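(* Let $\mathcal{B}=\{B,p,M,\mathbb{S}^1\}$ be a smooth circle bundle with total space $B$ and projection $p:B\to M$ over a closed connected manifold $M$ (not assumed orientable). If the fiber determines a nonzero class in $H_1(B;\mathbb{R})$, then $\mathcal{B}$ is smoothly foliated.
   Context: A smooth circle bundle is a smooth fiber bundle with fiber $\mathbb{S}^1$ (structure group $\mathrm{Diff}(\mathbb{S}^1)$, not assumed principal or orientable). "Closed manifold" means compact without boundary. The bundle is smoothly foliated if there is a $C^\infty$ codimension-one foliation of $B$ whose leaves are everywhere transverse to the fibers of $p$. *)

theory Defs
  imports "HOL-Analysis.Analysis" "HOL-Homology.Homology"
begin

section \<open>Model spaces\<close>

text \<open>
  Charts take values in finite-dimensional real inner product spaces.  The class
  \<^class>\<open>euclidean_space\<close> is not used for this because it has no zero-dimensional member, whereas a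
  closed manifold may be a point.  The Heine--Borel property follows from finite-dimensionality; it
  is part of the class only so that the library results about it apply.
\<close>

class model_space = real_inner + heine_borel +
  assumes finite_spanning_set: "\<exists>S. finite S \<and> (\<forall>x. \<exists>c. x = (\<Sum>v\<in>S. c v *\<^sub>R v))"

lemma finite_span_UNIV: "\<exists>S::'a::model_space set. finite S \<and> span S = UNIV"
proof -
  obtain S :: "'a set" where S: "finite S" "\<And>x. \<exists>c. x = (\<Sum>v\<in>S. c v *\<^sub>R v)"
    using finite_spanning_set by blast
  then have "span S = UNIV"
    by (auto simp: span_finite image_iff)
  with S(1) show ?thesis by blast
qed

lemma model_space_spanning_set:
  fixes S :: "'a::real_vector set"
  assumes "finite S" "span S = UNIV"
  shows "\<exists>S::'a set. finite S \<and> (\<forall>x. \<exists>c. x = (\<Sum>v\<in>S. c v *\<^sub>R v))"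
  using assms by (intro exI[of _ S]) (auto simp: span_finite)

instance euclidean_space \<subseteq> model_space
  by standard (rule model_space_spanning_set[OF finite_Basis span_Basis])

instance prod :: (model_space, model_space) model_space
proof
  obtain S :: "'a set" where S: "finite S" "span S = UNIV"
    using finite_span_UNIV by blast
  obtain T :: "'b set" where T: "finite T" "span T = UNIV"
    using finite_span_UNIV by blast
  let ?P = "(\<lambda>x. (x, 0::'b)) ` S \<union> (\<lambda>y. (0::'a, y)) ` T"
  have lin1: "linear (\<lambda>x::'a. (x, 0::'b))" and lin2: "linear (\<lambda>y::'b. (0::'a, y))"
    by (auto intro!: linearI)
  have "(x, y) \<in> span ?P" for x y
  proof -
    have "(x, 0) \<in> span ?P"
      using span_mono[of "(\<lambda>x. (x, 0::'b)) ` S" ?P] linear_span_image[OF lin1, of S] S by auto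
    moreover have "(0, y) \<in> span ?P"
      using span_mono[of "(\<lambda>y. (0::'a, y)) ` T" ?P] linear_span_image[OF lin2, of T] T by auto
    ultimately have "(x, 0) + (0, y) \<in> span ?P" by (rule span_add)
    then show ?thesis by simp
  qed
  then have "span ?P = UNIV" by auto
  then show "\<exists>S::('a \<times> 'b) set. finite S \<and> (\<forall>x. \<exists>c. x = (\<Sum>v\<in>S. c v *\<^sub>R v))"
    using S T by (intro model_space_spanning_set[of ?P]) auto
qed

text \<open>The zero-dimensional model space.\<close>

instantiation unit :: real_inner
begin

definition zero_unit :: unit where "zero_unit = ()"
definition plus_unit :: "unit \<Rightarrow> unit \<Rightarrow> unit" where "plus_unit x y = ()"
definition scaleR_unit :: "real \<Rightarrow> unit \<Rightarrow> unit" where "scaleR_unit r x = ()"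
definition inner_unit :: "unit \<Rightarrow> unit \<Rightarrow> real" where "inner_unit x y = 0"
definition norm_unit :: "unit \<Rightarrow> real" where "norm_unit x = 0"
definition dist_unit :: "unit \<Rightarrow> unit \<Rightarrow> real" where "dist_unit x y = 0"
definition sgn_unit :: "unit \<Rightarrow> unit" where "sgn_unit x = ()"
definition uniformity_unit :: "(unit \<times> unit) filter" where
  "uniformity_unit = (INF e\<in>{0<..}. principal {(x, y). dist x y < e})"
definition open_unit :: "unit set \<Rightarrow> bool" where
  "open_unit U \<longleftrightarrow> (\<forall>x\<in>U. eventually (\<lambda>(x', y). x' = x \<longrightarrow> y \<in> U) uniformity)"

instance
proof
  show "open U \<longleftrightarrow> (\<forall>x\<in>U. eventually (\<lambda>(x', y). x' = x \<longrightarrow> y \<in> U) uniformity)" for U :: "unit set"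
    by (simp add: open_unit_def)
qed (auto simp: uniformity_unit_def inner_unit_def norm_unit_def dist_unit_def)

end

instance unit :: model_space
proof
  show "\<exists>l r. strict_mono (r::nat \<Rightarrow> nat) \<and> ((f \<circ> r) \<longlongrightarrow> l) sequentially"
    for f :: "nat \<Rightarrow> unit"
    by (intro exI[of _ "()"] exI[of _ id]) (auto simp: strict_mono_def comp_def)
  show "\<exists>S::unit set. finite S \<and> (\<forall>x. \<exists>c. x = (\<Sum>v\<in>S. c v *\<^sub>R v))"
    by (rule exI[of _ UNIV]) auto
qed


section \<open>Smooth manifolds without boundary\<close>

text \<open>
  \<open>C_k_on k S f\<close> says that \<open>f\<close> is of class \<open>C\<^sup>k\<close> on the open set \<open>S\<close>: all iterated
  directional derivatives up to order \<open>k\<close> exist and are continuous.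
\<close>

primrec C_k_on ::
    "nat \<Rightarrow> 'a::real_normed_vector set \<Rightarrow> ('a \<Rightarrow> 'b::real_normed_vector) \<Rightarrow> bool" where
  "C_k_on 0 S f \<longleftrightarrow> continuous_on S f"
| "C_k_on (Suc k) S f \<longleftrightarrow>
     (\<forall>x\<in>S. f differentiable (at x)) \<and> (\<forall>v. C_k_on k S (\<lambda>x. frechet_derivative f (at x) v))"

definition smooth_on ::
    "'a::real_normed_vector set \<Rightarrow> ('a \<Rightarrow> 'b::real_normed_vector) \<Rightarrow> bool" where
  "smooth_on S f \<longleftrightarrow> (\<forall>k. C_k_on k S f)"

text \<open>A chart \<open>(U, \<phi>)\<close> consists of its domain and a function that is only relevant on the domain.\<close>

type_synonym ('a, 'e) chart = "'a set \<times> ('a \<Rightarrow> 'e)"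

definition is_chart :: "'a topology \<Rightarrow> ('a, 'e::model_space) chart \<Rightarrow> bool" where
  "is_chart X = (\<lambda>(U, \<phi>). openin X U \<and> open (\<phi> ` U) \<and>
     homeomorphic_map (subtopology X U) (top_of_set (\<phi> ` U)) \<phi>)"

definition transition_map :: "('a, 'e) chart \<Rightarrow> ('a, 'f) chart \<Rightarrow> 'e \<Rightarrow> 'f" where
  "transition_map = (\<lambda>(U, \<phi>) (V, \<psi>). \<psi> \<circ> inv_into U \<phi>)"

definition transition_domain :: "('a, 'e) chart \<Rightarrow> ('a, 'f) chart \<Rightarrow> 'e set" where
  "transition_domain = (\<lambda>(U, \<phi>) (V, \<psi>). \<phi> ` (U \<inter> V))"

definition smoothly_compatible ::
    "('a, 'e::model_space) chart \<Rightarrow> ('a, 'e) chart \<Rightarrow> bool" where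
  "smoothly_compatible c d \<longleftrightarrow>
     smooth_on (transition_domain c d) (transition_map c d) \<and>
     smooth_on (transition_domain d c) (transition_map d c)"

text \<open>A manifold carries a smooth atlas, not necessarily a maximal one.\<close>

record ('a, 'e) manifold =
  mtop :: "'a topology"
  atlas :: "('a, 'e) chart set"

definition smooth_manifold :: "('a, 'e::model_space) manifold \<Rightarrow> bool" where
  "smooth_manifold M \<longleftrightarrow>
     Hausdorff_space (mtop M) \<and> second_countable (mtop M) \<and>
     (\<forall>c\<in>atlas M. is_chart (mtop M) c) \<and>
     (\<Union>c\<in>atlas M. fst c) = topspace (mtop M) \<and>
     (\<forall>c\<in>atlas M. \<forall>d\<in>atlas M. smoothly_compatible c d)"

definition closed_manifold :: "('a, 'e::model_space) manifold \<Rightarrow> bool" where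
  "closed_manifold M \<longleftrightarrow> smooth_manifold M \<and> compact_space (mtop M)"

definition smooth_map ::
    "('a, 'e::model_space) manifold \<Rightarrow> ('b, 'f::model_space) manifold \<Rightarrow> ('a \<Rightarrow> 'b) \<Rightarrow> bool" where
  "smooth_map M N f \<longleftrightarrow>
     continuous_map (mtop M) (mtop N) f \<and>
     (\<forall>(U, \<phi>)\<in>atlas M. \<forall>(V, \<psi>)\<in>atlas N.
        smooth_on (\<phi> ` {x \<in> U. f x \<in> V}) (\<psi> \<circ> f \<circ> inv_into U \<phi>))"

definition diffeomorphism ::
    "('a, 'e::model_space) manifold \<Rightarrow> ('b, 'f::model_space) manifold \<Rightarrow> ('a \<Rightarrow> 'b) \<Rightarrow> bool" where
  "diffeomorphism M N f \<longleftrightarrow>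
     (\<exists>g. homeomorphic_maps (mtop M) (mtop N) f g \<and> smooth_map M N f \<and> smooth_map N M g)"

definition open_submanifold :: "('a, 'e) manifold \<Rightarrow> 'a set \<Rightarrow> ('a, 'e) manifold" where
  "open_submanifold M W =
     \<lparr>mtop = subtopology (mtop M) W, atlas = (\<lambda>(U, \<phi>). (U \<inter> W, \<phi>)) ` atlas M\<rparr>"

definition prod_manifold ::
    "('a, 'e) manifold \<Rightarrow> ('b, 'f) manifold \<Rightarrow> ('a \<times> 'b, 'e \<times> 'f) manifold" where
  "prod_manifold M N =
     \<lparr>mtop = prod_topology (mtop M) (mtop N),
      atlas = (\<lambda>((U, \<phi>), (V, \<psi>)). (U \<times> V, map_prod \<phi> \<psi>)) ` (atlas M \<times> atlas N)\<rparr>"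

text \<open>The circle as the unit circle in the complex plane; its charts are the branches of the angle.\<close>

definition circle :: "(complex, real) manifold" where
  "circle =
     \<lparr>mtop = top_of_set (sphere 0 1),
      atlas = range (\<lambda>a. (cis ` {a<..<a + 2 * pi}, inv_into {a<..<a + 2 * pi} cis))\<rparr>"


section \<open>Smooth circle bundles\<close>

definition fiber :: "('b, 'f) manifold \<Rightarrow> ('b \<Rightarrow> 'a) \<Rightarrow> 'a \<Rightarrow> 'b set" where
  "fiber B p x = {b \<in> topspace (mtop B). p b = x}"

text \<open>
  The changes of two local trivializations are automatically smooth families of diffeomorphisms of
  the circle, so the structure group \<open>Diff(\<bbbS>\<^sup>1)\<close> imposes no further condition.  The total space has
  dimension one more than the base; its charts take values in \<open>'e \<times> real\<close>.
\<close>

definition smooth_circle_bundle ::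
    "('b, 'e::model_space \<times> real) manifold \<Rightarrow> ('b \<Rightarrow> 'a) \<Rightarrow> ('a, 'e) manifold \<Rightarrow> bool" where
  "smooth_circle_bundle B p M \<longleftrightarrow>
     smooth_manifold B \<and> smooth_manifold M \<and> smooth_map B M p \<and>
     (\<forall>x\<in>topspace (mtop M). \<exists>U \<Phi>. openin (mtop M) U \<and> x \<in> U \<and>
        diffeomorphism (open_submanifold B {b \<in> topspace (mtop B). p b \<in> U})
          (prod_manifold (open_submanifold M U) circle) \<Phi> \<and>
        (\<forall>b\<in>topspace (mtop B). p b \<in> U \<longrightarrow> fst (\<Phi> b) = p b))"


section \<open>Codimension-one foliations\<close>

text \<open>
  A foliated atlas consists of charts of the smooth structure with values in products
  \<open>S \<times> T\<close>, such that the last coordinate of a transition map is locally a function of the last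
  coordinate.  The sets with constant last coordinate in a single chart are the plaques.
\<close>

definition codim1_foliation ::
    "('b, 'e::model_space \<times> real) manifold \<Rightarrow> ('b, 'e \<times> real) chart set \<Rightarrow> bool" where
  "codim1_foliation B F \<longleftrightarrow>
     (\<forall>c\<in>F. is_chart (mtop B) c \<and> (\<forall>d\<in>atlas B. smoothly_compatible c d)) \<and>
     (\<Union>c\<in>F. fst c) = topspace (mtop B) \<and>
     (\<forall>(U, \<phi>)\<in>F. \<exists>S T. open S \<and> connected S \<and> open T \<and> connected T \<and> \<phi> ` U = S \<times> T) \<and>
     (\<forall>c\<in>F. \<forall>d\<in>F. \<forall>z\<in>transition_domain c d.
        \<exists>W g. open W \<and> z \<in> W \<and> W \<subseteq> transition_domain c d \<and>
          (\<forall>w\<in>W. snd (transition_map c d w) = g (snd w)))"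

definition same_plaque :: "('b, 'e \<times> real) chart set \<Rightarrow> 'b \<Rightarrow> 'b \<Rightarrow> bool" where
  "same_plaque F a b \<longleftrightarrow> (\<exists>(U, \<phi>)\<in>F. a \<in> U \<and> b \<in> U \<and> snd (\<phi> a) = snd (\<phi> b))"

definition leaf :: "('b, 'e \<times> real) chart set \<Rightarrow> 'b \<Rightarrow> 'b set" where
  "leaf F b = {c. (same_plaque F)\<^sup>*\<^sup>* b c}"

text \<open>
  The tangent space at \<open>b\<close> of a subset \<open>L\<close> of a manifold, expressed in a chart around \<open>b\<close>: the
  velocities of the smooth curves of the manifold that run in \<open>L\<close>.  For a submanifold this is the
  usual tangent space.  This includes leaves: a leaf meets the domain of a foliated chart in
  countably many plaques, so a curve in it stays in one plaque as long as it stays in that domain.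
\<close>

definition tangent_space ::
    "('b, 'f::model_space) chart \<Rightarrow> 'b set \<Rightarrow> 'b \<Rightarrow> 'f set" where
  "tangent_space = (\<lambda>(U, \<phi>) L b.
     {v. \<exists>\<gamma> \<epsilon>. \<epsilon> > 0 \<and> \<gamma> 0 = b \<and> (\<forall>t\<in>{-\<epsilon><..<\<epsilon>}. \<gamma> t \<in> U \<inter> L) \<and>
        smooth_on {-\<epsilon><..<\<epsilon>} (\<phi> \<circ> \<gamma>) \<and> ((\<phi> \<circ> \<gamma>) has_vector_derivative v) (at (0::real))})"

definition transverse_at ::
    "('b, 'f::model_space) manifold \<Rightarrow> 'b set \<Rightarrow> 'b set \<Rightarrow> 'b \<Rightarrow> bool" where
  "transverse_at B L N b \<longleftrightarrow>
     (\<forall>c\<in>atlas B. b \<in> fst c \<longrightarrow>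
        {u + v |u v. u \<in> tangent_space c L b \<and> v \<in> tangent_space c N b} = UNIV)"

definition smoothly_foliated ::
    "('b, 'e::model_space \<times> real) manifold \<Rightarrow> ('b \<Rightarrow> 'a) \<Rightarrow> bool" where
  "smoothly_foliated B p \<longleftrightarrow>
     (\<exists>F. codim1_foliation B F \<and>
        (\<forall>b\<in>topspace (mtop B). transverse_at B (leaf F b) (fiber B p (p b)) b))"


section \<open>Singular homology with real coefficients\<close>

text \<open>
  The library has integral singular homology only.  The following repeats its construction with
  \<^typ>\<open>real\<close> in place of \<^typ>\<open>int\<close>, in the absolute case.
\<close>

type_synonym 'a real_chain = "((nat \<Rightarrow> real) \<Rightarrow> 'a) \<Rightarrow>\<^sub>0 real"

definition real_singular_chain :: "nat \<Rightarrow> 'a topology \<Rightarrow> 'a real_chain \<Rightarrow> bool" where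
  "real_singular_chain n X c \<longleftrightarrow> Poly_Mapping.keys c \<subseteq> singular_simplex_set n X"

definition real_boundary :: "nat \<Rightarrow> 'a real_chain \<Rightarrow> 'a real_chain" where
  "real_boundary n c =
     (if n = 0 then 0
      else \<Sum>f\<in>Poly_Mapping.keys c. \<Sum>k\<le>n.
             Poly_Mapping.single (singular_face n k f) ((-1) ^ k * Poly_Mapping.lookup c f))"

definition real_cycle_group :: "nat \<Rightarrow> 'a topology \<Rightarrow> 'a real_chain monoid" where
  "real_cycle_group n X =
     \<lparr>carrier = {c. real_singular_chain n X c \<and> real_boundary n c = 0}, monoid.mult = (+), one = 0\<rparr>"

definition real_boundary_set :: "nat \<Rightarrow> 'a topology \<Rightarrow> 'a real_chain set" where
  "real_boundary_set n X = real_boundary (Suc n) ` {c. real_singular_chain (Suc n) X c}"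

definition real_homology_group :: "nat \<Rightarrow> 'a topology \<Rightarrow> 'a real_chain set monoid" where
  "real_homology_group n X = real_cycle_group n X Mod real_boundary_set n X"

definition real_homology_class :: "nat \<Rightarrow> 'a topology \<Rightarrow> 'a real_chain \<Rightarrow> 'a real_chain set" where
  "real_homology_class n X c = real_boundary_set n X #>\<^bsub>real_cycle_group n X\<^esub> c"

text \<open>
  The singular 1-simplex that runs once around the circle; on the standard 1-simplex the coordinate
  \<open>t 1\<close> runs from 0 to 1.
\<close>

definition circle_simplex :: "(nat \<Rightarrow> real) \<Rightarrow> complex" where
  "circle_simplex = restrict (\<lambda>t. cis (2 * pi * t 1)) (standard_simplex 1)"

text \<open>
  The class in \<open>H\<^sub>1(X;\<real>)\<close> of the image of the fundamental class of the circle.  For a homeomorphism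
  \<open>h\<close> onto a fiber it depends on \<open>h\<close> only up to sign.
\<close>

definition circle_class :: "'a topology \<Rightarrow> (complex \<Rightarrow> 'a) \<Rightarrow> 'a real_chain set" where
  "circle_class X h =
     real_homology_class 1 X (Poly_Mapping.single (simplex_map 1 h circle_simplex) 1)"

end

theory Submission
  imports Defs
begin

text \<open>
  A nonzero class of the fiber is detected by a real singular cocycle \<open>l\<close>, regarded as a function on
  paths that is additive on singular triangles.  In a local parametrization \<open>\<Psi>\<^sub>k (y, t)\<close> of the bundle
  over a coordinate ball, \<open>t\<close> being a lifted angle, straight segments give a primitive \<open>G\<^sub>k\<close> of \<open>l\<close> with
  \<open>G\<^sub>k (y, t + 2 \<pi>) = G\<^sub>k (y, t) + \<epsilon>\<^sub>k\<close>, and \<open>c\<^sub>k = G\<^sub>k - \<epsilon>\<^sub>k t / (2 \<pi>)\<close> descends to the bundle.  On an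
  overlap, \<open>G\<^sub>k - c\<^sub>j\<close> is locally \<open>\<epsilon>\<^sub>j / (2 \<pi>)\<close> times the \<open>j\<close>-th angle plus a constant; it is smooth, its
  derivative along the fiber has no zero if \<open>\<epsilon>\<^sub>j \<noteq> 0\<close>, and it grows by \<open>\<epsilon>\<^sub>k\<close> per turn, so the derivative has
  the sign of \<open>\<epsilon>\<^sub>k\<close>.  In particular \<open>\<epsilon>\<^sub>j \<noteq> 0\<close> propagates to \<open>\<epsilon>\<^sub>k\<close>, hence over the connected base.
  Averaging the \<open>c\<^sub>j\<close> with bump functions \<open>\<rho>\<^sub>j\<close> pulled back from the base, the function
  \<open>G\<^sub>k - (\<Sum>j. \<rho>\<^sub>j c\<^sub>j) / (\<Sum>j. \<rho>\<^sub>j)\<close> is smooth with nonzero derivative along the fibers, and for different \<open>k\<close>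
  these functions differ locally by constants.  Their level sets are the leaves.
\<close>

section \<open>Calculus of smooth functions\<close>

text \<open>The cocycle comes from linear extension on a huge space of chains and has no continuity:
  adding to it the coboundary of an arbitrary function on \<open>B\<close> changes every primitive
  and every reduced primitive by that function, up to constants. So neither is smooth by itself.
  Only differences are, because the arbitrary part cancels there, and all averages are therefore
  rewritten as averages of differences. This takes the place of the de Rham theorem; no form is ever
  integrated. No global angle exists, since orientability of the fibers is not assumed. But
  reversing the angle in one parametrization changes the sign of its period as well, so the product
  of period and angle does not notice the reversal. This is why all differences seen from one
  parametrization have fiber derivatives of one sign, and why a weighted mean of them cannot vanish.
  Angles range over all reals rather than over the circle, so that the parameter domain is convex
  and each path in it can be compared with a segment.\<close>

lemma orthonormal_set_spanning_finite_set:
  fixes S :: "'a::real_inner set"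
  assumes "finite S"
  shows "\<exists>E. finite E \<and> (\<forall>e\<in>E. \<forall>e'\<in>E. e \<bullet> e' = (if e = e' then 1 else 0)) \<and> S \<subseteq> span E"
  using assms
proof (induction S)
  case empty
  then show ?case by (intro exI[of _ "{}"]) auto
next
  case (insert a S)
  then obtain E where E: "finite E" "\<And>e e'. e \<in> E \<Longrightarrow> e' \<in> E \<Longrightarrow> e \<bullet> e' = (if e = e' then 1 else 0)"
    "S \<subseteq> span E" by blast
  \<comment> \<open>Gram-Schmidt: only the component of \<open>a\<close> orthogonal to
    \<open>E\<close> is new, and nothing is added if it vanishes.\<close>
  define a' where "a' = a - (\<Sum>e\<in>E. (a \<bullet> e) *\<^sub>R e)"
  have orth: "a' \<bullet> e = 0" if "e \<in> E" for e
  proof -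
    have "(\<Sum>e'\<in>E. (a \<bullet> e') * (e' \<bullet> e)) = (\<Sum>e'\<in>E. if e' = e then a \<bullet> e else 0)"
      using that by (intro sum.cong) (auto simp: E(2))
    also have "\<dots> = a \<bullet> e" using that E(1) by simp
    finally show ?thesis by (simp add: a'_def inner_diff_left inner_sum_left)
  qed
  have proj: "(\<Sum>e\<in>E. (a \<bullet> e) *\<^sub>R e) \<in> span E"
    by (intro span_sum span_scale span_base)
  have aeq: "a = a' + (\<Sum>e\<in>E. (a \<bullet> e) *\<^sub>R e)" by (simp add: a'_def)
  show ?case
  proof (cases "a' = 0")
    case True
    with aeq proj have "a \<in> span E" by simp
    with E show ?thesis by (intro exI[of _ E]) auto
  next
    case False
    let ?n = "a' /\<^sub>R norm a'"
    let ?E = "insert ?n E"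
    have sub: "span E \<subseteq> span ?E" by (rule span_mono) auto
    have "norm a' *\<^sub>R ?n \<in> span ?E" by (intro span_scale span_base) auto
    then have "a' \<in> span ?E" using False by simp
    then have "a \<in> span ?E" using aeq proj sub by (metis span_add subsetD)
    moreover have "?n \<bullet> ?n = 1" using False
      by (simp add: power2_norm_eq_inner[symmetric] field_simps power2_eq_square)
    moreover have "?n \<bullet> e = 0" "e \<bullet> ?n = 0" if "e \<in> E" for e
      using orth[OF that] by (simp_all add: inner_commute)
    moreover have "?n \<notin> E" using calculation(2,3) by force
    ultimately show ?thesis using E sub False
      by (intro exI[of _ ?E]) (auto split: if_splits simp del: inner_scaleR_left inner_scaleR_right)
  qed
qed

text \<open>Coordinates in a space that need not be a \<open>euclidean_space\<close>. The chain rule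
  for iterated derivatives needs finitely many fixed directions in which a varying vector can be
  expanded.\<close>

lemma orthonormal_expansion:
  "\<exists>E::'a::model_space set. finite E \<and> (\<forall>x. x = (\<Sum>e\<in>E. (x \<bullet> e) *\<^sub>R e))"
proof -
  obtain S :: "'a set" where S: "finite S" "span S = UNIV"
    using finite_span_UNIV by blast
  obtain E :: "'a set" where E: "finite E"
    "\<And>e e'. e \<in> E \<Longrightarrow> e' \<in> E \<Longrightarrow> e \<bullet> e' = (if e = e' then 1 else 0)" "S \<subseteq> span E"
    using orthonormal_set_spanning_finite_set[OF S(1)] by blast
  have UE: "span E = UNIV"
    using S(2) span_mono[OF E(3)] by (simp add: span_span top.extremum_uniqueI)
  have "x = (\<Sum>e\<in>E. (x \<bullet> e) *\<^sub>R e)" for x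
  proof -
    have "x \<in> range (\<lambda>u. \<Sum>v\<in>E. u v *\<^sub>R v)"
      using UE span_finite[OF E(1)] by blast
    then obtain c where c: "x = (\<Sum>v\<in>E. c v *\<^sub>R v)" by auto
    have "x \<bullet> e = c e" if "e \<in> E" for e
    proof -
      have "(\<Sum>v\<in>E. c v * (v \<bullet> e)) = (\<Sum>v\<in>E. if v = e then c e else 0)"
        using that by (intro sum.cong) (auto simp: E(2))
      also have "\<dots> = c e" using that E(1) by simp
      finally show ?thesis by (simp add: c inner_sum_left)
    qed
    then show ?thesis by (subst c) (auto intro: sum.cong)
  qed
  with E(1) show ?thesis by blast
qed

section \<open>Closure properties of the classes C^k\<close>

lemma C_k_on_subset: "C_k_on k S f \<Longrightarrow> T \<subseteq> S \<Longrightarrow> C_k_on k T f"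
  by (induction k arbitrary: f) (auto intro: continuous_on_subset)

text \<open>Derivatives see the values near a point, so openness of \<open>S\<close> carries the
  agreement of \<open>f\<close> and \<open>g\<close> over to their derivatives, and the induction
  can go on.\<close>

lemma C_k_on_cong:
  assumes "open S" "\<And>x. x \<in> S \<Longrightarrow> f x = g x" "C_k_on k S f"
  shows "C_k_on k S g"
  using assms(2,3)
proof (induction k arbitrary: f g)
  case 0
  then show ?case using continuous_on_cong[of S S f g] by simp
next
  case (Suc k)
  have ev: "(g has_derivative D) (at x)" if "(f has_derivative D) (at x)" "x \<in> S" for x D
    using has_derivative_transform_within_open[OF that(1) assms(1) that(2)] Suc.prems(1) by auto
  have der: "frechet_derivative f (at x) = frechet_derivative g (at x)" if "x \<in> S" for x
    using frechet_derivative_at[OF ev[of "frechet_derivative f (at x)"]] Suc.prems(2) that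
    by (simp add: frechet_derivative_works)
  have "C_k_on k S (\<lambda>x. frechet_derivative g (at x) v)" for v
    by (rule Suc.IH[of "\<lambda>x. frechet_derivative f (at x) v"]) (use Suc.prems(2) der in auto)
  then show ?case using Suc.prems(2) ev unfolding C_k_on.simps differentiable_def by blast
qed

lemma C_k_on_local:
  assumes "\<And>x. x \<in> S \<Longrightarrow> \<exists>U. open U \<and> x \<in> U \<and> C_k_on k U f"
  shows "C_k_on k S f"
  using assms
proof (induction k arbitrary: f)
  case 0
  have "isCont f x" if "x \<in> S" for x
    using 0[OF that] by (auto simp: continuous_on_eq_continuous_at)
  then show ?case by (simp add: continuous_at_imp_continuous_on)
next
  case (Suc k)
  have "C_k_on k S (\<lambda>x. frechet_derivative f (at x) v)" for v
    by (rule Suc.IH) (use Suc.prems in fastforce)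
  then show ?case using Suc.prems by fastforce
qed

lemma C_k_on_Suc_imp: "C_k_on (Suc k) S f \<Longrightarrow> C_k_on k S f"
proof (induction k arbitrary: f)
  case 0
  then show ?case
    by (auto intro!: continuous_at_imp_continuous_on differentiable_imp_continuous_within)
next
  case (Suc k)
  then show ?case unfolding C_k_on.simps(2)[of "Suc k"] C_k_on.simps(2)[of k] by blast
qed

text \<open>Since derivatives are unique, an explicit formula \<open>D\<close> may stand for
  \<open>frechet_derivative\<close>; the inductions below differentiate through this rule.\<close>

lemma C_k_on_SucI:
  assumes "open S" "\<And>x. x \<in> S \<Longrightarrow> (f has_derivative D x) (at x)" "\<And>v. C_k_on k S (\<lambda>x. D x v)"
  shows "C_k_on (Suc k) S f"
proof -
  have "frechet_derivative f (at x) = D x" if "x \<in> S" for x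
    using assms(2)[OF that] frechet_derivative_at by metis
  then have "C_k_on k S (\<lambda>x. frechet_derivative f (at x) v)" for v
    by (intro C_k_on_cong[OF assms(1) _ assms(3)[of v]]) auto
  then show ?thesis using assms(2) by (auto simp: differentiable_def)
qed

lemma C_k_on_SucD:
  assumes "C_k_on (Suc k) S f" "x \<in> S"
  shows "(f has_derivative frechet_derivative f (at x)) (at x)"
  using assms by (simp add: frechet_derivative_works)

lemma C_k_on_const: "open S \<Longrightarrow> C_k_on k S (\<lambda>x. c)"
proof (induction k arbitrary: c)
  case (Suc k)
  then show ?case by (intro C_k_on_SucI[where D="\<lambda>x v. 0"]) auto
qed auto

lemma C_k_on_bounded_linear:
  assumes "bounded_linear L" "open S"
  shows "C_k_on k S L"
proof (cases k)
  case 0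
  then show ?thesis using assms by (simp add: linear_continuous_on)
next
  case (Suc m)
  have "C_k_on (Suc m) S L" using assms
    by (intro C_k_on_SucI[where D="\<lambda>x. L"] bounded_linear_imp_has_derivative C_k_on_const)
  with Suc show ?thesis by simp
qed

lemma C_k_on_linear_compose:
  assumes "bounded_linear L" "open S" "C_k_on k S f"
  shows "C_k_on k S (\<lambda>x. L (f x))"
  using assms(3)
proof (induction k arbitrary: f)
  case 0
  then show ?case using bounded_linear.continuous_on[OF assms(1)] by simp
next
  case (Suc k)
  show ?case
  proof (rule C_k_on_SucI[OF assms(2)])
    show "((\<lambda>x. L (f x)) has_derivative (\<lambda>v. L (frechet_derivative f (at x) v))) (at x)"
      if "x \<in> S" for x
      by (rule bounded_linear.has_derivative[OF assms(1) C_k_on_SucD[OF Suc.prems that]])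
    show "C_k_on k S (\<lambda>x. L (frechet_derivative f (at x) v))" for v
      by (rule Suc.IH) (use Suc.prems in simp)
  qed
qed

lemma C_k_on_add:
  assumes "open S" "C_k_on k S f" "C_k_on k S g"
  shows "C_k_on k S (\<lambda>x. f x + g x)"
  using assms(2,3)
proof (induction k arbitrary: f g)
  case 0
  then show ?case by (simp add: continuous_on_add)
next
  case (Suc k)
  show ?case
  proof (rule C_k_on_SucI[OF assms(1)])
    show "((\<lambda>x. f x + g x) has_derivative
        (\<lambda>v. frechet_derivative f (at x) v + frechet_derivative g (at x) v)) (at x)" if "x \<in> S" for x
      using Suc.prems C_k_on_SucD that by (intro has_derivative_add) blast+
    show "C_k_on k S (\<lambda>x. frechet_derivative f (at x) v + frechet_derivative g (at x) v)" for v
      by (rule Suc.IH) (use Suc.prems in simp_all)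
  qed
qed

lemma C_k_on_sum:
  assumes "open S" "\<And>i. i \<in> I \<Longrightarrow> C_k_on k S (f i)"
  shows "C_k_on k S (\<lambda>x. \<Sum>i\<in>I. f i x)"
  using assms(2) by (induction I rule: infinite_finite_induct)
    (auto intro: C_k_on_add C_k_on_const assms(1))

text \<open>The Leibniz rule produces two terms of the same shape in which one factor is
  differentiated; the other factor is weakened by one order to fit the induction hypothesis.\<close>

lemma C_k_on_bilinear:
  assumes "bounded_bilinear P" "open S" "C_k_on k S f" "C_k_on k S g"
  shows "C_k_on k S (\<lambda>x. P (f x) (g x))"
  using assms(3,4)
proof (induction k arbitrary: f g)
  case 0
  then show ?case using bounded_bilinear.continuous_on[OF assms(1)] by simp
next
  case (Suc k)
  show ?case
  proof (rule C_k_on_SucI[OF assms(2)])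
    show "((\<lambda>x. P (f x) (g x)) has_derivative
        (\<lambda>v. P (f x) (frechet_derivative g (at x) v) + P (frechet_derivative f (at x) v) (g x))) (at x)"
      if "x \<in> S" for x
      by (rule bounded_bilinear.FDERIV[OF assms(1)])
        (use Suc.prems C_k_on_SucD that in blast)+
    show "C_k_on k S (\<lambda>x. P (f x) (frechet_derivative g (at x) v) + P (frechet_derivative f (at x) v) (g x))"
      for v
    proof (intro C_k_on_add assms(2) Suc.IH)
      show "C_k_on k S f" "C_k_on k S g" using Suc.prems C_k_on_Suc_imp by blast+
    qed (use Suc.prems in simp_all)
  qed
qed

text \<open>The chain rule differentiates \<open>f\<close> in a direction that varies with the
  point, whereas \<open>C_k_on\<close> speaks of fixed directions. Expanding the varying direction
  in an orthonormal set gives a finite sum of products, and the induction runs over \<open>f\<close>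
  with \<open>g\<close> unchanged.\<close>

lemma C_k_on_compose:
  fixes f :: "'a::model_space \<Rightarrow> 'b::real_normed_vector" and g :: "'c::real_normed_vector \<Rightarrow> 'a"
  assumes "open S" "C_k_on k T f" "C_k_on k S g" "\<And>x. x \<in> S \<Longrightarrow> g x \<in> T"
  shows "C_k_on k S (\<lambda>x. f (g x))"
  using assms(2,3,4)
proof (induction k arbitrary: f)
  case 0
  then show ?case by (auto intro: continuous_on_compose2)
next
  case (Suc k)
  obtain E :: "'a set" where E: "finite E" "\<And>x. x = (\<Sum>e\<in>E. (x \<bullet> e) *\<^sub>R e)"
    using orthonormal_expansion by blast
  let ?f' = "\<lambda>x. frechet_derivative f (at x)" and ?g' = "\<lambda>x. frechet_derivative g (at x)"
  show ?case
  proof (rule C_k_on_SucI[OF assms(1)])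
    show "((\<lambda>x. f (g x)) has_derivative (\<lambda>v. \<Sum>e\<in>E. (?g' x v \<bullet> e) *\<^sub>R ?f' (g x) e)) (at x)"
      if "x \<in> S" for x
    proof -
      have f: "(f has_derivative ?f' (g x)) (at (g x))"
        using C_k_on_SucD[OF Suc.prems(1)] Suc.prems(3) that by blast
      interpret bounded_linear "?f' (g x)" using f by (rule has_derivative_bounded_linear)
      have "?f' (g x) w = (\<Sum>e\<in>E. (w \<bullet> e) *\<^sub>R ?f' (g x) e)" for w
        by (subst E(2)[of w]) (simp add: sum scaleR)
      then show ?thesis
        using has_derivative_compose[OF C_k_on_SucD[OF Suc.prems(2) that] f]
        by (metis (no_types, lifting) ext)
    qed
    show "C_k_on k S (\<lambda>x. \<Sum>e\<in>E. (?g' x v \<bullet> e) *\<^sub>R ?f' (g x) e)" for v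
    proof (intro C_k_on_sum C_k_on_bilinear[OF bounded_bilinear_scaleR] assms(1))
      fix e assume "e \<in> E"
      show "C_k_on k S (\<lambda>x. ?g' x v \<bullet> e)"
        by (rule C_k_on_linear_compose[OF bounded_linear_inner_left assms(1)]) (use Suc.prems in simp)
      show "C_k_on k S (\<lambda>x. ?f' (g x) e)"
        by (rule Suc.IH) (use Suc.prems C_k_on_Suc_imp in auto)
    qed
  qed
qed

text \<open>The derivative is again a polynomial in \<open>inverse\<close>, so the induction feeds
  on itself.\<close>

lemma C_k_on_inverse: "C_k_on k (- {0::real}) inverse"
proof (induction k)
  case (Suc k)
  show ?case
  proof (rule C_k_on_SucI)
    show "(inverse has_derivative (\<lambda>v. - (inverse x * v * inverse x))) (at x)" if "x \<in> - {0}" for x :: real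
      using that has_derivative_inverse'[of x UNIV] by simp
    have "C_k_on k (- {0}) (\<lambda>x::real. (-v) * (inverse x * inverse x))" for v
      by (intro C_k_on_bilinear[OF bounded_bilinear_mult] C_k_on_const Suc.IH) auto
    then show "C_k_on k (- {0}) (\<lambda>x::real. - (inverse x * v * inverse x))" for v
      by (rule C_k_on_cong[rotated 2]) (auto simp: algebra_simps)
  qed auto
qed (auto intro!: continuous_intros)

lemma C_k_on_divide:
  fixes f g :: "'a::real_normed_vector \<Rightarrow> real"
  assumes "open S" "C_k_on k S f" "C_k_on k S g" "\<And>x. x \<in> S \<Longrightarrow> g x \<noteq> 0"
  shows "C_k_on k S (\<lambda>x. f x / g x)"
proof -
  have "C_k_on k S (\<lambda>x. inverse (g x))"
    using C_k_on_compose[OF assms(1) C_k_on_inverse assms(3)] assms(4) by simp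
  from C_k_on_bilinear[OF bounded_bilinear_mult assms(1,2) this]
  show ?thesis by (simp add: divide_inverse)
qed

lemma C_k_on_Pair:
  assumes "open S" "C_k_on k S f" "C_k_on k S g"
  shows "C_k_on k S (\<lambda>x. (f x, g x))"
proof -
  have "bounded_linear (\<lambda>x::'b. (x, 0::'c))" "bounded_linear (\<lambda>x::'c. (0::'b, x))"
    by (intro bounded_linear_Pair bounded_linear_ident bounded_linear_zero)+
  from C_k_on_add[OF assms(1) C_k_on_linear_compose[OF this(1) assms(1,2)]
      C_k_on_linear_compose[OF this(2) assms(1,3)]]
  show ?thesis by simp
qed

section \<open>Smooth functions\<close>

lemma smooth_on_subset: "smooth_on S f \<Longrightarrow> T \<subseteq> S \<Longrightarrow> smooth_on T f"
  using C_k_on_subset unfolding smooth_on_def by blast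

lemma smooth_on_cong:
  "smooth_on S f \<Longrightarrow> open S \<Longrightarrow> (\<And>x. x \<in> S \<Longrightarrow> f x = g x) \<Longrightarrow> smooth_on S g"
  using C_k_on_cong unfolding smooth_on_def by blast

lemma smooth_on_local:
  "(\<And>x. x \<in> S \<Longrightarrow> \<exists>U. open U \<and> x \<in> U \<and> smooth_on U f) \<Longrightarrow> smooth_on S f"
  unfolding smooth_on_def by (intro allI C_k_on_local) blast

lemma smooth_on_differentiable:
  assumes "smooth_on S f" "x \<in> S"
  shows "(f has_derivative frechet_derivative f (at x)) (at x)"
  using assms C_k_on_SucD unfolding smooth_on_def by blast

lemma smooth_on_continuous_on: "smooth_on S f \<Longrightarrow> continuous_on S f"
  unfolding smooth_on_def using C_k_on.simps(1) by blast

lemma smooth_on_directional_derivative: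
  "smooth_on S f \<Longrightarrow> smooth_on S (\<lambda>x. frechet_derivative f (at x) v)"
  unfolding smooth_on_def using C_k_on.simps(2) by blast

lemma smooth_on_const: "open S \<Longrightarrow> smooth_on S (\<lambda>x. c)"
  unfolding smooth_on_def using C_k_on_const by blast

lemma smooth_on_bounded_linear: "bounded_linear L \<Longrightarrow> open S \<Longrightarrow> smooth_on S L"
  unfolding smooth_on_def using C_k_on_bounded_linear by blast

lemma smooth_on_ident: "open S \<Longrightarrow> smooth_on S (\<lambda>x. x)"
  by (rule smooth_on_bounded_linear) (auto simp: bounded_linear_ident)

lemma smooth_on_add:
  "open S \<Longrightarrow> smooth_on S f \<Longrightarrow> smooth_on S g \<Longrightarrow> smooth_on S (\<lambda>x. f x + g x)"
  unfolding smooth_on_def using C_k_on_add by blast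

lemma smooth_on_sum:
  "open S \<Longrightarrow> (\<And>i. i \<in> I \<Longrightarrow> smooth_on S (f i)) \<Longrightarrow> smooth_on S (\<lambda>x. \<Sum>i\<in>I. f i x)"
  unfolding smooth_on_def by (simp add: C_k_on_sum)

lemma smooth_on_bilinear:
  "bounded_bilinear P \<Longrightarrow> open S \<Longrightarrow> smooth_on S f \<Longrightarrow> smooth_on S g \<Longrightarrow> smooth_on S (\<lambda>x. P (f x) (g x))"
  unfolding smooth_on_def by (simp add: C_k_on_bilinear)

lemmas smooth_on_mult = smooth_on_bilinear[OF bounded_bilinear_mult]
lemmas smooth_on_inner = smooth_on_bilinear[OF bounded_bilinear_inner]
lemmas smooth_on_scaleR = smooth_on_bilinear[OF bounded_bilinear_scaleR]

lemma smooth_on_Pair: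
  "open S \<Longrightarrow> smooth_on S f \<Longrightarrow> smooth_on S g \<Longrightarrow> smooth_on S (\<lambda>x. (f x, g x))"
  unfolding smooth_on_def using C_k_on_Pair by blast

lemma smooth_on_compose:
  fixes f :: "'a::model_space \<Rightarrow> 'b::real_normed_vector" and g :: "'c::real_normed_vector \<Rightarrow> 'a"
  assumes "open S" "smooth_on T f" "smooth_on S g" "\<And>x. x \<in> S \<Longrightarrow> g x \<in> T"
  shows "smooth_on S (\<lambda>x. f (g x))"
  using assms(2,3) C_k_on_compose[OF assms(1), of _ T f g] assms(4) unfolding smooth_on_def by blast

lemma smooth_on_divide:
  fixes f g :: "'a::real_normed_vector \<Rightarrow> real"
  assumes "open S" "smooth_on S f" "smooth_on S g" "\<And>x. x \<in> S \<Longrightarrow> g x \<noteq> 0"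
  shows "smooth_on S (\<lambda>x. f x / g x)"
  using assms C_k_on_divide unfolding smooth_on_def by blast

section \<open>A smooth cutoff function\<close>

text \<open>The bump functions use only \<open>n = 0\<close>. The other members are there because
  the derivative of \<open>cutoff n\<close> is a combination of \<open>cutoff (n + 1)\<close> and
  \<open>cutoff (n + 2)\<close>, which makes smoothness an induction over the order with
  \<open>n\<close> arbitrary.\<close>

definition cutoff :: "nat \<Rightarrow> real \<Rightarrow> real" where
  "cutoff n x = (if 0 < x then exp (- inverse x) * inverse x ^ n else 0)"

lemma cutoff_tendsto_0: "(cutoff n \<longlongrightarrow> 0) (at 0)"
proof -
  have "((\<lambda>x::real. inverse x ^ n / exp (inverse x)) \<longlongrightarrow> 0) (at_right 0)"
    by (rule filterlim_compose[OF tendsto_power_div_exp_0 filterlim_inverse_at_top_right])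
  then have r: "(cutoff n \<longlongrightarrow> 0) (at_right 0)"
    by (rule Lim_transform_eventually)
      (auto simp: eventually_at_filter cutoff_def exp_minus field_simps)
  have l: "(cutoff n \<longlongrightarrow> 0) (at_left 0)"
    by (rule Lim_transform_eventually[OF tendsto_const])
      (auto simp: eventually_at_filter cutoff_def)
  show ?thesis using l r filterlim_split_at by blast
qed

lemma cutoff_DERIV:
  "(cutoff n has_real_derivative (cutoff (n + 2) x - real n * cutoff (n + 1) x)) (at x)"
proof -
  consider "x > 0" | "x < 0" | "x = 0" by linarith
  then show ?thesis
  proof cases
    case 1
    have "((\<lambda>x. exp (- inverse x) * inverse x ^ n) has_real_derivative
       (cutoff (n + 2) x - real n * cutoff (n + 1) x)) (at x)"
    proof (cases n)
      case (Suc m)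
      then show ?thesis using 1
        by (auto intro!: derivative_eq_intros simp: cutoff_def power2_eq_square algebra_simps)
          (metis One_nat_def power_eq_if)
    qed (use 1 in \<open>auto intro!: derivative_eq_intros simp: cutoff_def power2_eq_square\<close>)
    then show ?thesis
      by (rule has_field_derivative_transform_within_open[of _ _ _ "{0<..}"]) (use 1 in \<open>auto simp: cutoff_def\<close>)
  next
    case 2
    have "((\<lambda>x. 0) has_real_derivative (cutoff (n + 2) x - real n * cutoff (n + 1) x)) (at x)"
      using 2 by (simp add: cutoff_def)
    then show ?thesis
      by (rule has_field_derivative_transform_within_open[of _ _ _ "{..<0}"]) (use 2 in \<open>auto simp: cutoff_def\<close>)
  next
    case 3
    \<comment> \<open>Away from zero the difference quotient of \<open>cutoff n\<close> is
      \<open>cutoff (n + 1)\<close>.\<close>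
    have "((\<lambda>h. (cutoff n (0 + h) - cutoff n 0) / h) \<longlongrightarrow> 0) (at 0)"
      by (rule Lim_transform_eventually[OF cutoff_tendsto_0[of "n + 1"]])
        (auto simp: eventually_at_filter cutoff_def field_simps)
    then show ?thesis using 3 by (simp add: DERIV_def cutoff_def)
  qed
qed

lemma smooth_on_cutoff: "smooth_on UNIV (cutoff n)"
proof -
  have "C_k_on k UNIV (cutoff n)" for k
  proof (induction k arbitrary: n)
    case 0
    then show ?case
      by (auto intro!: continuous_at_imp_continuous_on DERIV_isCont[OF cutoff_DERIV])
  next
    case (Suc k)
    show ?case
    proof (rule C_k_on_SucI)
      show "(cutoff n has_derivative (\<lambda>v. (cutoff (n + 2) x + (- real n) * cutoff (n + 1) x) * v)) (at x)" for x
        using cutoff_DERIV[of n x] by (simp add: has_field_derivative_def)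
      show "C_k_on k UNIV (\<lambda>x. (cutoff (n + 2) x + (- real n) * cutoff (n + 1) x) * v)" for v
        by (intro C_k_on_bilinear[OF bounded_bilinear_mult] C_k_on_add C_k_on_const Suc.IH) auto
    qed auto
  qed
  then show ?thesis by (simp add: smooth_on_def)
qed

section \<open>Path cocycles from real cohomology\<close>

text \<open>A basis of \<open>W\<close> stays independent when \<open>v\<close> is added, which
  leaves the value at \<open>v\<close> free. Applied to the subspace of boundaries this yields a
  cocycle that detects a nonzero class.\<close>

lemma (in vector_space_pair) functional_vanishing_on_subspace:
  assumes "vs1.subspace W" "v \<notin> W"
  shows "\<exists>f. Vector_Spaces.linear s1 s2 f \<and> (\<forall>w\<in>W. f w = 0) \<and> f v = c"
proof -
  obtain A where A: "A \<subseteq> W" "vs1.independent A" "W \<subseteq> vs1.span A"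
    by (rule vs1.maximal_independent_subset)
  then have "vs1.span A = W" using assms(1) by (simp add: vs1.span_subspace)
  with assms(2) A(2) have "vs1.independent (insert v A)" by (simp add: vs1.independent_insert)
  from linear_independent_extend[OF this, of "\<lambda>x. if x = v then c else 0"]
  obtain f where f: "Vector_Spaces.linear s1 s2 f" "\<And>x. x \<in> insert v A \<Longrightarrow> f x = (if x = v then c else 0)"
    by blast
  have "f x = 0" if "x \<in> A" for x
    using f(2)[of x] that \<open>v \<notin> W\<close> A(1) by auto
  then have "f w = 0" if "w \<in> W" for w
    using linear_eq_0_on_span[OF f(1)] that A(3) by blast
  with f show ?thesis by auto
qed

section \<open>Real chains as a vector space\<close>

lemma lookup_map_times:
  "Poly_Mapping.lookup (Poly_Mapping.map ((*) r) c) k = (r::real) * Poly_Mapping.lookup c k"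
  by transfer (simp add: when_def)

interpretation real_chain: vector_space "\<lambda>r (c::'s \<Rightarrow>\<^sub>0 real). Poly_Mapping.map ((*) r) c"
  by unfold_locales (auto intro!: poly_mapping_eqI simp: lookup_map_times lookup_add algebra_simps)

interpretation real_chain_functional:
  vector_space_pair "\<lambda>r (c::'s \<Rightarrow>\<^sub>0 real). Poly_Mapping.map ((*) r) c" "(*) :: real \<Rightarrow> real \<Rightarrow> real"
  by unfold_locales (auto simp: algebra_simps)

text \<open>Linearity is hidden by a sum over the support, which differs for \<open>c\<close>,
  \<open>d\<close> and \<open>c + d\<close>. Zero terms extend all three sums to one finite
  set.\<close>

lemma real_boundary_superset:
  assumes "finite A" "Poly_Mapping.keys c \<subseteq> A" "n \<noteq> 0"
  shows "real_boundary n c = (\<Sum>f\<in>A. \<Sum>k\<le>n.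
     Poly_Mapping.single (singular_face n k f) ((-1) ^ k * Poly_Mapping.lookup c f))"
proof -
  have "(\<Sum>f\<in>Poly_Mapping.keys c. \<Sum>k\<le>n.
          Poly_Mapping.single (singular_face n k f) ((-1) ^ k * Poly_Mapping.lookup c f)) =
        (\<Sum>f\<in>A. \<Sum>k\<le>n.
          Poly_Mapping.single (singular_face n k f) ((-1) ^ k * Poly_Mapping.lookup c f))"
    by (rule sum.mono_neutral_left) (use assms in \<open>auto simp: in_keys_iff\<close>)
  with assms(3) show ?thesis by (simp add: real_boundary_def)
qed

lemma real_boundary_add: "real_boundary n (c + d) = real_boundary n c + real_boundary n d"
proof (cases "n = 0")
  case False
  let ?A = "Poly_Mapping.keys c \<union> Poly_Mapping.keys d"
  have A: "finite ?A" "Poly_Mapping.keys (c + d) \<subseteq> ?A" "Poly_Mapping.keys c \<subseteq> ?A" "Poly_Mapping.keys d \<subseteq> ?A"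
    using keys_add[of c d] by auto
  show ?thesis
    unfolding real_boundary_superset[OF A(1,2) False] real_boundary_superset[OF A(1,3) False]
      real_boundary_superset[OF A(1,4) False]
    by (simp add: lookup_add distrib_left single_add sum.distrib)
qed (simp add: real_boundary_def)

lemma real_boundary_scale:
  "real_boundary n (Poly_Mapping.map ((*) r) c) = Poly_Mapping.map ((*) r) (real_boundary n c)"
proof (cases "n = 0")
  case False
  have A: "finite (Poly_Mapping.keys c)"
    "Poly_Mapping.keys (Poly_Mapping.map ((*) r) c) \<subseteq> Poly_Mapping.keys c"
    by (auto simp: in_keys_iff lookup_map_times)
  have s: "Poly_Mapping.map ((*) r) (Poly_Mapping.single k a) = Poly_Mapping.single k (r * a)"
    for k :: "(nat \<Rightarrow> real) \<Rightarrow> 'a" and a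
    by (auto intro!: poly_mapping_eqI simp: lookup_map_times lookup_single when_def)
  show ?thesis
    unfolding real_boundary_superset[OF A False] real_boundary_superset[OF A(1) subset_refl False]
    by (simp add: real_chain.scale_sum_right s lookup_map_times algebra_simps)
qed (simp add: real_boundary_def real_chain.scale_zero_right)

lemma subspace_real_boundary_set: "real_chain.subspace (real_boundary_set n X)"
proof (rule real_chain.subspaceI)
  show "0 \<in> real_boundary_set n X"
    unfolding real_boundary_set_def
    by (rule image_eqI[of _ _ 0]) (simp_all add: real_boundary_def real_singular_chain_def)
next
  fix x y assume "x \<in> real_boundary_set n X" "y \<in> real_boundary_set n X"
  then obtain c d where "x = real_boundary (Suc n) c" "y = real_boundary (Suc n) d"
    "real_singular_chain (Suc n) X c" "real_singular_chain (Suc n) X d"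
    unfolding real_boundary_set_def by auto
  then show "x + y \<in> real_boundary_set n X"
    unfolding real_boundary_set_def using keys_add[of c d]
    by (intro image_eqI[of _ _ "c + d"]) (auto simp: real_boundary_add real_singular_chain_def)
next
  fix r x assume "x \<in> real_boundary_set n X"
  then obtain c where c: "x = real_boundary (Suc n) c" "real_singular_chain (Suc n) X c"
    unfolding real_boundary_set_def by auto
  then have "real_singular_chain (Suc n) X (Poly_Mapping.map ((*) r) c)"
    unfolding real_singular_chain_def by (auto simp: in_keys_iff lookup_map_times subset_iff)
  with c show "Poly_Mapping.map ((*) r) x \<in> real_boundary_set n X"
    unfolding real_boundary_set_def by (intro image_eqI[of _ _ "Poly_Mapping.map ((*) r) c"])
      (auto simp: real_boundary_scale)
qed

text \<open>The coset of a boundary is the subgroup of boundaries, which is the neutral element of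
  the quotient.\<close>

lemma real_homology_class_neq_one:
  assumes "real_homology_class n X c \<noteq> \<one>\<^bsub>real_homology_group n X\<^esub>"
  shows "c \<notin> real_boundary_set n X"
proof
  assume c: "c \<in> real_boundary_set n X"
  have "real_homology_class n X c = (\<lambda>w. w + c) ` real_boundary_set n X"
    by (auto simp: real_homology_class_def r_coset_def real_cycle_group_def)
  also have "\<dots> = real_boundary_set n X"
  proof
    show "(\<lambda>w. w + c) ` real_boundary_set n X \<subseteq> real_boundary_set n X"
      using c real_chain.subspace_add[OF subspace_real_boundary_set] by blast
    have "w = (w - c) + c" "w - c \<in> real_boundary_set n X" if "w \<in> real_boundary_set n X" for w
      using real_chain.subspace_diff[OF subspace_real_boundary_set that c] by auto
    then show "real_boundary_set n X \<subseteq> (\<lambda>w. w + c) ` real_boundary_set n X" by blast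
  qed
  finally show False using assms by (simp add: real_homology_group_def FactGroup_def)
qed

text \<open>With real coefficients the boundaries form a subspace, so a linear functional separates
  from them the chain of the fiber. Its values on 1-simplices satisfy the cocycle identity because
  it kills the boundary of every singular triangle.\<close>

lemma simplicial_cocycle_of_circle_class:
  assumes "circle_class X h \<noteq> \<one>\<^bsub>real_homology_group 1 X\<^esub>"
  obtains \<mu> :: "((nat \<Rightarrow> real) \<Rightarrow> 'a) \<Rightarrow> real" where
    "\<forall>f. singular_simplex 2 X f \<longrightarrow>
       \<mu> (singular_face 2 0 f) + \<mu> (singular_face 2 2 f) = \<mu> (singular_face 2 1 f)"
    "\<mu> (simplex_map 1 h circle_simplex) \<noteq> 0"
proof -
  let ?s = "\<lambda>r (c::'a real_chain). Poly_Mapping.map ((*) r) c"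
  let ?c = "Poly_Mapping.single (simplex_map 1 h circle_simplex) (1::real)"
  have "?c \<notin> real_boundary_set 1 X"
    using assms real_homology_class_neq_one unfolding circle_class_def by blast
  from real_chain_functional.functional_vanishing_on_subspace[OF subspace_real_boundary_set this, of 1]
  obtain l where l: "Vector_Spaces.linear ?s ((*) :: real \<Rightarrow> real \<Rightarrow> real) l"
    "\<And>w. w \<in> real_boundary_set 1 X \<Longrightarrow> l w = 0" "l ?c = 1" by blast
  interpret l: Vector_Spaces.linear ?s "(*) :: real \<Rightarrow> real \<Rightarrow> real" l by (rule l(1))
  define \<mu> where "\<mu> f = l (Poly_Mapping.single f 1)" for f
  have l_single: "l (Poly_Mapping.single f r) = r * \<mu> f" for f r
  proof -
    have "Poly_Mapping.single f r = ?s r (Poly_Mapping.single f 1)"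
      by (auto intro!: poly_mapping_eqI simp: lookup_map_times lookup_single when_def)
    then show ?thesis unfolding \<mu>_def by (metis l.scale)
  qed
  have "\<mu> (singular_face 2 0 f) + \<mu> (singular_face 2 2 f) = \<mu> (singular_face 2 1 f)"
    if "singular_simplex 2 X f" for f
  proof -
    have "real_boundary 2 (Poly_Mapping.single f 1) \<in> real_boundary_set 1 X"
      using that unfolding real_boundary_set_def
      by (intro image_eqI[of _ _ "Poly_Mapping.single f 1"])
        (simp_all add: real_singular_chain_def numeral_2_eq_2)
    moreover have "real_boundary 2 (Poly_Mapping.single f 1) =
        (\<Sum>k\<le>2. Poly_Mapping.single (singular_face 2 k f) ((-1) ^ k))"
      by (simp add: real_boundary_def)
    ultimately have "(\<Sum>k\<le>2. (-1) ^ k * \<mu> (singular_face 2 k f)) = 0"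
      using l(2) by (metis (mono_tags, lifting) l.sum l_single sum.cong)
    then show ?thesis by (simp add: numeral_2_eq_2)
  qed
  with l(3) show ?thesis by (intro that[of \<mu>]) (auto simp: \<mu>_def)
qed

text \<open>Paths are functions on \<open>real\<close> of which only the values on the unit interval count; the
  second condition evaluates the cocycle on the boundary of a singular triangle.\<close>

definition path_cocycle :: "'b topology \<Rightarrow> ((real \<Rightarrow> 'b) \<Rightarrow> real) \<Rightarrow> bool" where
  "path_cocycle X l \<longleftrightarrow>
     (\<forall>\<sigma> \<sigma>'. (\<forall>s\<in>{0..1}. \<sigma> s = \<sigma>' s) \<longrightarrow> l \<sigma> = l \<sigma>') \<and>
     (\<forall>T. continuous_map (top_of_set {(u, v). 0 \<le> u \<and> 0 \<le> v \<and> u + v \<le> 1}) X T \<longrightarrow>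
        l (\<lambda>s. T (1 - s, s)) + l (\<lambda>s. T (s, 0)) = l (\<lambda>s. T (0, s)))"

section \<open>From singular simplices to paths\<close>

lemma standard_simplex_1_eq:
  assumes "t \<in> standard_simplex 1"
  shows "t 0 = 1 - t 1 \<and> t 1 \<in> {0..1}"
proof -
  have "(\<Sum>i\<le>Suc 0. t i) = 1" "0 \<le> t 1" "t 1 \<le> 1"
    using assms by (simp_all add: standard_simplex_def)
  then show ?thesis by simp
qed

lemma standard_simplex_2:
  assumes "t \<in> standard_simplex 2"
  shows "0 \<le> t 1 \<and> 0 \<le> t 2 \<and> t 1 + t 2 \<le> 1"
proof -
  have "(\<Sum>i\<le>Suc (Suc 0). t i) = 1" "0 \<le> t 0" "0 \<le> t 1" "0 \<le> t 2"
    using assms by (simp_all add: standard_simplex_def numeral_2_eq_2)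
  then show ?thesis by (simp add: numeral_2_eq_2)
qed

text \<open>A path parameter is the barycentric coordinate \<open>t 1\<close>, and a triangle is
  parametrized by \<open>(t 1, t 2)\<close>. Under this convention faces 0, 1 and 2 become the
  hypotenuse from (1, 0) to (0, 1), the vertical leg and the horizontal leg, all legs starting at
  the origin.\<close>

lemma path_cocycle_of_circle_class:
  assumes "circle_class X h \<noteq> \<one>\<^bsub>real_homology_group 1 X\<^esub>"
  obtains l where "path_cocycle X l" "l (\<lambda>s. h (cis (2 * pi * s))) \<noteq> 0"
proof -
  obtain \<mu> :: "_ \<Rightarrow> real" where \<mu>: "\<forall>f. singular_simplex 2 X f \<longrightarrow>
       \<mu> (singular_face 2 0 f) + \<mu> (singular_face 2 2 f) = \<mu> (singular_face 2 1 f)"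
    "\<mu> (simplex_map 1 h circle_simplex) \<noteq> 0"
    by (rule simplicial_cocycle_of_circle_class[OF assms])
  \<comment> \<open>The restriction to the simplex makes the value depend on the path over the unit
    interval only.\<close>
  define l where "l \<sigma> = \<mu> (restrict (\<lambda>t. \<sigma> (t 1)) (standard_simplex 1))" for \<sigma>
  have "path_cocycle X l"
    unfolding path_cocycle_def
  proof (intro conjI allI impI)
    fix \<sigma> \<sigma>' :: "real \<Rightarrow> 'a" assume "\<forall>s\<in>{0..1}. \<sigma> s = \<sigma>' s"
    then have "restrict (\<lambda>t. \<sigma> (t 1)) (standard_simplex 1) = restrict (\<lambda>t. \<sigma>' (t 1)) (standard_simplex 1)"
      by (intro restrict_ext) (use standard_simplex_1_eq in metis)
    then show "l \<sigma> = l \<sigma>'" by (simp add: l_def)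
  next
    fix T :: "real \<times> real \<Rightarrow> 'a"
    assume T: "continuous_map (top_of_set {(u, v). 0 \<le> u \<and> 0 \<le> v \<and> u + v \<le> 1}) X T"
    define f where "f = restrict (\<lambda>t. T (t 1, t 2)) (standard_simplex 2)"
    have coord: "continuous_map (subtopology (powertop_real UNIV) (standard_simplex 2)) euclideanreal (\<lambda>t. t i)" for i
      by (intro continuous_map_from_subtopology continuous_map_product_projection) auto
    have "continuous_map (subtopology (powertop_real UNIV) (standard_simplex 2))
        (top_of_set {(u, v). 0 \<le> u \<and> 0 \<le> v \<and> u + v \<le> 1}) (\<lambda>t. (t 1, t 2))"
      unfolding continuous_map_in_subtopology
    proof
      show "continuous_map (subtopology (powertop_real UNIV) (standard_simplex 2)) euclidean (\<lambda>t. (t 1, t 2))"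
        using continuous_map_pairedI[OF coord coord, of 1 2] by (simp add: euclidean_product_topology)
      show "(\<lambda>t. (t 1, t 2)) \<in> topspace (subtopology (powertop_real UNIV) (standard_simplex 2))
          \<rightarrow> {(u, v). 0 \<le> u \<and> 0 \<le> v \<and> u + v \<le> 1}"
        by (auto dest: standard_simplex_2)
    qed
    from continuous_map_compose[OF this T]
    have "continuous_map (subtopology (powertop_real UNIV) (standard_simplex 2)) X f"
      by (rule continuous_map_eq) (auto simp: f_def)
    then have "singular_simplex 2 X f" by (simp add: singular_simplex_def f_def)
    with \<mu>(1) have "\<mu> (singular_face 2 0 f) + \<mu> (singular_face 2 2 f) = \<mu> (singular_face 2 1 f)"
      by blast
    moreover have face: "singular_face 2 k f = restrict (\<lambda>t. T (\<sigma> (t 1))) (standard_simplex 1)"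
      if "k \<le> 2" "\<And>t. t \<in> standard_simplex 1 \<Longrightarrow> (simplical_face k t 1, simplical_face k t 2) = \<sigma> (t 1)"
      for k \<sigma>
      using that simplical_face_in_standard_simplex[of 2 k]
      by (auto simp: singular_face_def f_def intro!: restrict_ext)
    have "singular_face 2 0 f = restrict (\<lambda>t. T (1 - t 1, t 1)) (standard_simplex 1)"
      by (rule face[of 0 "\<lambda>s. (1 - s, s)"]) (use standard_simplex_1_eq in \<open>auto simp: simplical_face_def\<close>)
    moreover have "singular_face 2 1 f = restrict (\<lambda>t. T (0, t 1)) (standard_simplex 1)"
      by (rule face[of 1 "\<lambda>s. (0, s)"]) (auto simp: simplical_face_def)
    moreover have "singular_face 2 2 f = restrict (\<lambda>t. T (t 1, 0)) (standard_simplex 1)"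
      by (rule face[of 2 "\<lambda>s. (s, 0)"]) (auto simp: simplical_face_def)
    ultimately show "l (\<lambda>s. T (1 - s, s)) + l (\<lambda>s. T (s, 0)) = l (\<lambda>s. T (0, s))"
      by (simp add: l_def)
  qed
  moreover have "simplex_map 1 h circle_simplex = restrict (\<lambda>t. h (cis (2 * pi * t 1))) (standard_simplex 1)"
    by (auto simp: simplex_map_def circle_simplex_def intro!: restrict_ext)
  ultimately show ?thesis using that[of l] \<mu>(2) by (simp add: l_def)
qed

lemma path_cocycle_cong:
  "path_cocycle X l \<Longrightarrow> (\<And>s. s \<in> {0..1} \<Longrightarrow> \<sigma> s = \<sigma>' s) \<Longrightarrow> l \<sigma> = l \<sigma>'"
  unfolding path_cocycle_def by blast

lemma path_cocycle_triangle:
  assumes "path_cocycle X l" "continuous_map (top_of_set C) X \<Psi>"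
    "continuous_on {(u, v). 0 \<le> u \<and> 0 \<le> v \<and> u + v \<le> 1} H"
    "\<And>u v. 0 \<le> u \<Longrightarrow> 0 \<le> v \<Longrightarrow> u + v \<le> 1 \<Longrightarrow> H (u, v) \<in> C"
  shows "l (\<lambda>s. \<Psi> (H (1 - s, s))) + l (\<lambda>s. \<Psi> (H (s, 0))) = l (\<lambda>s. \<Psi> (H (0, s)))"
proof -
  have "continuous_map (top_of_set {(u, v). 0 \<le> u \<and> 0 \<le> v \<and> u + v \<le> 1}) (top_of_set C) H"
    using assms(3,4) by (auto simp: continuous_map_in_subtopology)
  from continuous_map_compose[OF this assms(2)] assms(1) show ?thesis
    unfolding path_cocycle_def by (auto simp: o_def)
qed

text \<open>The Poincare lemma for cocycles. Convexity deforms the path to the segment between its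
  ends without leaving \<open>C\<close>, and this segment bounds a triangle with the two segments
  from \<open>a\<close>.\<close>

lemma path_cocycle_primitive:
  fixes C :: "'v::real_normed_vector set"
  assumes l: "path_cocycle X l" and \<Psi>: "continuous_map (top_of_set C) X \<Psi>" and C: "convex C" "a \<in> C"
    and \<sigma>: "continuous_on {0..1} \<sigma>" "\<And>s. s \<in> {0..1} \<Longrightarrow> \<sigma> s \<in> C"
  shows "l (\<lambda>s. \<Psi> (\<sigma> s)) =
    l (\<lambda>s. \<Psi> (a + s *\<^sub>R (\<sigma> 1 - a))) - l (\<lambda>s. \<Psi> (a + s *\<^sub>R (\<sigma> 0 - a)))"
proof -
  note triangle = path_cocycle_triangle[OF l \<Psi>]
  let ?D = "{(u, v). (0::real) \<le> u \<and> 0 \<le> v \<and> u + v \<le> 1}"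
  define p q where "p = \<sigma> 0" and "q = \<sigma> 1"
  have pq: "p \<in> C" "q \<in> C" using \<sigma>(2) by (auto simp: p_def q_def)
  have comb: "(1 - u) *\<^sub>R x + u *\<^sub>R y \<in> C" if "x \<in> C" "y \<in> C" "0 \<le> u" "u \<le> 1" for x y u
    using C(1) that by (simp add: convexD_alt)
  \<comment> \<open>A constant triangle has three equal faces, so twice the value equals the
    value.\<close>
  have const: "l (\<lambda>s. \<Psi> x) = 0" if "x \<in> C" for x
    using triangle[of "\<lambda>_. x"] that by auto
  define H where "H = (\<lambda>(s, u). (1 - u) *\<^sub>R ((1 - s) *\<^sub>R p + s *\<^sub>R q) + u *\<^sub>R \<sigma> s)"
  have H: "H (s, u) \<in> C" if "0 \<le> s" "s \<le> 1" "0 \<le> u" "u \<le> 1" for s u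
    using that pq \<sigma>(2) by (auto simp: H_def intro!: comb)
  have cont: "continuous_on ?D (\<lambda>z. H (f z, g z))"
    if "continuous_on ?D f" "continuous_on ?D g" "f ` ?D \<subseteq> {0..1}" for f g
  proof -
    have "continuous_on ?D (\<lambda>z. \<sigma> (f z))"
      by (rule continuous_on_compose2[OF \<sigma>(1) that(1,3)])
    then show ?thesis unfolding H_def prod.case using that by (intro continuous_intros)
  qed
  \<comment> \<open>the two triangles of the square on which \<open>H\<close> is the homotopy to the straight path\<close>
  have "l (\<lambda>s. \<Psi> (H (1, s))) + l (\<lambda>s. \<Psi> (H (s, 0))) = l (\<lambda>s. \<Psi> (H (s, s)))"
  proof -
    have "continuous_on ?D (\<lambda>z. H (fst z + snd z, snd z))"
      by (intro cont continuous_intros) auto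
    from triangle[OF this] show ?thesis by (simp add: H)
  qed
  moreover have "l (\<lambda>s. \<Psi> (H (s, 1))) + l (\<lambda>s. \<Psi> (H (0, s))) = l (\<lambda>s. \<Psi> (H (s, s)))"
  proof -
    have "continuous_on ?D (\<lambda>z. H (snd z, fst z + snd z))"
      by (intro cont continuous_intros) auto
    from triangle[OF this] show ?thesis by (simp add: H)
  qed
  moreover have "(\<lambda>s. H (1, s)) = (\<lambda>s. q)" "(\<lambda>s. H (0, s)) = (\<lambda>s. p)" "(\<lambda>s. H (s, 1)) = \<sigma>"
    "(\<lambda>s. H (s, 0)) = (\<lambda>s. p + s *\<^sub>R (q - p))"
    by (auto simp: H_def p_def q_def algebra_simps)
  ultimately have straight: "l (\<lambda>s. \<Psi> (\<sigma> s)) = l (\<lambda>s. \<Psi> (p + s *\<^sub>R (q - p)))"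
    using const[OF pq(1)] const[OF pq(2)] by (simp add: fun_eq_iff)
  \<comment> \<open>The affine triangle with vertices \<open>a\<close>, \<open>p\<close>,
    \<open>q\<close>; its hypotenuse is the segment from \<open>p\<close> to
    \<open>q\<close>.\<close>
  define K where "K = (\<lambda>(u, v). a + u *\<^sub>R (p - a) + v *\<^sub>R (q - a))"
  have "K (u, v) \<in> C" if "0 \<le> u" "0 \<le> v" "u + v \<le> 1" for u v
  proof -
    have "(1 - (u + v)) *\<^sub>R a + u *\<^sub>R p + v *\<^sub>R q \<in> convex hull {a, p, q}"
      unfolding convex_hull_3 using that by fastforce
    moreover have "convex hull {a, p, q} \<subseteq> C" using C pq by (intro hull_minimal) auto
    ultimately show ?thesis by (auto simp: K_def algebra_simps)
  qed
  moreover have "continuous_on ?D K" unfolding K_def split_def by (intro continuous_intros)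
  ultimately have "l (\<lambda>s. \<Psi> (K (1 - s, s))) + l (\<lambda>s. \<Psi> (K (s, 0))) = l (\<lambda>s. \<Psi> (K (0, s)))"
    by (rule triangle[rotated])
  moreover have "K (1 - s, s) = p + s *\<^sub>R (q - p)" for s by (simp add: K_def algebra_simps)
  ultimately show ?thesis using straight by (simp add: K_def p_def q_def)
qed

section \<open>Straightening the second coordinate\<close>

lemma DERIV_snd:
  fixes F :: "'a::real_normed_vector \<times> real \<Rightarrow> real"
  assumes "(F has_derivative D) (at (y, t))"
  shows "((\<lambda>t. F (y, t)) has_real_derivative D (0, 1)) (at t)"
proof -
  interpret bounded_linear D using assms by (rule has_derivative_bounded_linear)
  have "((\<lambda>t. (y, t)) has_derivative (\<lambda>h. (0, h))) (at t)"
    by (auto intro!: derivative_eq_intros)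
  from has_derivative_compose[OF this assms]
  have "((\<lambda>t. F (y, t)) has_derivative (\<lambda>h. D (0, h))) (at t)" .
  moreover have "(\<lambda>h. D (0, h)) = (*) (D (0, 1))"
  proof
    show "D (0, h) = D (0, 1) * h" for h
      using scaleR[of h "(0, 1)"] by (simp add: mult.commute)
  qed
  ultimately show ?thesis by (simp only: has_field_derivative_def)
qed

text \<open>Bootstrapping: the derivative of \<open>G\<close> is a rational expression in first
  derivatives of \<open>F\<close> evaluated along \<open>G\<close>, so it is as smooth as
  \<open>G\<close> already is, and \<open>G\<close> gains one order. The map \<open>(y, t)\<close>
  to \<open>(y, F (y, t))\<close> has a triangular derivative, so its inverse can be written down
  with the fiber derivative as the only denominator.\<close>

lemma C_k_on_inverse_graph_map:
  fixes F :: "'a::model_space \<times> real \<Rightarrow> real" and G :: "'a \<times> real \<Rightarrow> 'a \<times> real"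
  assumes F: "smooth_on \<Omega> F" and nz: "\<And>z. z \<in> \<Omega> \<Longrightarrow> frechet_derivative F (at z) (0, 1) \<noteq> 0"
    and W: "open W" and G: "continuous_on W G" "\<And>w. w \<in> W \<Longrightarrow> G w \<in> \<Omega>"
      "\<And>w. w \<in> W \<Longrightarrow> (fst (G w), F (G w)) = w"
  shows "C_k_on k W G"
proof (induction k)
  case 0
  then show ?case using G(1) by simp
next
  case (Suc k)
  let ?F' = "\<lambda>z. frechet_derivative F (at z)"
  have F': "(F has_derivative ?F' z) (at z)" if "z \<in> \<Omega>" for z
    by (rule smooth_on_differentiable[OF F that])
  show ?case
  proof (rule C_k_on_SucI[OF W])
    fix w assume w: "w \<in> W"
    let ?D = "?F' (G w)"
    interpret bounded_linear ?D using F'[OF G(2)[OF w]] by (rule has_derivative_bounded_linear)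
    have D1: "bounded_linear (\<lambda>v. ?D (fst v, 0))"
      by (rule bounded_linear_compose[OF bounded_linear_axioms])
        (intro bounded_linear_Pair bounded_linear_fst bounded_linear_zero)
    show "(G has_derivative (\<lambda>v. (fst v, (snd v - ?D (fst v, 0)) / ?D (0, 1)))) (at w)"
    proof (rule has_derivative_inverse_basic[where f="\<lambda>z. (fst z, F z)" and f'="\<lambda>v. (fst v, ?D v)"])
      show "((\<lambda>z. (fst z, F z)) has_derivative (\<lambda>v. (fst v, ?D v))) (at (G w))"
        using F'[OF G(2)[OF w]] by (auto intro!: derivative_eq_intros)
      show "bounded_linear (\<lambda>v. (fst v, (snd v - ?D (fst v, 0)) / ?D (0, 1)))"
        by (intro bounded_linear_Pair bounded_linear_fst bounded_linear_sub bounded_linear_snd D1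
            bounded_linear_compose[OF bounded_linear_divide])
      show "(\<lambda>v. (fst v, (snd v - ?D (fst v, 0)) / ?D (0, 1))) \<circ> (\<lambda>v. (fst v, ?D v)) = id"
      proof
        fix v :: "'a \<times> real"
        have "?D v = ?D (fst v, 0) + ?D (0, snd v)"
          using add[of "(fst v, 0)" "(0, snd v)"] by simp
        also have "?D (0, snd v) = snd v * ?D (0, 1)"
          using scaleR[of "snd v" "(0, 1)"] by simp
        finally show "((\<lambda>v. (fst v, (snd v - ?D (fst v, 0)) / ?D (0, 1))) \<circ> (\<lambda>v. (fst v, ?D v))) v = id v"
          using nz[OF G(2)[OF w]] by (cases v) simp
      qed
      show "isCont G w" using G(1) W w by (simp add: continuous_on_eq_continuous_at)
    qed (use W w G(3) in auto)
  next
    fix v :: "'a \<times> real"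
    have "C_k_on k W (\<lambda>w. ?F' (G w) u)" for u
      by (rule C_k_on_compose[OF W _ Suc.IH G(2)])
        (use smooth_on_directional_derivative[OF F] in \<open>auto simp: smooth_on_def\<close>)
    then have "C_k_on k W (\<lambda>w. (snd v + (- 1) * ?F' (G w) (fst v, 0)) / ?F' (G w) (0, 1))"
      by (intro C_k_on_divide C_k_on_add C_k_on_bilinear[OF bounded_bilinear_mult] C_k_on_const W)
        (use nz G(2) in auto)
    then show "C_k_on k W (\<lambda>w. (fst v, (snd v - ?F' (G w) (fst v, 0)) / ?F' (G w) (0, 1)))"
      by (intro C_k_on_Pair C_k_on_const W) simp
  qed
qed

text \<open>The inverse function theorem for a map that fixes the first coordinate, obtained from
  one-variable arguments: monotonicity in the second variable gives injectivity, intermediate values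
  give surjectivity. This also controls the image, which has to be a product of connected open sets
  to serve as the image of a foliated chart.\<close>

lemma straighten_snd:
  fixes F :: "'a::model_space \<times> real \<Rightarrow> real"
  defines "H \<equiv> \<lambda>z. (fst z, F z)"
  assumes \<Omega>: "open \<Omega>" "z0 \<in> \<Omega>" and F: "smooth_on \<Omega> F"
    and nz: "\<And>z. z \<in> \<Omega> \<Longrightarrow> frechet_derivative F (at z) (0, 1) \<noteq> 0"
  obtains D S T G where "open D" "z0 \<in> D" "D \<subseteq> \<Omega>" "open S" "connected S" "open T" "connected T"
    "\<forall>z\<in>D. H z \<in> S \<times> T \<and> G (H z) = z" "\<forall>w\<in>S \<times> T. G w \<in> D \<and> H (G w) = w"
    "smooth_on (S \<times> T) G"
proof -
  obtain y0 t0 where z0: "z0 = (y0, t0)" by (cases z0)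
  let ?F' = "\<lambda>z. frechet_derivative F (at z) (0, 1)"
  \<comment> \<open>Multiplying by the sign makes the function increasing along each vertical
    segment, so both cases are treated at once.\<close>
  define \<sigma> where "\<sigma> = sgn (?F' z0)"
  have \<sigma>: "\<sigma> = 1 \<or> \<sigma> = -1" using nz[OF \<Omega>(2)] by (auto simp: \<sigma>_def sgn_if)
  have F'cont: "continuous_on \<Omega> ?F'"
    by (rule smooth_on_continuous_on[OF smooth_on_directional_derivative[OF F]])
  have "open (\<Omega> \<inter> (\<lambda>z. \<sigma> * ?F' z) -` {0<..})"
    by (intro continuous_open_preimage continuous_intros F'cont \<Omega>(1))
  moreover have "z0 \<in> \<Omega> \<inter> (\<lambda>z. \<sigma> * ?F' z) -` {0<..}"
    using \<Omega>(2) nz[OF \<Omega>(2)] by (auto simp: \<sigma>_def sgn_if)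
  ultimately obtain A A' where A: "open A" "open A'" "z0 \<in> A \<times> A'"
      "A \<times> A' \<subseteq> \<Omega> \<inter> (\<lambda>z. \<sigma> * ?F' z) -` {0<..}"
    by (rule open_prod_elim)
  obtain r1 where r1: "0 < r1" "cball y0 r1 \<subseteq> A"
    using A(1,3) z0 open_contains_cball_eq by blast
  obtain r where r: "0 < r" "cball t0 r \<subseteq> A'"
    using A(2,3) z0 open_contains_cball_eq by blast
  let ?K = "cball y0 r1 \<times> cball t0 r"
  have K: "?K \<subseteq> \<Omega>" "\<And>z. z \<in> ?K \<Longrightarrow> 0 < \<sigma> * ?F' z" using r1(2) r(2) A(4) by blast+
  have mono: "\<sigma> * F (y, s) < \<sigma> * F (y, t)"
    if "y \<in> cball y0 r1" "s \<in> cball t0 r" "t \<in> cball t0 r" "s < t" for y s t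
  proof (rule DERIV_pos_imp_increasing[OF that(4)])
    fix u assume u: "s \<le> u" "u \<le> t"
    then have "(y, u) \<in> ?K" using that by (auto simp: dist_real_def)
    moreover have "((\<lambda>u. \<sigma> * F (y, u)) has_real_derivative \<sigma> * ?F' (y, u)) (at u)"
      using calculation K(1) by (intro DERIV_cmult DERIV_snd smooth_on_differentiable[OF F]) blast
    ultimately show "\<exists>d. ((\<lambda>u. \<sigma> * F (y, u)) has_real_derivative d) (at u) \<and> 0 < d"
      using K(2) by blast
  qed
  have Fcont: "continuous_on \<Omega> F" by (rule smooth_on_continuous_on[OF F])
  have Hinj: "inj_on H ?K"
  proof (rule inj_onI)
    fix z w assume zw: "z \<in> ?K" "w \<in> ?K" "H z = H w"
    then have e: "fst z = fst w" "F (fst z, snd z) = F (fst z, snd w)" by (auto simp: H_def)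
    have "snd z = snd w"
      using mono[of "fst z" "snd z" "snd w"] mono[of "fst z" "snd w" "snd z"] zw(1,2) e
      by (cases "snd z" "snd w" rule: linorder_cases) (auto simp: mem_Times_iff)
    with e(1) show "z = w" by (simp add: prod_eq_iff)
  qed
  have Hcont: "continuous_on ?K H"
    unfolding H_def using K(1) Fcont by (intro continuous_intros) (rule continuous_on_subset)
  \<comment> \<open>A continuous injection of the compact box has a continuous inverse on its image;
    this is the starting point of the bootstrapping.\<close>
  define G where "G = inv_into ?K H"
  have Gcont: "continuous_on (H ` ?K) G"
    by (rule continuous_on_inv[OF Hcont]) (auto intro!: compact_Times simp: G_def Hinj)
  \<comment> \<open>Half of the smaller increment of \<open>\<sigma> * F\<close> from the center to
    an end of the central segment. The other half is a margin, so that for \<open>y\<close> near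
    \<open>y0\<close> the end values still enclose the interval of radius \<open>\<eta>\<close>
    about the central value.\<close>
  define \<eta> where "\<eta> = min (\<sigma> * F (y0, t0) - \<sigma> * F (y0, t0 - r)) (\<sigma> * F (y0, t0 + r) - \<sigma> * F (y0, t0)) / 2"
  have \<eta>: "0 < \<eta>" "\<sigma> * F (y0, t0 - r) < \<sigma> * F (y0, t0) - \<eta>" "\<sigma> * F (y0, t0) + \<eta> < \<sigma> * F (y0, t0 + r)"
    using mono[of y0 "t0 - r" t0] mono[of y0 t0 "t0 + r"] r(1) r1(1)
    by (auto simp: \<eta>_def dist_real_def min_def field_simps)
  have slice: "continuous_on (ball y0 r1) (\<lambda>y. \<sigma> * F (y, t))" if "t \<in> cball t0 r" for t
    by (intro continuous_intros continuous_on_compose2[OF Fcont]) (use that K(1) in auto)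
  have "open (ball y0 r1 \<inter> (\<lambda>y. \<sigma> * F (y, t0 - r)) -` {..<\<sigma> * F (y0, t0) - \<eta>})"
    by (intro continuous_open_preimage slice) (use r(1) in \<open>auto simp: dist_real_def\<close>)
  moreover have "open (ball y0 r1 \<inter> (\<lambda>y. \<sigma> * F (y, t0 + r)) -` {\<sigma> * F (y0, t0) + \<eta><..})"
    by (intro continuous_open_preimage slice) (use r(1) in \<open>auto simp: dist_real_def\<close>)
  ultimately have "open (ball y0 r1 \<inter> (\<lambda>y. \<sigma> * F (y, t0 - r)) -` {..<\<sigma> * F (y0, t0) - \<eta>} \<inter>
     (ball y0 r1 \<inter> (\<lambda>y. \<sigma> * F (y, t0 + r)) -` {\<sigma> * F (y0, t0) + \<eta><..}))" (is "open ?V")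
    by (rule open_Int)
  moreover have "y0 \<in> ?V" using r1(1) \<eta> by auto
  ultimately obtain \<rho> where \<rho>: "0 < \<rho>" "ball y0 \<rho> \<subseteq> ?V"
    using open_contains_ball_eq by blast
  define S where "S = ball y0 \<rho>"
  define T where "T = ball (F (y0, t0)) \<eta>"
  define D where "D = (S \<times> ball t0 r) \<inter> F -` T"
  have SK: "S \<times> ball t0 r \<subseteq> ?K" using \<rho>(2) by (auto simp: S_def)
  have DK: "D \<subseteq> ?K" using SK by (auto simp: D_def)
  have G1: "H z \<in> S \<times> T \<and> G (H z) = z" if "z \<in> D" for z
  proof
    show "H z \<in> S \<times> T" using that by (auto simp: D_def H_def)
    show "G (H z) = z" unfolding G_def using that DK by (intro inv_into_f_f[OF Hinj]) blast
  qed
  have G2: "G w \<in> D \<and> H (G w) = w" if w: "w \<in> S \<times> T" for w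
  proof -
    obtain y t where yt: "w = (y, t)" "y \<in> S" "t \<in> T" using w by blast
    have "y \<in> ?V" "y \<in> cball y0 r1" using yt(2) \<rho>(2) by (auto simp: S_def)
    moreover have "\<bar>\<sigma> * F (y0, t0) - \<sigma> * t\<bar> < \<eta>"
      using yt(3) \<sigma> by (auto simp: T_def dist_real_def)
    ultimately have b: "\<sigma> * F (y, t0 - r) < \<sigma> * t" "\<sigma> * t < \<sigma> * F (y, t0 + r)" by auto
    have "continuous_on {t0 - r..t0 + r} (\<lambda>u. \<sigma> * F (y, u))"
      by (intro continuous_intros continuous_on_compose2[OF Fcont])
        (use K(1) \<open>y \<in> cball y0 r1\<close> in \<open>auto simp: dist_real_def subset_iff\<close>)
    then obtain u where u: "t0 - r \<le> u" "u \<le> t0 + r" "\<sigma> * F (y, u) = \<sigma> * t"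
      using IVT'[of "\<lambda>u. \<sigma> * F (y, u)" "t0 - r" "\<sigma> * t" "t0 + r"] b r(1) by auto
    have "u \<noteq> t0 - r" "u \<noteq> t0 + r" using b u(3) by auto
    then have "u \<in> ball t0 r" using u by (auto simp: dist_real_def)
    moreover have "F (y, u) = t" using u(3) \<sigma> by auto
    ultimately have "(y, u) \<in> D" "H (y, u) = w" using yt by (auto simp: D_def H_def)
    with G1 show ?thesis by metis
  qed
  have "open D" unfolding D_def S_def T_def
    by (intro continuous_open_preimage continuous_on_subset[OF Fcont])
      (use SK K(1) in \<open>auto simp: S_def intro!: open_Times\<close>)
  moreover have "z0 \<in> D" using z0 \<rho>(1) r(1) \<eta>(1) by (auto simp: D_def S_def T_def)
  moreover have "smooth_on (S \<times> T) G"
    unfolding smooth_on_def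
  proof (intro allI C_k_on_inverse_graph_map[OF F nz])
    show "continuous_on (S \<times> T) G"
      by (rule continuous_on_subset[OF Gcont]) (use G2 DK in \<open>force simp: image_iff\<close>)
    show "(fst (G w), F (G w)) = w" if "w \<in> S \<times> T" for w
      using G2[OF that] by (simp add: H_def)
    show "G w \<in> \<Omega>" if "w \<in> S \<times> T" for w
      using G2[OF that] DK K(1) by blast
  qed (auto simp: S_def T_def intro!: open_Times)
  moreover have "D \<subseteq> \<Omega>" using DK K(1) by (rule subset_trans)
  moreover have "open S" "connected S" "open T" "connected T" by (simp_all add: S_def T_def)
  ultimately show ?thesis using G1 G2 by (intro that[of D S T G] ballI) simp_all
qed

section \<open>Charts compatible with an atlas\<close>

text \<open>Membership in the maximal atlas; \<open>atlas B\<close> itself may be smaller, and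
  foliated charts are taken from the larger one.\<close>

definition compat_chart :: "('b, 'f::model_space) manifold \<Rightarrow> ('b, 'f) chart \<Rightarrow> bool" where
  "compat_chart B c \<longleftrightarrow> is_chart (mtop B) c \<and> (\<forall>d\<in>atlas B. smoothly_compatible c d)"

lemma compat_chart_is_chart: "compat_chart B c \<Longrightarrow> is_chart (mtop B) c"
  by (simp add: compat_chart_def)

lemma atlas_compat_chart: "smooth_manifold B \<Longrightarrow> c \<in> atlas B \<Longrightarrow> compat_chart B c"
  by (simp add: compat_chart_def smooth_manifold_def)

lemma atlas_covers:
  assumes "smooth_manifold B" "b \<in> topspace (mtop B)"
  obtains U \<phi> where "(U, \<phi>) \<in> atlas B" "b \<in> U"
proof -
  have "b \<in> (\<Union>c\<in>atlas B. fst c)" using assms by (simp add: smooth_manifold_def)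
  then obtain c where "c \<in> atlas B" "b \<in> fst c" by blast
  then show ?thesis using that[of "fst c" "snd c"] by simp
qed

lemma is_chart_props:
  assumes "is_chart X (U, \<phi>)"
  shows chart_openin: "openin X U" and chart_open_image: "open (\<phi> ` U)" and chart_inj_on: "inj_on \<phi> U"
    and chart_continuous: "continuous_map (subtopology X U) euclidean \<phi>"
    and chart_continuous_inv: "continuous_map (top_of_set (\<phi> ` U)) X (inv_into U \<phi>)"
    and chart_homeomorphic_map: "homeomorphic_map (subtopology X U) (top_of_set (\<phi> ` U)) \<phi>"
proof -
  show U: "openin X U" and "open (\<phi> ` U)" and hom: "homeomorphic_map (subtopology X U) (top_of_set (\<phi> ` U)) \<phi>"
    using assms by (auto simp: is_chart_def)
  have top: "topspace (subtopology X U) = U" using openin_subset[OF U] by auto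
  show inj: "inj_on \<phi> U" using homeomorphic_imp_injective_map[OF hom] top by simp
  show "continuous_map (subtopology X U) euclidean \<phi>"
    using homeomorphic_imp_continuous_map[OF hom] continuous_map_in_subtopology by blast
  obtain g where g: "homeomorphic_maps (subtopology X U) (top_of_set (\<phi> ` U)) \<phi> g"
    using hom homeomorphic_map_maps by blast
  then have "continuous_map (top_of_set (\<phi> ` U)) X g"
    by (auto simp: homeomorphic_maps_def continuous_map_in_subtopology)
  moreover have "g y = inv_into U \<phi> y" if "y \<in> \<phi> ` U" for y
    using g that inj top by (auto simp: homeomorphic_maps_def)
  ultimately show "continuous_map (top_of_set (\<phi> ` U)) X (inv_into U \<phi>)"
    by (rule continuous_map_eq) auto
qed

lemma chart_open_image_Int:
  assumes "is_chart X (U, \<phi>)" "openin X V"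
  shows "open (\<phi> ` (U \<inter> V))"
proof -
  have "openin (subtopology X U) (U \<inter> V)"
    using assms(2) by (simp add: openin_subtopology_Int2)
  then have "openin (top_of_set (\<phi> ` U)) (\<phi> ` (U \<inter> V))"
    using homeomorphic_map_openness_eq[OF chart_homeomorphic_map[OF assms(1)]] by blast
  then show ?thesis using chart_open_image[OF assms(1)] openin_open_trans by blast
qed

lemma chart_openin_preimage:
  assumes "is_chart X (U, \<phi>)" "open D"
  shows "openin X (U \<inter> \<phi> -` D)"
proof -
  have "openin (subtopology X U) {x \<in> topspace (subtopology X U). \<phi> x \<in> D}"
    by (rule openin_continuous_map_preimage[OF chart_continuous[OF assms(1)]]) (use assms(2) in simp)
  moreover have "{x \<in> topspace (subtopology X U). \<phi> x \<in> D} = U \<inter> \<phi> -` D"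
    using openin_subset[OF chart_openin[OF assms(1)]] by auto
  ultimately show ?thesis using chart_openin[OF assms(1)] openin_trans_full by metis
qed

lemma is_chartI:
  assumes "openin X U" "open D" "continuous_map (subtopology X U) euclidean \<phi>"
    "continuous_map (top_of_set D) X g"
    "\<And>x. x \<in> U \<Longrightarrow> \<phi> x \<in> D \<and> g (\<phi> x) = x" "\<And>y. y \<in> D \<Longrightarrow> g y \<in> U \<and> \<phi> (g y) = y"
  shows "is_chart X (U, \<phi>)" "\<phi> ` U = D" "\<And>y. y \<in> D \<Longrightarrow> inv_into U \<phi> y = g y"
proof -
  show im: "\<phi> ` U = D" using assms(5,6) by force
  have "homeomorphic_maps (subtopology X U) (top_of_set D) \<phi> g"
    using assms by (auto simp: homeomorphic_maps_def continuous_map_in_subtopology)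
  then have "homeomorphic_map (subtopology X U) (top_of_set D) \<phi>"
    using homeomorphic_maps_map by blast
  with assms(1,2) im show "is_chart X (U, \<phi>)" by (simp add: is_chart_def)
  have "inj_on \<phi> U" using assms(5) by (metis inj_onI)
  then show "inv_into U \<phi> y = g y" if "y \<in> D" for y
    using assms(6)[OF that] by (metis inv_into_f_f)
qed

section \<open>Transition maps\<close>

lemma transition_domain_open:
  assumes "is_chart X c" "is_chart X d"
  shows "open (transition_domain c d)"
proof -
  obtain U \<phi> V \<psi> where [simp]: "c = (U, \<phi>)" "d = (V, \<psi>)" by (cases c; cases d)
  show ?thesis
    using chart_open_image_Int[of X U \<phi> V] chart_openin[of X V \<psi>] assms
    by (simp add: transition_domain_def)
qed

lemma transition_inverse:
  assumes "is_chart X c" "is_chart X d" "z \<in> transition_domain c d"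
  shows "transition_map c d z \<in> transition_domain d c"
    "transition_map d c (transition_map c d z) = z"
proof -
  obtain U \<phi> V \<psi> where [simp]: "c = (U, \<phi>)" "d = (V, \<psi>)" by (cases c; cases d)
  obtain b where b: "b \<in> U" "b \<in> V" "z = \<phi> b"
    using assms(3) by (auto simp: transition_domain_def)
  have "inj_on \<phi> U" "inj_on \<psi> V" using assms chart_inj_on by auto
  with b show "transition_map c d z \<in> transition_domain d c"
    "transition_map d c (transition_map c d z) = z"
    by (auto simp: transition_domain_def transition_map_def)
qed

text \<open>Near each point the transition factors through a chart of the atlas, with which both
  charts are compatible.\<close>

lemma compat_chart_smoothly_compatible:
  assumes B: "smooth_manifold B" and c: "compat_chart B c" and d: "compat_chart B d"
  shows "smoothly_compatible c d"
proof -
  have "smooth_on (transition_domain c d) (transition_map c d)"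
    if c: "compat_chart B c" and d: "compat_chart B d" for c d
  proof (rule smooth_on_local)
    fix z assume z: "z \<in> transition_domain c d"
    obtain U \<phi> V \<psi> where cd: "c = (U, \<phi>)" "d = (V, \<psi>)" by (cases c; cases d)
    have ch: "is_chart (mtop B) (U, \<phi>)" "is_chart (mtop B) (V, \<psi>)"
      using c d compat_chart_is_chart cd by auto
    obtain b where b: "b \<in> U" "b \<in> V" "z = \<phi> b"
      using z by (auto simp: cd transition_domain_def)
    have "b \<in> topspace (mtop B)" using openin_subset[OF chart_openin[OF ch(1)]] b by blast
    then obtain W \<kappa> where W: "(W, \<kappa>) \<in> atlas B" "b \<in> W"
      by (rule atlas_covers[OF B])
    have chW: "is_chart (mtop B) (W, \<kappa>)" using W(1) B by (auto simp: smooth_manifold_def)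
    let ?N = "\<phi> ` (U \<inter> (V \<inter> W))"
    have N: "open ?N"
      by (intro chart_open_image_Int[OF ch(1)] openin_Int chart_openin[OF ch(2)] chart_openin[OF chW])
    have s1: "smooth_on (\<phi> ` (U \<inter> W)) (\<kappa> \<circ> inv_into U \<phi>)"
      using c W(1) unfolding compat_chart_def smoothly_compatible_def
      by (auto simp: cd transition_domain_def transition_map_def)
    have s2: "smooth_on (\<kappa> ` (W \<inter> V)) (\<psi> \<circ> inv_into W \<kappa>)"
      using d W(1) unfolding compat_chart_def smoothly_compatible_def
      by (auto simp: cd transition_domain_def transition_map_def)
    have "smooth_on ?N (\<lambda>x. (\<psi> \<circ> inv_into W \<kappa>) ((\<kappa> \<circ> inv_into U \<phi>) x))"
      by (rule smooth_on_compose[OF N s2 smooth_on_subset[OF s1]])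
        (use chart_inj_on[OF ch(1)] in auto)
    then have "smooth_on ?N (\<psi> \<circ> inv_into U \<phi>)"
      by (rule smooth_on_cong[OF _ N]) (use chart_inj_on[OF ch(1)] chart_inj_on[OF chW] in auto)
    then show "\<exists>N. open N \<and> z \<in> N \<and> smooth_on N (transition_map c d)"
      using N b W(2) by (intro exI[of _ ?N]) (auto simp: cd transition_map_def)
  qed
  with c d show ?thesis by (simp add: smoothly_compatible_def)
qed

text \<open>The two transition maps are inverse to each other on open sets, so differentiating their
  composites shows that their derivatives are inverse too.\<close>

lemma transition_derivative_bijective:
  assumes B: "smooth_manifold B" and c: "compat_chart B c" and d: "compat_chart B d"
    and z: "z \<in> transition_domain c d"
  obtains D D' where "(transition_map c d has_derivative D) (at z)" "\<forall>v. D (D' v) = v" "\<forall>v. D' (D v) = v"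
proof -
  have D: "\<exists>D. (transition_map c d has_derivative D) (at z)"
    if "compat_chart B c" "compat_chart B d" "z \<in> transition_domain c d" for c d z
    using compat_chart_smoothly_compatible[OF B that(1,2)] smooth_on_differentiable that(3)
    unfolding smoothly_compatible_def by blast
  have inv: "(D' \<circ> D) = id"
    if "compat_chart B c" "compat_chart B d" "z \<in> transition_domain c d"
      "(transition_map c d has_derivative D) (at z)"
      "(transition_map d c has_derivative D') (at (transition_map c d z))" for c d z D D'
  proof -
    have ch: "is_chart (mtop B) c" "is_chart (mtop B) d" using that by (simp_all add: compat_chart_def)
    have "((\<lambda>x. transition_map d c (transition_map c d x)) has_derivative (\<lambda>x. D' (D x))) (at z)"
      by (rule has_derivative_compose[OF that(4,5)])
    then have "((\<lambda>x. x) has_derivative (\<lambda>x. D' (D x))) (at z)"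
      by (rule has_derivative_transform_within_open[OF _ transition_domain_open[OF ch] that(3)])
        (rule transition_inverse(2)[OF ch])
    then have "(\<lambda>x. D' (D x)) = (\<lambda>x. x)"
      using has_derivative_unique[OF _ has_derivative_ident] by blast
    then show ?thesis by (auto simp: fun_eq_iff)
  qed
  have ch: "is_chart (mtop B) c" "is_chart (mtop B) d" using c d by (simp_all add: compat_chart_def)
  note t = transition_inverse[OF ch z]
  obtain D where D1: "(transition_map c d has_derivative D) (at z)" using D[OF c d z] by blast
  obtain D' where D2: "(transition_map d c has_derivative D') (at (transition_map c d z))"
    using D[OF d c t(1)] by blast
  have "D' \<circ> D = id" by (rule inv[OF c d z D1 D2])
  moreover have "D \<circ> D' = id" using inv[OF d c t(1) D2] D1 t(2) by simp
  ultimately show ?thesis using that[OF D1] by (auto simp: fun_eq_iff)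
qed

text \<open>Turns a diffeomorphism between open sets of the model space into a new compatible chart;
  it is used to replace the angle by the straightened function.\<close>

lemma compat_chart_change_coordinates:
  assumes B: "smooth_manifold B" and c: "compat_chart B (U, \<phi>)"
    and D: "open D" "D \<subseteq> \<phi> ` U" "smooth_on D H"
    and E: "open E" "smooth_on E G"
    and HG: "\<And>z. z \<in> D \<Longrightarrow> H z \<in> E \<and> G (H z) = z" "\<And>w. w \<in> E \<Longrightarrow> G w \<in> D \<and> H (G w) = w"
  shows "compat_chart B (U \<inter> \<phi> -` D, H \<circ> \<phi>)" (is ?compat)
    and "(H \<circ> \<phi>) ` (U \<inter> \<phi> -` D) = E"
    and "\<And>w. w \<in> E \<Longrightarrow> inv_into (U \<inter> \<phi> -` D) (H \<circ> \<phi>) w = inv_into U \<phi> (G w)"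
proof -
  let ?U = "U \<inter> \<phi> -` D"
  have ch: "is_chart (mtop B) (U, \<phi>)" using c compat_chart_is_chart by auto
  have inj: "inj_on \<phi> U" by (rule chart_inj_on[OF ch])
  have 1: "openin (mtop B) ?U" by (rule chart_openin_preimage[OF ch D(1)])
  have sub: "subtopology (subtopology (mtop B) U) ?U = subtopology (mtop B) ?U"
    by (simp add: subtopology_subtopology)
  have "continuous_map (subtopology (mtop B) ?U) (top_of_set D) \<phi>"
    using chart_continuous[OF ch] sub continuous_map_from_subtopology[of "subtopology (mtop B) U" euclidean \<phi> ?U]
    by (auto simp: continuous_map_in_subtopology)
  moreover have "continuous_map (top_of_set D) euclidean H"
    using smooth_on_continuous_on[OF D(3)] by simp
  ultimately have 2: "continuous_map (subtopology (mtop B) ?U) euclidean (H \<circ> \<phi>)"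
    by (rule continuous_map_compose)
  have "continuous_map (top_of_set E) (top_of_set (\<phi> ` U)) G"
    using smooth_on_continuous_on[OF E(2)] HG(2) D(2) by (auto simp: continuous_map_in_subtopology)
  from continuous_map_compose[OF this chart_continuous_inv[OF ch]]
  have 3: "continuous_map (top_of_set E) (mtop B) (\<lambda>w. inv_into U \<phi> (G w))" by (simp add: o_def)
  have 4: "(H \<circ> \<phi>) x \<in> E \<and> inv_into U \<phi> (G ((H \<circ> \<phi>) x)) = x" if "x \<in> ?U" for x
    using that HG(1) inj by auto
  have 5: "inv_into U \<phi> (G w) \<in> ?U \<and> (H \<circ> \<phi>) (inv_into U \<phi> (G w)) = w" if "w \<in> E" for w
    using HG(2)[OF that] D(2) by (auto simp: f_inv_into_f inv_into_into subset_iff)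
  note I = is_chartI[OF 1 E(1) 2 3 4 5]
  show im: "(H \<circ> \<phi>) ` ?U = E" by (rule I(2))
  show inv: "inv_into ?U (H \<circ> \<phi>) w = inv_into U \<phi> (G w)" if "w \<in> E" for w using I(3) that by blast
  have "smoothly_compatible (?U, H \<circ> \<phi>) d" if d: "d \<in> atlas B" for d
  proof -
    obtain V \<kappa> where dV: "d = (V, \<kappa>)" by (cases d)
    have chV: "is_chart (mtop B) (V, \<kappa>)" using d B by (auto simp: dV smooth_manifold_def)
    have injV: "inj_on \<kappa> V" by (rule chart_inj_on[OF chV])
    have s: "smooth_on (\<phi> ` (U \<inter> V)) (\<kappa> \<circ> inv_into U \<phi>)" "smooth_on (\<kappa> ` (V \<inter> U)) (\<phi> \<circ> inv_into V \<kappa>)"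
      using c d unfolding compat_chart_def smoothly_compatible_def
      by (auto simp: dV transition_domain_def transition_map_def)
    have o1: "open ((H \<circ> \<phi>) ` (?U \<inter> V))" by (rule chart_open_image_Int[OF I(1) chart_openin[OF chV]])
    have o2: "open (\<kappa> ` (V \<inter> ?U))" by (rule chart_open_image_Int[OF chV 1])
    have E': "(H \<circ> \<phi>) ` (?U \<inter> V) \<subseteq> E" using im by blast
    have "smooth_on ((H \<circ> \<phi>) ` (?U \<inter> V)) (\<lambda>w. (\<kappa> \<circ> inv_into U \<phi>) (G w))"
      by (rule smooth_on_compose[OF o1 s(1) smooth_on_subset[OF E(2) E']]) (use HG(1) in auto)
    then have "smooth_on ((H \<circ> \<phi>) ` (?U \<inter> V)) (\<kappa> \<circ> inv_into ?U (H \<circ> \<phi>))"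
    proof (rule smooth_on_cong[OF _ o1])
      fix w assume "w \<in> (H \<circ> \<phi>) ` (?U \<inter> V)"
      then have "w \<in> E" using E' by blast
      from inv[OF this] show "(\<kappa> \<circ> inv_into U \<phi>) (G w) = (\<kappa> \<circ> inv_into ?U (H \<circ> \<phi>)) w" by simp
    qed
    moreover have "smooth_on (\<kappa> ` (V \<inter> ?U)) (\<lambda>w. H ((\<phi> \<circ> inv_into V \<kappa>) w))"
      by (rule smooth_on_compose[OF o2 D(3) smooth_on_subset[OF s(2)]]) (use injV in auto)
    ultimately show ?thesis
      by (simp add: smoothly_compatible_def transition_domain_def transition_map_def dV o_def)
  qed
  then show ?compat using I(1) unfolding compat_chart_def by blast
qed

section \<open>Local parametrizations of a circle bundle\<close>

lemma cis_eq_cis_iff: "cis s = cis t \<longleftrightarrow> (\<exists>n::int. s = t + 2 * pi * n)"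
proof -
  have "cis s = cis t \<longleftrightarrow> (\<exists>n::int. \<i> * s = \<i> * t + (of_int (2 * n) * pi) * \<i>)"
    by (simp only: cis_conv_exp exp_eq)
  also have "\<dots> \<longleftrightarrow> (\<exists>n::int. s = t + 2 * pi * n)"
    by (simp add: complex_eq_iff algebra_simps)
  finally show ?thesis .
qed

lemma inj_on_cis: "inj_on cis {a<..<a + 2 * pi}"
proof (rule inj_onI)
  fix s t assume st: "s \<in> {a<..<a + 2 * pi}" "t \<in> {a<..<a + 2 * pi}" and eq: "cis s = cis t"
  obtain n :: int where n: "s = t + 2 * pi * n" using cis_eq_cis_iff eq by blast
  have "pi * real_of_int n < pi * 1" "pi * (- 1) < pi * real_of_int n"
    using st n unfolding greaterThanLessThan_iff by linarith+
  then have "\<bar>real_of_int n\<bar> < 1" by (simp only: mult_less_cancel_left_pos pi_gt_zero abs_less_iff) simp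
  then have "n = 0" by linarith
  with n show "s = t" by simp
qed

abbreviation angle :: "real \<Rightarrow> complex \<Rightarrow> real" where
  "angle a \<equiv> inv_into {a<..<a + 2 * pi} cis"

lemma angle_cis: "t \<in> {a<..<a + 2 * pi} \<Longrightarrow> angle a (cis t) = t"
  by (simp add: inv_into_f_f[OF inj_on_cis])

lemma cis_notin_nonpos_Reals:
  assumes "- pi < u" "u < pi"
  shows "cis u \<notin> \<real>\<^sub>\<le>\<^sub>0"
proof
  assume "cis u \<in> \<real>\<^sub>\<le>\<^sub>0"
  then have "sin u = 0" "cos u \<le> 0" by (auto simp: complex_nonpos_Reals_iff)
  then have "u = 0" using sin_eq_0_pi assms by blast
  with \<open>cos u \<le> 0\<close> show False by simp
qed

text \<open>The arc omits only the point with angle \<open>a\<close>. Rotation by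
  \<open>- (a + pi)\<close> moves this point to -1, where the circle meets the branch cut of
  \<open>Arg\<close>; openness of the arc and continuity of its angle are then inherited from the
  principal argument.\<close>

lemma arc_eq:
  "cis ` {a<..<a + 2 * pi} = sphere 0 1 \<inter> (\<lambda>z. z * cis (- (a + pi))) -` (- \<real>\<^sub>\<le>\<^sub>0)"
proof (intro equalityI subsetI)
  fix z assume "z \<in> cis ` {a<..<a + 2 * pi}"
  then obtain t where t: "z = cis t" "a < t" "t < a + 2 * pi" by auto
  have "cis (t + - (a + pi)) \<notin> \<real>\<^sub>\<le>\<^sub>0" using t by (intro cis_notin_nonpos_Reals) auto
  then show "z \<in> sphere 0 1 \<inter> (\<lambda>z. z * cis (- (a + pi))) -` (- \<real>\<^sub>\<le>\<^sub>0)"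
    unfolding t(1) vimage_eq Int_iff cis_mult by simp
next
  fix z assume z: "z \<in> sphere 0 1 \<inter> (\<lambda>z. z * cis (- (a + pi))) -` (- \<real>\<^sub>\<le>\<^sub>0)"
  define w where "w = z * cis (- (a + pi))"
  have w: "norm w = 1" "w \<notin> \<real>\<^sub>\<le>\<^sub>0" using z unfolding w_def by (simp_all add: norm_mult)
  then have "w \<noteq> 0" by auto
  then have c: "cis (Arg w) = w" using w(1) by (simp add: cis_Arg sgn_eq)
  have "Arg w \<noteq> pi"
  proof
    assume "Arg w = pi"
    with c have "w = -1" by simp
    with w(2) show False by (simp add: complex_nonpos_Reals_iff)
  qed
  then have b: "- pi < Arg w" "Arg w < pi" using Arg_bounded[of w] by auto
  have "z = w * cis (a + pi)" by (simp add: w_def cis_mult)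
  also have "\<dots> = cis (Arg w + (a + pi))" by (subst c[symmetric]) (simp add: cis_mult)
  finally show "z \<in> cis ` {a<..<a + 2 * pi}" using b by (intro image_eqI) auto
qed

lemma openin_arc: "openin (top_of_set (sphere 0 1)) (cis ` {a<..<a + 2 * pi})"
  unfolding arc_eq
  by (intro continuous_openin_preimage_gen continuous_intros) (simp add: open_Compl)

lemma continuous_on_angle: "continuous_on (cis ` {a<..<a + 2 * pi}) (angle a)"
proof -
  have "continuous_on (cis ` {a<..<a + 2 * pi}) (\<lambda>z. a + pi + Arg (z * cis (- (a + pi))))"
    by (intro continuous_intros) (auto simp: arc_eq)
  moreover have "a + pi + Arg (cis t * cis (- (a + pi))) = angle a (cis t)"
    if "t \<in> {a<..<a + 2 * pi}" for t
    using that by (simp only: angle_cis cis_mult) (subst Arg_cis, auto)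
  ultimately show ?thesis
    by (elim continuous_on_eq) auto
qed

lemma smooth_map_charts:
  assumes "smooth_map M N f" "(U, \<phi>) \<in> atlas M" "(V, \<psi>) \<in> atlas N"
  shows "smooth_on (\<phi> ` {x \<in> U. f x \<in> V}) (\<psi> \<circ> f \<circ> inv_into U \<phi>)"
  using assms by (auto simp: smooth_map_def)

text \<open>\<open>\<Psi> (y, t)\<close> is the point with angle \<open>t\<close> in the fiber over the point with coordinate \<open>y\<close>, and
  \<open>\<zeta>\<close> is the corresponding circle coordinate.\<close>

locale circle_bundle_chart =
  fixes B :: "('b, 'e::model_space \<times> real) manifold" and p :: "'b \<Rightarrow> 'a" and M :: "('a, 'e) manifold"
    and V :: "'a set" and \<phi> :: "'a \<Rightarrow> 'e" and a :: 'e and R :: real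
    and \<Psi> :: "'e \<times> real \<Rightarrow> 'b" and \<zeta> :: "'b \<Rightarrow> complex"
  assumes manifolds: "smooth_manifold B" "smooth_manifold M"
    and chart: "(V, \<phi>) \<in> atlas M" "0 < R" "ball a R \<subseteq> \<phi> ` V"
    and continuous_param: "continuous_map (top_of_set (ball a R \<times> UNIV)) (mtop B) \<Psi>"
    and p_param: "\<And>y t. y \<in> ball a R \<Longrightarrow> p (\<Psi> (y, t)) = inv_into V \<phi> y"
    and angle_param: "\<And>y t. y \<in> ball a R \<Longrightarrow> \<zeta> (\<Psi> (y, t)) = cis t"
    and norm_circle_coord: "\<And>b. b \<in> topspace (mtop B) \<Longrightarrow> p b \<in> inv_into V \<phi> ` ball a R \<Longrightarrow> norm (\<zeta> b) = 1"
    and param_eqI: "\<And>b t. b \<in> topspace (mtop B) \<Longrightarrow> p b \<in> inv_into V \<phi> ` ball a R \<Longrightarrow> \<zeta> b = cis t \<Longrightarrow>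
      \<Psi> (\<phi> (p b), t) = b"
    and continuous_circle_coord: "continuous_map
      (subtopology (mtop B) {b \<in> topspace (mtop B). p b \<in> inv_into V \<phi> ` ball a R}) euclidean \<zeta>"
    and box_chart: "\<And>s. compat_chart B
      (\<Psi> ` (ball a R \<times> {s<..<s + 2 * pi}), \<lambda>b. (\<phi> (p b), angle s (\<zeta> b)))"

text \<open>The parametrization is the inverse of a local trivialization, preceded by a chart of the
  base and by \<open>cis\<close>. The box charts are product charts of the trivialization, which is
  why they are compatible with the atlas of the total space.\<close>

lemma ex_circle_bundle_chart:
  fixes B :: "('b, 'e::model_space \<times> real) manifold"
  assumes circle_bundle: "smooth_circle_bundle B p M" and x: "x \<in> topspace (mtop M)"
  obtains V \<phi> R \<Psi> \<zeta> where "circle_bundle_chart B p M V \<phi> (\<phi> x) R \<Psi> \<zeta>" "x \<in> V"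
proof -
  have B: "smooth_manifold B" and M: "smooth_manifold M"
    using circle_bundle by (auto simp: smooth_circle_bundle_def)
  obtain U \<Phi> where U: "openin (mtop M) U" "x \<in> U"
    and diff: "diffeomorphism (open_submanifold B {b \<in> topspace (mtop B). p b \<in> U})
          (prod_manifold (open_submanifold M U) circle) \<Phi>"
    and fst\<Phi>: "\<And>b. b \<in> topspace (mtop B) \<Longrightarrow> p b \<in> U \<Longrightarrow> fst (\<Phi> b) = p b"
    using circle_bundle x unfolding smooth_circle_bundle_def by meson
  define Y where "Y = {b \<in> topspace (mtop B). p b \<in> U}"
  let ?P = "prod_manifold (open_submanifold M U) circle"
  obtain g where hom: "homeomorphic_maps (mtop (open_submanifold B Y)) (mtop ?P) \<Phi> g"
    and sm: "smooth_map (open_submanifold B Y) ?P \<Phi>" "smooth_map ?P (open_submanifold B Y) g"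
    using diff unfolding diffeomorphism_def Y_def by blast
  have topU: "topspace (mtop M) \<inter> U = U" using openin_subset[OF U(1)] by blast
  have mP: "mtop ?P = prod_topology (subtopology (mtop M) U) (top_of_set (sphere 0 1))"
    by (simp add: prod_manifold_def open_submanifold_def circle_def)
  have mY: "mtop (open_submanifold B Y) = subtopology (mtop B) Y" by (simp add: open_submanifold_def)
  have YB: "Y \<subseteq> topspace (mtop B)" by (auto simp: Y_def)
  have cont\<Phi>: "continuous_map (subtopology (mtop B) Y) (mtop ?P) \<Phi>"
    and contg: "continuous_map (mtop ?P) (subtopology (mtop B) Y) g"
    and g\<Phi>: "\<And>b. b \<in> Y \<Longrightarrow> g (\<Phi> b) = b"
    and \<Phi>g: "\<And>u z. u \<in> U \<Longrightarrow> norm z = 1 \<Longrightarrow> \<Phi> (g (u, z)) = (u, z)"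
    using hom YB topU unfolding homeomorphic_maps_def mY by (auto simp: mP)
  have gY: "g (u, z) \<in> Y" if "u \<in> U" "norm z = 1" for u z
    using continuous_map_image_subset_topspace[OF contg] that topU YB by (auto simp: mP image_subset_iff)
  have \<Phi>P: "\<Phi> b = (p b, snd (\<Phi> b))" "p b \<in> U" "norm (snd (\<Phi> b)) = 1" if "b \<in> Y" for b
  proof -
    show "\<Phi> b = (p b, snd (\<Phi> b))" "p b \<in> U" using that fst\<Phi>[of b] by (auto simp: Y_def prod_eq_iff)
    have "\<Phi> b \<in> topspace (mtop ?P)"
      using continuous_map_image_subset_topspace[OF cont\<Phi>] that YB by auto
    then show "norm (snd (\<Phi> b)) = 1" by (auto simp: mP)
  qed
  have pg: "p (g (u, z)) = u" if "u \<in> U" "norm z = 1" for u z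
    using \<Phi>P(1)[OF gY[OF that]] \<Phi>g[OF that] by simp
  obtain V \<phi> where V: "(V, \<phi>) \<in> atlas M" "x \<in> V" by (rule atlas_covers[OF M x])
  have ch: "is_chart (mtop M) (V, \<phi>)" using M V(1) by (auto simp: smooth_manifold_def)
  have inj: "inj_on \<phi> V" by (rule chart_inj_on[OF ch])
  have "open (\<phi> ` (V \<inter> U))" "\<phi> x \<in> \<phi> ` (V \<inter> U)"
    using chart_open_image_Int[OF ch U(1)] V(2) U(2) by auto
  \<comment> \<open>The ball has to fit into the chart domain and the trivializing set at
    once.\<close>
  then obtain R where R: "0 < R" "ball (\<phi> x) R \<subseteq> \<phi> ` (V \<inter> U)"
    using open_contains_ball_eq by blast
  let ?b = "ball (\<phi> x) R"
  define q where "q = inv_into V \<phi>"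
  have q: "q y \<in> V" "q y \<in> U" "\<phi> (q y) = y" if "y \<in> ?b" for y
    using that R(2) inj by (auto simp: q_def)
  have qball: "q ` ?b = V \<inter> \<phi> -` ?b"
  proof (intro equalityI subsetI)
    fix u assume u: "u \<in> V \<inter> \<phi> -` ?b"
    then have "u = q (\<phi> u)" using inj by (simp add: q_def)
    with u show "u \<in> q ` ?b" by blast
  qed (use q in auto)
  have q\<phi>: "q (\<phi> u) = u" if "u \<in> V" for u using that inj by (simp add: q_def)
  have open_qball: "openin (mtop M) (q ` ?b)"
    unfolding qball by (rule chart_openin_preimage[OF ch]) simp
  define \<Psi> where "\<Psi> = (\<lambda>z. g (q (fst z), cis (snd z)))"
  define \<zeta> where "\<zeta> = (\<lambda>b. snd (\<Phi> b))"
  have contq: "continuous_map (top_of_set ?b) (subtopology (mtop M) U) q"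
    using continuous_map_from_subtopology_mono[OF chart_continuous_inv[OF ch], of ?b] R(2) q(2)
    by (auto simp: q_def continuous_map_in_subtopology)
  have cont1: "continuous_map (top_of_set (?b \<times> UNIV)) (mtop ?P) (\<lambda>z. (q (fst z), cis (snd z)))"
    unfolding mP
  proof (intro continuous_map_pairedI)
    have "continuous_map (top_of_set (?b \<times> UNIV)) (top_of_set ?b) fst"
      by (auto simp: continuous_map_in_subtopology intro!: continuous_intros)
    from continuous_map_compose[OF this contq]
    show "continuous_map (top_of_set (?b \<times> UNIV)) (subtopology (mtop M) U) (\<lambda>z. q (fst z))"
      by (simp add: o_def)
    show "continuous_map (top_of_set (?b \<times> UNIV)) (top_of_set (sphere 0 1)) (\<lambda>z. cis (snd z))"
      by (auto simp: continuous_map_in_subtopology intro!: continuous_intros)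
  qed
  have cont\<Psi>: "continuous_map (top_of_set (?b \<times> UNIV)) (mtop B) \<Psi>"
    using continuous_map_compose[OF cont1 contg] unfolding continuous_map_in_subtopology
    by (simp add: \<Psi>_def o_def)
  have p\<Psi>: "p (\<Psi> (y, t)) = q y" and \<zeta>\<Psi>: "\<zeta> (\<Psi> (y, t)) = cis t" and \<Psi>Y: "\<Psi> (y, t) \<in> Y"
    if "y \<in> ?b" for y t
    using q[OF that] by (auto simp: \<Psi>_def pg \<zeta>_def \<Phi>g gY)
  have inY: "b \<in> Y" if "b \<in> topspace (mtop B)" "p b \<in> q ` ?b" for b
    using that q(2) by (auto simp: Y_def)
  have \<Psi>eq: "\<Psi> (\<phi> (p b), t) = b" if "b \<in> topspace (mtop B)" "p b \<in> q ` ?b" "\<zeta> b = cis t" for b t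
  proof -
    have "p b \<in> V" using that(2) qball by auto
    then have "\<Psi> (\<phi> (p b), t) = g (p b, \<zeta> b)" by (simp add: \<Psi>_def q\<phi> that(3))
    also have "\<dots> = g (\<Phi> b)" using \<Phi>P(1)[OF inY[OF that(1,2)]] by (metis \<zeta>_def)
    also have "\<dots> = b" by (rule g\<Phi>[OF inY[OF that(1,2)]])
    finally show ?thesis .
  qed
  have cont\<zeta>Y: "continuous_map (subtopology (mtop B) Y) (top_of_set (sphere 0 1)) \<zeta>"
    using continuous_map_compose[OF cont\<Phi>[unfolded mP] continuous_map_snd] by (simp add: \<zeta>_def o_def)
  have contpY: "continuous_map (subtopology (mtop B) Y) (subtopology (mtop M) U) p"
  proof -
    have "continuous_map (subtopology (mtop B) Y) (subtopology (mtop M) U) (\<lambda>b. fst (\<Phi> b))"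
      using continuous_map_compose[OF cont\<Phi>[unfolded mP] continuous_map_fst] by (simp add: o_def)
    then show ?thesis by (rule continuous_map_eq) (auto simp: fst\<Phi> Y_def)
  qed
  have openY: "openin (mtop B) Y"
    using circle_bundle U(1) unfolding Y_def smooth_circle_bundle_def smooth_map_def
    by (intro openin_continuous_map_preimage) auto
  have box: "compat_chart B (\<Psi> ` (?b \<times> {s<..<s + 2 * pi}), \<lambda>b. (\<phi> (p b), angle s (\<zeta> b)))" for s
  proof -
    let ?I = "{s<..<s + 2 * pi}"
    let ?D = "?b \<times> ?I"
    let ?W = "\<Psi> ` ?D"
    define \<xi> where "\<xi> = (\<lambda>b. (\<phi> (p b), angle s (\<zeta> b)))"
    have \<xi>\<Psi>: "\<xi> (\<Psi> z) = z" if "z \<in> ?D" for z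
      using that p\<Psi> \<zeta>\<Psi> q(3) by (cases z) (auto simp: \<xi>_def angle_cis)
    \<comment> \<open>Described by conditions on \<open>p\<close> and \<open>\<zeta>\<close>, the
      box is open because these maps are continuous.\<close>
    have W: "?W = {b \<in> topspace (subtopology (mtop B) Y). p b \<in> q ` ?b}
        \<inter> {b \<in> topspace (subtopology (mtop B) Y). \<zeta> b \<in> cis ` ?I}" (is "_ = ?W1 \<inter> ?W2")
    proof (intro equalityI subsetI)
      fix b assume "b \<in> ?W"
      then show "b \<in> ?W1 \<inter> ?W2" using \<Psi>Y YB by (auto simp: p\<Psi> \<zeta>\<Psi>)
    next
      fix b assume b: "b \<in> ?W1 \<inter> ?W2"
      then obtain t where t: "t \<in> ?I" "\<zeta> b = cis t" by auto
      have "\<Psi> (\<phi> (p b), t) = b" using b t(2) by (intro \<Psi>eq) auto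
      moreover have "\<phi> (p b) \<in> ?b" using b q(3) by auto
      ultimately show "b \<in> ?W" using t(1) by (metis SigmaI image_eqI)
    qed
    have WY: "?W \<subseteq> Y" using \<Psi>Y by auto
    have "openin (subtopology (mtop B) Y) (?W1 \<inter> ?W2)"
    proof (intro openin_Int openin_continuous_map_preimage[OF contpY] openin_continuous_map_preimage[OF cont\<zeta>Y])
      show "openin (subtopology (mtop M) U) (q ` ?b)"
        using open_qball q(2) by (intro openin_subset_topspace_eq[THEN iffD2] subset_openin_subtopology) auto
      show "openin (top_of_set (sphere 0 1)) (cis ` ?I)" by (rule openin_arc)
    qed
    then have 1: "openin (mtop B) ?W" using openY W openin_trans_full by metis
    have 2: "continuous_map (subtopology (mtop B) ?W) euclidean \<xi>"
    proof -
      have "continuous_map (subtopology (mtop B) ?W) (subtopology (mtop M) V) p"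
        using continuous_map_from_subtopology_mono[OF contpY WY] p\<Psi> q(1)
        by (auto simp: continuous_map_in_subtopology)
      from continuous_map_compose[OF this chart_continuous[OF ch]]
      have "continuous_map (subtopology (mtop B) ?W) euclidean (\<lambda>b. \<phi> (p b))" by (simp add: o_def)
      moreover have "continuous_map (subtopology (mtop B) ?W) (top_of_set (cis ` ?I)) \<zeta>"
        using continuous_map_from_subtopology_mono[OF cont\<zeta>Y WY] \<zeta>\<Psi>
        by (auto simp: continuous_map_in_subtopology)
      then have "continuous_map (subtopology (mtop B) ?W) euclidean (angle s \<circ> \<zeta>)"
        by (rule continuous_map_compose) (simp add: continuous_on_angle)
      ultimately have "continuous_map (subtopology (mtop B) ?W) (prod_topology euclidean euclidean)
          (\<lambda>b. (\<phi> (p b), (angle s \<circ> \<zeta>) b))" by (rule continuous_map_pairedI)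
      then show ?thesis by (simp add: euclidean_product_topology \<xi>_def)
    qed
    have 3: "continuous_map (top_of_set ?D) (mtop B) \<Psi>"
      by (rule continuous_map_from_subtopology_mono[OF cont\<Psi>]) auto
    have 4: "\<xi> b \<in> ?D \<and> \<Psi> (\<xi> b) = b" if "b \<in> ?W" for b
      using that \<xi>\<Psi> by auto
    have 5: "\<Psi> z \<in> ?W \<and> \<xi> (\<Psi> z) = z" if "z \<in> ?D" for z
      using that \<xi>\<Psi> by auto
    note I = is_chartI[OF 1 open_Times[OF open_ball open_greaterThanLessThan] 2 3 4 5]
    have arc: "angle s ` cis ` ?I = ?I" by (force simp: angle_cis)
    have injP: "inj_on (map_prod \<phi> (angle s)) ((V \<inter> U) \<times> cis ` ?I)"
      by (rule map_prod_inj_on) (use inj in \<open>auto intro: inj_on_subset inj_on_inv_into\<close>)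
    have chP: "((V \<inter> U) \<times> cis ` ?I, map_prod \<phi> (angle s)) \<in> atlas ?P"
      using V(1) by (force simp: prod_manifold_def open_submanifold_def circle_def image_iff)
    have \<Phi>W: "\<Phi> b \<in> (V \<inter> U) \<times> cis ` ?I" "\<xi> b = map_prod \<phi> (angle s) (\<Phi> b)" if "b \<in> ?W" for b
    proof -
      have "b \<in> Y" "p b \<in> V \<inter> U" "\<zeta> b \<in> cis ` ?I" using that \<Psi>Y p\<Psi> q \<zeta>\<Psi> by auto
      moreover have "\<Phi> b = (p b, \<zeta> b)" using \<Phi>P(1)[OF \<open>b \<in> Y\<close>] by (simp add: \<zeta>_def)
      ultimately show "\<Phi> b \<in> (V \<inter> U) \<times> cis ` ?I" "\<xi> b = map_prod \<phi> (angle s) (\<Phi> b)"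
        by (simp_all add: \<xi>_def)
    qed
    \<comment> \<open>The transition maps are the coordinate expressions of \<open>g\<close> and
      \<open>\<Phi>\<close>, which are smooth because the trivialization is a
      diffeomorphism.\<close>
    have "smoothly_compatible (?W, \<xi>) d" if d: "d \<in> atlas B" for d
    proof -
      obtain C \<kappa> where dC: "d = (C, \<kappa>)" by (cases d)
      have chC: "is_chart (mtop B) (C, \<kappa>)" using d B by (auto simp: dC smooth_manifold_def)
      have injC: "inj_on \<kappa> C" by (rule chart_inj_on[OF chC])
      have chCY: "(C \<inter> Y, \<kappa>) \<in> atlas (open_submanifold B Y)"
        using d by (force simp: dC open_submanifold_def)
      have o1: "open (\<xi> ` (?W \<inter> C))" by (rule chart_open_image_Int[OF I(1) chart_openin[OF chC]])
      have o2: "open (\<kappa> ` (C \<inter> ?W))" by (rule chart_open_image_Int[OF chC 1])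
      have "smooth_on (\<xi> ` (?W \<inter> C)) (\<kappa> \<circ> inv_into ?W \<xi>)"
      proof (rule smooth_on_cong[OF smooth_on_subset[OF smooth_map_charts[OF sm(2) chP chCY]] o1])
        show "\<xi> ` (?W \<inter> C) \<subseteq>
            map_prod \<phi> (angle s) ` {z \<in> (V \<inter> U) \<times> cis ` ?I. g z \<in> C \<inter> Y}"
        proof
          fix w assume "w \<in> \<xi> ` (?W \<inter> C)"
          then obtain b where b: "w = \<xi> b" "b \<in> ?W" "b \<in> C" by blast
          have "g (\<Phi> b) = b" using b(2) WY g\<Phi> by blast
          then show "w \<in> map_prod \<phi> (angle s) ` {z \<in> (V \<inter> U) \<times> cis ` ?I. g z \<in> C \<inter> Y}"
            unfolding b(1) using \<Phi>W[OF b(2)] b(2,3) WY by (intro image_eqI[of _ _ "\<Phi> b"]) auto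
        qed
        fix w assume "w \<in> \<xi> ` (?W \<inter> C)"
        then obtain b where b: "w = \<xi> b" "b \<in> ?W" "b \<in> C" by blast
        have "g (\<Phi> b) = b" using b(2) WY g\<Phi> by blast
        then show "(\<kappa> \<circ> g \<circ> inv_into ((V \<inter> U) \<times> cis ` ?I) (map_prod \<phi> (angle s))) w
            = (\<kappa> \<circ> inv_into ?W \<xi>) w"
          using \<Phi>W[OF b(2)] injP I(3) 4[OF b(2)] b(1) by simp
      qed
      moreover have "smooth_on (\<kappa> ` (C \<inter> ?W)) (\<xi> \<circ> inv_into C \<kappa>)"
      proof (rule smooth_on_cong[OF smooth_on_subset[OF smooth_map_charts[OF sm(1) chCY chP]] o2])
        show "\<kappa> ` (C \<inter> ?W) \<subseteq> \<kappa> ` {b \<in> C \<inter> Y. \<Phi> b \<in> (V \<inter> U) \<times> cis ` ?I}"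
          using \<Phi>W(1) WY by blast
        fix w assume "w \<in> \<kappa> ` (C \<inter> ?W)"
        then obtain b where b: "w = \<kappa> b" "b \<in> C" "b \<in> ?W" by blast
        then have "inv_into (C \<inter> Y) \<kappa> w = b" "inv_into C \<kappa> w = b"
          using WY injC by (auto intro!: inv_into_f_eq intro: inj_on_subset)
        then show "(map_prod \<phi> (angle s) \<circ> \<Phi> \<circ> inv_into (C \<inter> Y) \<kappa>) w = (\<xi> \<circ> inv_into C \<kappa>) w"
          using \<Phi>W(2)[OF b(3)] by simp
      qed
      ultimately show ?thesis
        by (simp add: smoothly_compatible_def transition_domain_def transition_map_def dC)
    qed
    with I(1) show ?thesis unfolding compat_chart_def \<xi>_def by blast
  qed
  have "circle_bundle_chart B p M V \<phi> (\<phi> x) R \<Psi> \<zeta>"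
  proof (unfold_locales, unfold q_def[symmetric])
    show "ball (\<phi> x) R \<subseteq> \<phi> ` V" using R(2) by blast
    show "norm (\<zeta> b) = 1" if "b \<in> topspace (mtop B)" "p b \<in> q ` ?b" for b
      using \<Phi>P(3)[OF inY[OF that]] by (simp add: \<zeta>_def)
    show "continuous_map (subtopology (mtop B) {b \<in> topspace (mtop B). p b \<in> q ` ?b}) euclidean \<zeta>"
      by (rule continuous_map_from_subtopology_mono[of _ Y])
        (use cont\<zeta>Y inY in \<open>auto simp: continuous_map_in_subtopology\<close>)
  qed (use B M V(1) R(1) cont\<Psi> p\<Psi> \<zeta>\<Psi> \<Psi>eq box in auto)
  then show ?thesis using V(2) by (rule that)
qed

section \<open>Primitives of the cocycle in a local parametrization\<close>

text \<open>Taken at radius \<open>R\<close> for the domain of a parametrization, and at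
  \<open>R / 2\<close> for the set on which \<open>bump\<close> is positive.\<close>

definition base_nbhd :: "'a set \<Rightarrow> ('a \<Rightarrow> 'e::model_space) \<Rightarrow> 'e \<Rightarrow> real \<Rightarrow> 'a set" where
  "base_nbhd V \<phi> a R = inv_into V \<phi> ` ball a R"

text \<open>One minus the square of twice the coordinate distance over \<open>R\<close> is positive
  exactly within half the radius. The shell that remains leaves room for the extension by
  zero.\<close>

definition bump :: "'a set \<Rightarrow> ('a \<Rightarrow> 'e::model_space) \<Rightarrow> 'e \<Rightarrow> real \<Rightarrow> 'a \<Rightarrow> real" where
  "bump V \<phi> a R q = (if q \<in> base_nbhd V \<phi> a R
     then cutoff 0 (1 - 4 / R\<^sup>2 * ((\<phi> q - a) \<bullet> (\<phi> q - a))) else 0)"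

definition primitive :: "((real \<Rightarrow> 'b) \<Rightarrow> real) \<Rightarrow> 'e::model_space \<Rightarrow> ('e \<times> real \<Rightarrow> 'b) \<Rightarrow> 'e \<times> real \<Rightarrow> real"
  where "primitive l a \<Psi> z = l (\<lambda>s. \<Psi> ((a, 0) + s *\<^sub>R (z - (a, 0))))"

text \<open>The segment from \<open>(a, 0)\<close> to \<open>(a, 2 * pi)\<close> runs once round the
  central fiber.\<close>

definition fiber_period :: "((real \<Rightarrow> 'b) \<Rightarrow> real) \<Rightarrow> 'e::model_space \<Rightarrow> ('e \<times> real \<Rightarrow> 'b) \<Rightarrow> real"
  where "fiber_period l a \<Psi> = primitive l a \<Psi> (a, 2 * pi)"

text \<open>Subtracting the multiple of the angle with the same period makes the primitive descend to the
  total space; the resulting function is not continuous in general.\<close>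

definition reduced_primitive ::
    "((real \<Rightarrow> 'b) \<Rightarrow> real) \<Rightarrow> 'e::model_space \<Rightarrow> real \<Rightarrow> ('e \<times> real \<Rightarrow> 'b) \<Rightarrow> 'b \<Rightarrow> real" where
  "reduced_primitive l a R \<Psi> b = (let z = SOME z. z \<in> ball a R \<times> UNIV \<and> \<Psi> z = b in
     primitive l a \<Psi> z - fiber_period l a \<Psi> * (snd z / (2 * pi)))"

lemma base_nbhd_eq:
  assumes "is_chart X (V, \<phi>)" "ball a R \<subseteq> \<phi> ` V"
  shows "base_nbhd V \<phi> a R = V \<inter> \<phi> -` ball a R"
proof (intro equalityI subsetI)
  fix q assume q: "q \<in> V \<inter> \<phi> -` ball a R"
  then have "q = inv_into V \<phi> (\<phi> q)" using chart_inj_on[OF assms(1)] by simp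
  with q show "q \<in> base_nbhd V \<phi> a R" unfolding base_nbhd_def by blast
next
  fix q assume "q \<in> base_nbhd V \<phi> a R"
  then obtain y where y: "q = inv_into V \<phi> y" "y \<in> ball a R" by (auto simp: base_nbhd_def)
  then have "y \<in> \<phi> ` V" using assms(2) by blast
  with y show "q \<in> V \<inter> \<phi> -` ball a R" by (auto simp: inv_into_into f_inv_into_f)
qed

lemma base_nbhd_openin:
  assumes "is_chart X (V, \<phi>)" "ball a R \<subseteq> \<phi> ` V"
  shows "openin X (base_nbhd V \<phi> a R)"
  unfolding base_nbhd_eq[OF assms] by (rule chart_openin_preimage[OF assms(1)]) simp

context circle_bundle_chart
begin

abbreviation "U \<equiv> base_nbhd V \<phi> a R"

section \<open>Coordinates over one ball\<close>

lemma chart_V: "is_chart (mtop M) (V, \<phi>)"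
  using manifolds(2) chart(1) by (simp add: smooth_manifold_def)

lemma base_coord:
  assumes "y \<in> ball a R"
  shows "inv_into V \<phi> y \<in> V" "\<phi> (inv_into V \<phi> y) = y" "inv_into V \<phi> y \<in> U"
proof -
  have "y \<in> \<phi> ` V" using assms chart(3) by blast
  then show "inv_into V \<phi> y \<in> V" "\<phi> (inv_into V \<phi> y) = y"
    by (auto simp: inv_into_into f_inv_into_f)
  show "inv_into V \<phi> y \<in> U" using assms by (simp add: base_nbhd_def)
qed

lemma coord_base:
  assumes "q \<in> U"
  shows "q \<in> V" "\<phi> q \<in> ball a R" "inv_into V \<phi> (\<phi> q) = q"
  using assms base_coord unfolding base_nbhd_def by auto

lemma openin_base_nbhd: "openin (mtop M) U"
  by (rule base_nbhd_openin[OF chart_V chart(3)])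

lemma param_in:
  assumes "y \<in> ball a R"
  shows "\<Psi> (y, t) \<in> topspace (mtop B)" "p (\<Psi> (y, t)) \<in> U" "\<phi> (p (\<Psi> (y, t))) = y"
  using continuous_map_image_subset_topspace[OF continuous_param] assms base_coord[OF assms]
  by (auto simp: p_param image_subset_iff)

lemma param_cong: "y \<in> ball a R \<Longrightarrow> cis s = cis t \<Longrightarrow> \<Psi> (y, s) = \<Psi> (y, t)"
  using param_eqI[of "\<Psi> (y, t)" s] param_in[of y t] by (simp add: angle_param base_nbhd_def)

lemma param_eq_iff:
  assumes "y \<in> ball a R" "y' \<in> ball a R"
  shows "\<Psi> (y, s) = \<Psi> (y', t) \<longleftrightarrow> y = y' \<and> cis s = cis t"
  using assms param_cong param_in(3) angle_param by metis

lemma param_surj: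
  assumes "b \<in> topspace (mtop B)" "p b \<in> U"
  obtains t where "\<phi> (p b) \<in> ball a R" "\<Psi> (\<phi> (p b), t) = b"
proof -
  have "norm (\<zeta> b) = 1" using norm_circle_coord assms by (simp add: base_nbhd_def)
  then obtain t where "\<zeta> b = cis t" using complex_unimodular_polar[of "\<zeta> b"] 
    by (metis cis.ctr complex_eq_iff)
  then have "\<Psi> (\<phi> (p b), t) = b" using param_eqI assms by (simp add: base_nbhd_def)
  with coord_base(2)[OF assms(2)] show ?thesis by (rule that)
qed

lemma param_period: "y \<in> ball a R \<Longrightarrow> \<Psi> (y, t + 2 * pi) = \<Psi> (y, t)"
  by (rule param_cong) (simp_all add: complex_eq_iff)

definition "angle_box s = \<Psi> ` (ball a R \<times> {s<..<s + 2 * pi})"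
definition "box_coord s b = (\<phi> (p b), angle s (\<zeta> b))"

lemma compat_box: "compat_chart B (angle_box s, box_coord s)"
  using box_chart[of s] by (simp add: angle_box_def box_coord_def[abs_def])

lemma box_coord_param: "z \<in> ball a R \<times> {s<..<s + 2 * pi} \<Longrightarrow> box_coord s (\<Psi> z) = z"
  by (cases z) (auto simp: box_coord_def param_in(3) angle_param angle_cis)

lemma box_coord_image: "box_coord s ` angle_box s = ball a R \<times> {s<..<s + 2 * pi}"
  unfolding angle_box_def image_image using box_coord_param by (simp cong: image_cong)

lemma inv_box_coord:
  assumes "z \<in> ball a R \<times> {s<..<s + 2 * pi}"
  shows "inv_into (angle_box s) (box_coord s) z = \<Psi> z"
proof -
  have "\<Psi> z \<in> angle_box s" using assms by (simp add: angle_box_def)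
  then show ?thesis
    using chart_inj_on[OF compat_chart_is_chart[OF compat_box]] box_coord_param[OF assms]
    by (metis inv_into_f_f)
qed

section \<open>The bump function of one ball\<close>

lemma bump_pos: "q \<in> base_nbhd V \<phi> a (R / 2) \<Longrightarrow> 0 < bump V \<phi> a R q"
proof -
  assume "q \<in> base_nbhd V \<phi> a (R / 2)"
  then obtain y where y: "q = inv_into V \<phi> y" "y \<in> ball a (R / 2)" by (auto simp: base_nbhd_def)
  then have yR: "y \<in> ball a R" using chart(2) by auto
  have n: "2 * norm (y - a) < R" using y(2) by (simp add: dist_norm norm_minus_commute)
  then have "(2 * norm (y - a))\<^sup>2 < R\<^sup>2" by (intro power_strict_mono) auto
  then have "4 / R\<^sup>2 * ((y - a) \<bullet> (y - a)) < 1"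
    using chart(2) by (simp add: power2_norm_eq_inner[symmetric] power_mult_distrib field_simps)
  then show ?thesis
    unfolding bump_def y(1) using base_coord[OF yR] by (simp add: cutoff_def)
qed

text \<open>The bump vanishes off the image of the closed ball of half radius, which is compact and
  hence closed in the Hausdorff base.\<close>

lemma bump_zero_near:
  assumes "q \<in> topspace (mtop M)" "q \<notin> U"
  obtains W where "openin (mtop M) W" "q \<in> W" "\<And>q'. q' \<in> W \<Longrightarrow> bump V \<phi> a R q' = 0"
proof -
  let ?K = "inv_into V \<phi> ` cball a (R / 2)"
  have sub: "cball a (R / 2) \<subseteq> ball a R" using chart(2) by auto
  have "continuous_map (top_of_set (cball a (R / 2))) (mtop M) (inv_into V \<phi>)"
    by (rule continuous_map_from_subtopology_mono[OF chart_continuous_inv[OF chart_V]])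
      (use sub chart(3) in blast)
  moreover have "compactin (top_of_set (cball a (R / 2))) (cball a (R / 2))"
    by (simp add: compactin_subtopology)
  ultimately have "compactin (mtop M) ?K" by (rule image_compactin[rotated])
  then have "closedin (mtop M) ?K"
    using manifolds(2) by (auto simp: smooth_manifold_def intro: compactin_imp_closedin)
  then have "openin (mtop M) (topspace (mtop M) - ?K)" by (rule openin_diff[OF openin_topspace])
  moreover have "q \<in> topspace (mtop M) - ?K" using assms base_coord(3) sub by auto
  moreover have "bump V \<phi> a R q' = 0" if q': "q' \<in> topspace (mtop M) - ?K" for q'
  proof (cases "q' \<in> U")
    case True
    have "\<phi> q' \<notin> cball a (R / 2)" using q' coord_base(3)[OF True] by (metis DiffE image_eqI)
    then have "R \<le> 2 * norm (\<phi> q' - a)" by (simp add: dist_norm norm_minus_commute)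
    then have "R\<^sup>2 \<le> (2 * norm (\<phi> q' - a))\<^sup>2" using chart(2) by (intro power_mono) auto
    then have "1 \<le> 4 / R\<^sup>2 * ((\<phi> q' - a) \<bullet> (\<phi> q' - a))"
      using chart(2) by (simp add: power2_norm_eq_inner[symmetric] power_mult_distrib field_simps)
    then show ?thesis by (simp add: bump_def cutoff_def)
  qed (simp add: bump_def)
  ultimately show ?thesis by (rule that)
qed

text \<open>Stated for every chart of the base, because the weight belonging to one ball is later
  read in the coordinates of another.\<close>

lemma smooth_on_bump:
  assumes c: "(V', \<phi>') \<in> atlas M"
  shows "smooth_on (\<phi>' ` V') (\<lambda>y. bump V \<phi> a R (inv_into V' \<phi>' y))"
proof (rule smooth_on_local)
  fix y assume "y \<in> \<phi>' ` V'"
  then obtain q where q: "q \<in> V'" "y = \<phi>' q" by blast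
  have ch: "is_chart (mtop M) (V', \<phi>')" using c manifolds(2) by (simp add: smooth_manifold_def)
  have inj: "inj_on \<phi>' V'" by (rule chart_inj_on[OF ch])
  show "\<exists>N. open N \<and> y \<in> N \<and> smooth_on N (\<lambda>y. bump V \<phi> a R (inv_into V' \<phi>' y))"
  proof (cases "q \<in> U")
    case True
    let ?N = "\<phi>' ` (V' \<inter> U)"
    have N: "open ?N" by (rule chart_open_image_Int[OF ch openin_base_nbhd])
    have "smooth_on (\<phi>' ` (V' \<inter> V)) (\<phi> \<circ> inv_into V' \<phi>')"
      using manifolds(2) c chart(1) unfolding smooth_manifold_def smoothly_compatible_def
      by (force simp: transition_domain_def transition_map_def)
    then have s: "smooth_on ?N (\<phi> \<circ> inv_into V' \<phi>')"
      by (rule smooth_on_subset) (use coord_base(1) in blast)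
    let ?d = "\<lambda>y. (\<phi> \<circ> inv_into V' \<phi>') y + (- a)"
    have d: "smooth_on ?N ?d"
      by (rule smooth_on_add[OF N s smooth_on_const[OF N]])
    have "smooth_on ?N (\<lambda>y. 1 + (- 4 / R\<^sup>2) * (?d y \<bullet> ?d y))"
      by (rule smooth_on_add[OF N smooth_on_const[OF N] smooth_on_mult[OF N smooth_on_const[OF N]
            smooth_on_inner[OF N d d]]])
    from smooth_on_compose[OF N smooth_on_cutoff this, of 0]
    have "smooth_on ?N (\<lambda>y. cutoff 0 (1 + (- 4 / R\<^sup>2) * (?d y \<bullet> ?d y)))" by simp
    then have "smooth_on ?N (\<lambda>y. bump V \<phi> a R (inv_into V' \<phi>' y))"
      by (rule smooth_on_cong[OF _ N]) (use inj in \<open>auto simp: bump_def\<close>)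
    then show ?thesis using N True q by blast
  next
    case False
    have "q \<in> topspace (mtop M)" using openin_subset[OF chart_openin[OF ch]] q(1) by blast
    from bump_zero_near[OF this False] obtain W where W: "openin (mtop M) W" "q \<in> W"
      "\<And>q'. q' \<in> W \<Longrightarrow> bump V \<phi> a R q' = 0" by blast
    have N: "open (\<phi>' ` (V' \<inter> W))" by (rule chart_open_image_Int[OF ch W(1)])
    have "smooth_on (\<phi>' ` (V' \<inter> W)) (\<lambda>y. bump V \<phi> a R (inv_into V' \<phi>' y))"
      by (rule smooth_on_cong[OF smooth_on_const[OF N, of 0] N]) (use inj W(3) in auto)
    then show ?thesis using N W(2) q by blast
  qed
qed

end

locale circle_bundle_cocycle = circle_bundle_chart B p M V \<phi> a R \<Psi> \<zeta>
  for B :: "('b, 'e::model_space \<times> real) manifold" and p :: "'b \<Rightarrow> 'a" and M :: "('a, 'e) manifold"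
    and V \<phi> a R \<Psi> \<zeta> +
  fixes l :: "(real \<Rightarrow> 'b) \<Rightarrow> real"
  assumes cocycle: "path_cocycle (mtop B) l"
begin

abbreviation "G \<equiv> primitive l a \<Psi>"
abbreviation "\<epsilon> \<equiv> fiber_period l a \<Psi>"
abbreviation "c \<equiv> reduced_primitive l a R \<Psi>"

section \<open>Primitives and periods\<close>

lemma l_param_path:
  assumes "continuous_on {0..1} \<sigma>" "\<And>s. s \<in> {0..1} \<Longrightarrow> \<sigma> s \<in> ball a R \<times> UNIV"
  shows "l (\<lambda>s. \<Psi> (\<sigma> s)) = G (\<sigma> 1) - G (\<sigma> 0)"
  unfolding primitive_def
  by (rule path_cocycle_primitive[OF cocycle continuous_param convex_Times[OF convex_ball convex_UNIV] _ assms])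
    (use chart(2) in auto)

lemma segment_in:
  assumes "z \<in> ball a R \<times> UNIV" "s \<in> {0..1}"
  shows "(a, 0) + s *\<^sub>R (z - (a, 0)) \<in> ball a R \<times> (UNIV :: real set)"
proof -
  have "(a, 0) + s *\<^sub>R (z - (a, 0)) = (1 - s) *\<^sub>R (a, 0) + s *\<^sub>R z"
    by (cases z) (simp add: algebra_simps)
  moreover have "(1 - s) *\<^sub>R (a, 0) + s *\<^sub>R z \<in> ball a R \<times> UNIV"
    using assms chart(2) by (intro convexD_alt convex_Times convex_ball) auto
  ultimately show ?thesis by simp
qed

text \<open>Shifting a path by one turn of the angle does not change its image in \<open>B\<close>,
  hence not its value under \<open>l\<close>. So the increment over one turn is the same at
  \<open>(y, t)\<close> as at \<open>(a, 0)\<close>, where it is the period.\<close>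

lemma primitive_period:
  assumes y: "y \<in> ball a R"
  shows "G (y, t + 2 * pi) = G (y, t) + \<epsilon>"
proof -
  let ?\<sigma> = "\<lambda>s. (a, 0) + s *\<^sub>R ((y, t) - (a, 0))"
  let ?\<tau> = "\<lambda>s. ?\<sigma> s + (0, 2 * pi)"
  have in\<sigma>: "?\<sigma> s \<in> ball a R \<times> UNIV" if "s \<in> {0..1}" for s
    by (rule segment_in) (use y that in auto)
  have in\<tau>: "?\<tau> s \<in> ball a R \<times> UNIV" if "s \<in> {0..1}" for s
    using in\<sigma>[OF that] by auto
  have "l (\<lambda>s. \<Psi> (?\<tau> s)) = l (\<lambda>s. \<Psi> (?\<sigma> s))"
  proof (rule path_cocycle_cong[OF cocycle])
    fix s :: real assume "s \<in> {0..1}"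
    then have "fst (?\<sigma> s) \<in> ball a R" using in\<sigma> by fastforce
    from param_period[OF this, of "snd (?\<sigma> s)"]
    show "\<Psi> (?\<tau> s) = \<Psi> (?\<sigma> s)" by simp
  qed
  moreover have "l (\<lambda>s. \<Psi> (?\<sigma> s)) = G (?\<sigma> 1) - G (?\<sigma> 0)"
    by (rule l_param_path[OF _ in\<sigma>]) (auto intro!: continuous_intros)
  moreover have "l (\<lambda>s. \<Psi> (?\<tau> s)) = G (?\<tau> 1) - G (?\<tau> 0)"
    by (rule l_param_path[OF _ in\<tau>]) (auto intro!: continuous_intros)
  \<comment> \<open>The constant path at the base point; the equation says that
    \<open>G (a, 0)\<close> is zero.\<close>
  moreover have "G (a, 0) = G (a, 0) - G (a, 0)"
    using l_param_path[of "\<lambda>_. (a, 0)"] chart(2) by (simp add: primitive_def)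
  ultimately show ?thesis by (simp add: fiber_period_def)
qed

lemma primitive_period_int:
  assumes y: "y \<in> ball a R"
  shows "G (y, t + 2 * pi * real_of_int n) = G (y, t) + n * \<epsilon>"
proof (induction n rule: int_induct[where k=0])
  case (step1 i)
  then show ?case using primitive_period[OF y, of "t + 2 * pi * i"] by (simp add: algebra_simps)
next
  case (step2 i)
  then show ?case using primitive_period[OF y, of "t + 2 * pi * (i - 1)"] by (simp add: algebra_simps)
qed simp

text \<open>Another preimage of the same point has an angle differing by \<open>n\<close> turns.
  Both terms then change by \<open>n\<close> periods, so the choice made in the definition is
  immaterial.\<close>

lemma reduced_primitive_param:
  assumes y: "y \<in> ball a R"
  shows "c (\<Psi> (y, t)) = G (y, t) - \<epsilon> * (t / (2 * pi))"
proof -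
  define z where "z = (SOME z. z \<in> ball a R \<times> UNIV \<and> \<Psi> z = \<Psi> (y, t))"
  have "z \<in> ball a R \<times> UNIV \<and> \<Psi> z = \<Psi> (y, t)"
    unfolding z_def by (rule someI[of _ "(y, t)"]) (use y in auto)
  then obtain s where z: "z = (y, s)" "cis s = cis t"
    using param_eq_iff[OF _ y, of "fst z" "snd z" t] by (cases z) auto
  obtain n :: int where n: "s = t + 2 * pi * n" using z(2) cis_eq_cis_iff by blast
  have "c (\<Psi> (y, t)) = G z - \<epsilon> * (snd z / (2 * pi))"
    by (simp add: reduced_primitive_def z_def Let_def)
  also have "\<dots> = G (y, t) - \<epsilon> * (t / (2 * pi))"
    unfolding z(1) n primitive_period_int[OF y] by (simp add: add_divide_distrib distrib_left)
  finally show ?thesis .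
qed

text \<open>A loop in the fiber lifts to a path of angles whose ends differ by \<open>n\<close>
  turns, so \<open>l\<close> takes on it the value \<open>n\<close> times the period. No computation
  of \<open>n\<close> is required.\<close>

lemma fiber_period_nonzero:
  assumes x: "x \<in> U" and h: "continuous_map (mtop circle) (subtopology (mtop B) (fiber B p x)) h"
    and l: "l (\<lambda>s. h (cis (2 * pi * s))) \<noteq> 0"
  shows "\<epsilon> \<noteq> 0"
proof
  assume eps: "\<epsilon> = 0"
  define \<gamma> where "\<gamma> = (\<lambda>s. h (cis (2 * pi * s)))"
  let ?Y = "subtopology (mtop B) {b \<in> topspace (mtop B). p b \<in> inv_into V \<phi> ` ball a R}"
  have hfib: "h z \<in> fiber B p x" if "norm z = 1" for z
    using continuous_map_image_subset_topspace[OF h] that by (auto simp: circle_def image_subset_iff)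
  have \<gamma>: "\<gamma> s \<in> topspace (mtop B)" "p (\<gamma> s) = x" for s
    using hfib[of "cis (2 * pi * s)"] by (auto simp: \<gamma>_def fiber_def)
  have "continuous_map (top_of_set {0..1}) (mtop circle) (\<lambda>s. cis (2 * pi * s))"
    by (auto simp: circle_def continuous_map_in_subtopology intro!: continuous_intros)
  from continuous_map_compose[OF this h]
  have "continuous_map (top_of_set {0..1}) (mtop B) \<gamma>"
    by (simp add: \<gamma>_def o_def continuous_map_in_subtopology)
  then have "continuous_map (top_of_set {0..1}) ?Y \<gamma>"
    using \<gamma> x by (auto simp: continuous_map_in_subtopology base_nbhd_def)
  from continuous_map_compose[OF this continuous_circle_coord]
  have cont: "continuous_on {0..1} (\<lambda>s. \<zeta> (\<gamma> s))" by (simp add: o_def)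
  have n1: "norm (\<zeta> (\<gamma> s)) = 1" for s
    using norm_circle_coord \<gamma> x by (simp add: base_nbhd_def)
  \<comment> \<open>A logarithm along the contractible interval; its imaginary part is the lifted
    angle.\<close>
  obtain g where g: "continuous_on {0..1} g" "\<And>s. s \<in> {0..1} \<Longrightarrow> \<zeta> (\<gamma> s) = exp (g s)"
    using continuous_logarithm_on_contractible[OF cont] n1 convex_imp_contractible[OF convex_closed_interval]
    by (metis norm_zero zero_neq_one convex_real_interval(5))
  have cis: "\<zeta> (\<gamma> s) = cis (Im (g s))" if "s \<in> {0..1}" for s
    using n1[of s] g(2)[OF that] by (simp add: exp_eq_polar norm_mult)
  let ?\<sigma> = "\<lambda>s. (\<phi> x, Im (g s))"
  have y: "\<phi> x \<in> ball a R" using coord_base x by blast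
  have "l \<gamma> = l (\<lambda>s. \<Psi> (?\<sigma> s))"
  proof (rule path_cocycle_cong[OF cocycle])
    fix s :: real assume "s \<in> {0..1}"
    from param_eqI[OF \<gamma>(1) _ cis[OF this]] x
    show "\<gamma> s = \<Psi> (\<phi> x, Im (g s))" by (simp add: \<gamma>(2) base_nbhd_def)
  qed
  also have "\<dots> = G (?\<sigma> 1) - G (?\<sigma> 0)"
    by (rule l_param_path) (use y in \<open>auto intro!: continuous_intros g\<close>)
  also have "\<dots> = 0"
  proof -
    have "\<gamma> 1 = \<gamma> 0" by (simp add: \<gamma>_def)
    then have "cis (Im (g 1)) = cis (Im (g 0))" using cis[of 0] cis[of 1] by simp
    then obtain n :: int where "Im (g 1) = Im (g 0) + 2 * pi * n" using cis_eq_cis_iff by blast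
    then show ?thesis using primitive_period_int[OF y] eps by simp
  qed
  finally show False using l by (simp add: \<gamma>_def)
qed

end

section \<open>Comparison of two local parametrizations\<close>

locale circle_bundle_cocycle_pair =
  A: circle_bundle_cocycle B p M V \<phi> a R \<Psi> \<zeta> l + C: circle_bundle_cocycle B p M V' \<phi>' a' R' \<Psi>' \<zeta>' l
  for B :: "('b, 'e::model_space \<times> real) manifold" and p :: "'b \<Rightarrow> 'a" and M :: "('a, 'e) manifold"
    and V \<phi> a R \<Psi> \<zeta> V' \<phi>' a' R' \<Psi>' \<zeta>' l
begin

definition "overlap = {z \<in> ball a R \<times> UNIV. p (\<Psi> z) \<in> C.U}"
definition "difference z = A.G z - C.c (\<Psi> z)"

lemma overlap_Pair:
  "y \<in> ball a R \<Longrightarrow> (y, t) \<in> overlap \<longleftrightarrow> inv_into V \<phi> y \<in> C.U"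
  by (simp add: overlap_def A.p_param)

text \<open>\<open>\<Lambda>\<close> is a transition map between two boxes of angles. Its derivative
  is invertible and, as both parametrizations cover the base, sends the fiber direction to a fiber
  direction; so the new angle changes at nonzero speed along the fiber.\<close>

lemma local_lift:
  assumes z0: "z0 \<in> overlap"
  obtains N \<Lambda> D where "open N" "convex N" "z0 \<in> N" "N \<subseteq> ball a R \<times> UNIV" "smooth_on N \<Lambda>"
    "\<forall>z\<in>N. \<Lambda> z \<in> ball a' R' \<times> UNIV \<and> \<Psi>' (\<Lambda> z) = \<Psi> z"
    "(\<Lambda> has_derivative D) (at z0)" "snd (D (0, 1)) \<noteq> 0"
proof -
  obtain y0 t0 where yt: "z0 = (y0, t0)" "y0 \<in> ball a R" using z0 by (auto simp: overlap_def)
  define b0 where "b0 = \<Psi> z0"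
  have b0: "b0 \<in> topspace (mtop B)" "p b0 \<in> C.U"
    using A.param_in(1) yt z0 by (auto simp: b0_def overlap_def)
  obtain t' where t': "\<phi>' (p b0) \<in> ball a' R'" "\<Psi>' (\<phi>' (p b0), t') = b0"
    by (rule C.param_surj[OF b0])
  \<comment> \<open>With \<open>pi\<close> subtracted, the given angle is the midpoint of the
    interval of the box.\<close>
  define s where "s = t0 - pi"
  define s' where "s' = t' - pi"
  let ?c = "(A.angle_box s, A.box_coord s)" and ?d = "(C.angle_box s', C.box_coord s')"
  define T where "T = transition_map ?c ?d"
  have cc: "compat_chart B ?c" "compat_chart B ?d" by (rule A.compat_box C.compat_box)+
  have z0box: "z0 \<in> ball a R \<times> {s<..<s + 2 * pi}" using yt by (simp add: s_def)
  have b0box: "b0 \<in> A.angle_box s" "b0 \<in> C.angle_box s'"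
    using z0box t' by (auto simp: A.angle_box_def C.angle_box_def b0_def s'_def
        intro!: image_eqI[of _ _ "(\<phi>' (p (\<Psi> z0)), t')"])
  have dom: "z0 \<in> transition_domain ?c ?d"
    unfolding transition_domain_def using b0box A.box_coord_param[OF z0box]
    by (auto simp: b0_def intro!: image_eqI[of _ _ "\<Psi> z0"])
  have T: "z \<in> ball a R \<times> {s<..<s + 2 * pi} \<and> T z \<in> ball a' R' \<times> UNIV \<and> \<Psi>' (T z) = \<Psi> z \<and>
      fst (T z) = \<phi>' (inv_into V \<phi> (fst z))" if z: "z \<in> transition_domain ?c ?d" for z
  proof -
    obtain b where b: "b \<in> A.angle_box s" "b \<in> C.angle_box s'" "z = A.box_coord s b"
      using z by (auto simp: transition_domain_def)
    obtain w where w: "w \<in> ball a R \<times> {s<..<s + 2 * pi}" "b = \<Psi> w"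
      using b(1) by (auto simp: A.angle_box_def)
    obtain w' where w': "w' \<in> ball a' R' \<times> {s'<..<s' + 2 * pi}" "b = \<Psi>' w'"
      using b(2) by (auto simp: C.angle_box_def)
    have zw: "z = w" using A.box_coord_param[OF w(1)] b(3) w(2) by simp
    have "T z = C.box_coord s' b"
      unfolding T_def transition_map_def using A.inv_box_coord w zw by simp
    moreover from this have "T z = w'" using C.box_coord_param[OF w'(1)] w'(2) by simp
    moreover have "fst (T z) = \<phi>' (p (\<Psi> z))" using calculation(1) zw w(2) by (simp add: C.box_coord_def)
    ultimately show ?thesis using w w' zw A.p_param by (cases z) auto
  qed
  have odom: "open (transition_domain ?c ?d)"
    by (rule transition_domain_open[OF compat_chart_is_chart[OF cc(1)] compat_chart_is_chart[OF cc(2)]])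
  obtain D D' where D: "(T has_derivative D) (at z0)" "\<forall>v. D (D' v) = v" "\<forall>v. D' (D v) = v"
    unfolding T_def by (rule transition_derivative_bijective[OF A.manifolds(1) cc dom])
  interpret D: bounded_linear D using D(1) by (rule has_derivative_bounded_linear)
  have "D (0, 1) \<noteq> 0"
  proof
    assume "D (0, 1) = 0"
    then have "D (0, 1) = D 0" by (simp add: D.zero)
    then show False using D(3)[rule_format, of "(0, 1)"] D(3)[rule_format, of 0] by (simp add: zero_prod_def)
  qed
  \<comment> \<open>The first component of \<open>T\<close> depends on the base point only, hence is
    constant along the fiber.\<close>
  moreover have "fst (D (0, 1)) = 0"
  proof -
    have "((\<lambda>t. (y0, t)) has_derivative (\<lambda>h. (0, h))) (at t0)"
      by (auto intro!: derivative_eq_intros)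
    from has_derivative_fst[OF has_derivative_compose[OF this D(1)[unfolded yt(1)]]]
    have d: "((\<lambda>t. fst (T (y0, t))) has_derivative (\<lambda>h. fst (D (0, h)))) (at t0)" .
    have "((\<lambda>t. fst (T (y0, t0))) has_derivative (\<lambda>h. fst (D (0, h)))) (at t0)"
    proof (rule has_derivative_transform_within_open[OF d])
      show "open ((\<lambda>t. (y0, t)) -` transition_domain ?c ?d)"
        by (intro open_vimage odom continuous_intros)
      show "t0 \<in> (\<lambda>t. (y0, t)) -` transition_domain ?c ?d" using dom yt by simp
      show "fst (T (y0, t)) = fst (T (y0, t0))" if "t \<in> (\<lambda>t. (y0, t)) -` transition_domain ?c ?d" for t
        using T[of "(y0, t)"] T[of "(y0, t0)"] that dom yt by simp
    qed
    from has_derivative_unique[OF this has_derivative_const] show ?thesis by (metis (no_types))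
  qed
  ultimately have "snd (D (0, 1)) \<noteq> 0" by (simp add: prod_eq_iff)
  moreover obtain r where r: "0 < r" "ball z0 r \<subseteq> transition_domain ?c ?d"
    using odom dom open_contains_ball_eq by blast
  moreover have "smooth_on (ball z0 r) T"
    unfolding T_def using compat_chart_smoothly_compatible[OF A.manifolds(1) cc] r(2)
    by (auto simp: smoothly_compatible_def intro: smooth_on_subset)
  moreover have "\<forall>z\<in>ball z0 r. T z \<in> ball a' R' \<times> UNIV \<and> \<Psi>' (T z) = \<Psi> z"
    "ball z0 r \<subseteq> ball a R \<times> UNIV" using T r(2) by blast+
  ultimately show ?thesis
    by (intro that[of "ball z0 r" T D] D(1)) auto
qed

text \<open>On a convex \<open>N\<close> both \<open>A.G\<close> and the pullback of
  \<open>C.G\<close> by \<open>\<Lambda>\<close> measure \<open>l\<close> along the same paths of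
  \<open>B\<close>, so they differ by a constant. What is left of the difference is the smooth
  lifted angle times \<open>C.\<epsilon> / (2 * pi)\<close>; the irregular \<open>l\<close> survives
  only in constants.\<close>

lemma difference_local:
  assumes z0: "z0 \<in> overlap"
  shows "\<exists>N. open N \<and> z0 \<in> N \<and> N \<subseteq> overlap \<and> smooth_on N difference"
    and "C.\<epsilon> \<noteq> 0 \<Longrightarrow> frechet_derivative difference (at z0) (0, 1) \<noteq> 0"
proof -
  obtain N \<Lambda> D where N: "open N" "convex N" "z0 \<in> N" "N \<subseteq> ball a R \<times> UNIV" and \<Lambda>: "smooth_on N \<Lambda>"
    "\<forall>z\<in>N. \<Lambda> z \<in> ball a' R' \<times> UNIV \<and> \<Psi>' (\<Lambda> z) = \<Psi> z"
    and D: "(\<Lambda> has_derivative D) (at z0)" "snd (D (0, 1)) \<noteq> 0"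
    by (rule local_lift[OF z0])
  have overlap: "N \<subseteq> overlap"
  proof
    fix z assume z: "z \<in> N"
    have "p (\<Psi>' (\<Lambda> z)) \<in> C.U" using \<Lambda>(2)[rule_format, OF z] C.param_in(2)[of "fst (\<Lambda> z)" "snd (\<Lambda> z)"] by auto
    then show "z \<in> overlap" using \<Lambda>(2)[rule_format, OF z] z N(4) by (auto simp: overlap_def)
  qed
  define k where "k = A.G z0 - C.G (\<Lambda> z0)"
  have eq: "k + C.\<epsilon> / (2 * pi) * snd (\<Lambda> z) = difference z" if z: "z \<in> N" for z
  proof -
    let ?\<sigma> = "\<lambda>s. z0 + s *\<^sub>R (z - z0)"
    have \<sigma>: "?\<sigma> s \<in> N" if "s \<in> {0..1}" for s
      using convexD_alt[OF N(2,3) z, of s] that by (simp add: algebra_simps)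
    have "l (\<lambda>s. \<Psi> (?\<sigma> s)) = A.G (?\<sigma> 1) - A.G (?\<sigma> 0)"
      by (rule A.l_param_path) (use \<sigma> N(4) in \<open>auto intro!: continuous_intros\<close>)
    moreover have "l (\<lambda>s. \<Psi>' (\<Lambda> (?\<sigma> s))) = C.G (\<Lambda> (?\<sigma> 1)) - C.G (\<Lambda> (?\<sigma> 0))"
    proof (rule C.l_param_path)
      show "continuous_on {0..1} (\<lambda>s. \<Lambda> (?\<sigma> s))"
        by (rule continuous_on_compose2[OF smooth_on_continuous_on[OF \<Lambda>(1)]])
          (use \<sigma> in \<open>auto intro!: continuous_intros\<close>)
    qed (use \<Lambda>(2)[rule_format, OF \<sigma>] in auto)
    moreover have "l (\<lambda>s. \<Psi> (?\<sigma> s)) = l (\<lambda>s. \<Psi>' (\<Lambda> (?\<sigma> s)))"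
      by (rule path_cocycle_cong[OF A.cocycle]) (use \<Lambda>(2)[rule_format, OF \<sigma>] in auto)
    ultimately have "A.G z - C.G (\<Lambda> z) = k" by (simp add: k_def)
    moreover have "C.c (\<Psi> z) = C.G (\<Lambda> z) - C.\<epsilon> * (snd (\<Lambda> z) / (2 * pi))"
      using C.reduced_primitive_param[of "fst (\<Lambda> z)" "snd (\<Lambda> z)"] \<Lambda>(2)[rule_format, OF z] by (cases "\<Lambda> z") auto
    ultimately show ?thesis by (simp add: difference_def)
  qed
  have "smooth_on N (\<lambda>z. k + C.\<epsilon> / (2 * pi) * snd (\<Lambda> z))"
    by (rule smooth_on_add[OF N(1) smooth_on_const[OF N(1)] smooth_on_mult[OF N(1) smooth_on_const[OF N(1)]
          smooth_on_compose[OF N(1) smooth_on_bounded_linear[OF bounded_linear_snd open_UNIV] \<Lambda>(1)]]]) simp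
  from smooth_on_cong[OF this N(1) eq]
  show "\<exists>N. open N \<and> z0 \<in> N \<and> N \<subseteq> overlap \<and> smooth_on N difference" using N(1,3) overlap by blast
  have "((\<lambda>z. k + C.\<epsilon> / (2 * pi) * snd (\<Lambda> z)) has_derivative
      (\<lambda>v. C.\<epsilon> / (2 * pi) * snd (D v))) (at z0)"
    using D(1) by (auto intro!: derivative_eq_intros)
  from has_derivative_transform_within_open[OF this N(1,3) eq] frechet_derivative_at
  have "frechet_derivative difference (at z0) = (\<lambda>v. C.\<epsilon> / (2 * pi) * snd (D v))" by metis
  then show "frechet_derivative difference (at z0) (0, 1) \<noteq> 0" if "C.\<epsilon> \<noteq> 0" using that D(2) by simp
qed

lemma open_overlap: "open overlap"
  using difference_local(1) by (subst open_subopen) blast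

lemma smooth_on_difference: "smooth_on overlap difference"
  by (rule smooth_on_local) (use difference_local(1) in blast)

text \<open>Along a fiber the difference increases by \<open>A.\<epsilon>\<close> per turn and its derivative has no zero.\<close>

lemma difference_derivative_sign:
  assumes z: "(y, t) \<in> overlap" and eps: "C.\<epsilon> \<noteq> 0"
  shows "0 < A.\<epsilon> * frechet_derivative difference (at (y, t)) (0, 1)"
proof -
  have y: "y \<in> ball a R" using z by (simp add: overlap_def)
  define v where "v = (\<lambda>t. frechet_derivative difference (at (y, t)) (0, 1))"
  have line: "(y, t) \<in> overlap" for t using z overlap_Pair[OF y] by blast
  have v: "((\<lambda>t. difference (y, t)) has_real_derivative v t) (at t)" for t
    unfolding v_def by (rule DERIV_snd[OF smooth_on_differentiable[OF smooth_on_difference line]])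
  have nz: "v t \<noteq> 0" for t unfolding v_def by (rule difference_local(2)[OF line eps])
  have "continuous_on UNIV v"
    unfolding v_def
    by (rule continuous_on_compose2[OF smooth_on_continuous_on[OF
            smooth_on_directional_derivative[OF smooth_on_difference]]])
      (use line in \<open>auto intro!: continuous_intros\<close>)
  then have conn: "connected (range v)" by (rule connected_continuous_image) simp
  \<comment> \<open>Over one turn the reduced primitive returns to its value, so only the growth of
    \<open>A.G\<close> remains.\<close>
  have "difference (y, 0 + 2 * pi) - difference (y, 0) = A.\<epsilon>"
    using A.primitive_period[OF y, of 0] A.param_period[OF y, of 0] by (simp add: difference_def)
  \<comment> \<open>Somewhere on the turn the derivative is the period over \<open>2 * pi\<close>.
    Having no zero on the line, it keeps that sign everywhere.\<close>
  moreover obtain \<xi> where "difference (y, 2 * pi) - difference (y, 0) = 2 * pi * v \<xi>"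
    using MVT2[of 0 "2 * pi" "\<lambda>t. difference (y, t)" v] v by auto
  ultimately have \<xi>: "A.\<epsilon> = 2 * pi * v \<xi>" by simp
  have "0 < v \<xi> * v t"
  proof (rule ccontr)
    assume "\<not> 0 < v \<xi> * v t"
    then have "(v \<xi> < 0 \<and> 0 < v t) \<or> (v t < 0 \<and> 0 < v \<xi>)"
      using nz[of \<xi>] nz[of t] by (auto simp: zero_less_mult_iff linorder_not_less)
    then have "0 \<in> range v"
      using connectedD_interval[OF conn, of "v \<xi>" "v t" 0] connectedD_interval[OF conn, of "v t" "v \<xi>" 0]
      by (metis order_less_imp_le rangeI)
    then show False using nz by auto
  qed
  then show ?thesis by (simp add: \<xi> v_def mult.assoc)
qed

end

section \<open>The foliation\<close>

text \<open>Covering by balls of half radius guarantees a positive weight at each point of the base,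
  and finiteness of \<open>K\<close> makes the averages plain sums.\<close>

locale circle_bundle_family =
  fixes B :: "('b, 'e::model_space \<times> real) manifold" and p :: "'b \<Rightarrow> 'a" and M :: "('a, 'e) manifold"
    and K :: "'i set" and V \<phi> a R \<Psi> \<zeta> l
  assumes manifold: "smooth_manifold B"
    and finite: "finite K"
    and cocycles: "\<And>k. k \<in> K \<Longrightarrow> circle_bundle_cocycle B p M (V k) (\<phi> k) (a k) (R k) (\<Psi> k) (\<zeta> k) l"
    and cover: "\<And>q. q \<in> topspace (mtop M) \<Longrightarrow> \<exists>k\<in>K. q \<in> base_nbhd (V k) (\<phi> k) (a k) (R k / 2)"
    and period: "\<And>k. k \<in> K \<Longrightarrow> fiber_period l (a k) (\<Psi> k) \<noteq> 0"
    and projection: "\<And>b. b \<in> topspace (mtop B) \<Longrightarrow> p b \<in> topspace (mtop M)"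
begin

abbreviation "nbhd k \<equiv> base_nbhd (V k) (\<phi> k) (a k) (R k)"
abbreviation "weight k \<equiv> bump (V k) (\<phi> k) (a k) (R k)"
abbreviation "prim k \<equiv> primitive l (a k) (\<Psi> k)"
abbreviation "red k \<equiv> reduced_primitive l (a k) (R k) (\<Psi> k)"

text \<open>\<open>straight\<close> is the second coordinate of the foliated charts: the closed one-form given locally
  by its differential represents the cocycle, because \<open>correction\<close> is globally defined.\<close>

definition "correction b = (\<Sum>k\<in>K. weight k (p b) * red k b) / (\<Sum>k\<in>K. weight k (p b))"
definition "straight k z = prim k z - correction (\<Psi> k z)"

lemma pair:
  "k \<in> K \<Longrightarrow> j \<in> K \<Longrightarrow> circle_bundle_cocycle_pair B p M (V k) (\<phi> k) (a k) (R k) (\<Psi> k) (\<zeta> k)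
     (V j) (\<phi> j) (a j) (R j) (\<Psi> j) (\<zeta> j) l"
  using cocycles by (simp add: circle_bundle_cocycle_pair_def)

section \<open>The straightened function and its fiber derivative\<close>

lemma weight_nonneg: "0 \<le> weight k q"
  by (simp add: bump_def cutoff_def)

lemma sum_weights_pos: "q \<in> topspace (mtop M) \<Longrightarrow> 0 < (\<Sum>k\<in>K. weight k q)"
proof -
  assume "q \<in> topspace (mtop M)"
  then obtain k where k: "k \<in> K" "q \<in> base_nbhd (V k) (\<phi> k) (a k) (R k / 2)" using cover by blast
  interpret circle_bundle_cocycle B p M "V k" "\<phi> k" "a k" "R k" "\<Psi> k" "\<zeta> k" l
    by (rule cocycles[OF k(1)])
  show ?thesis
    by (rule sum_pos2[of K k "\<lambda>k. weight k q"]) (use finite k(1) bump_pos[OF k(2)] weight_nonneg in auto)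
qed

text \<open>Normalized weights sum to one, so \<open>prim k\<close> can be moved inside the average.
  The result averages differences, each smooth on its overlap, although \<open>prim k\<close> and
  \<open>correction\<close> need not be continuous.\<close>

lemma straight_eq:
  assumes k: "k \<in> K" and y: "y \<in> ball (a k) (R k)"
  defines "q \<equiv> inv_into (V k) (\<phi> k) y"
  shows "straight k (y, t) = (\<Sum>j\<in>K. weight j q * (prim k (y, t) - red j (\<Psi> k (y, t)))) / (\<Sum>j\<in>K. weight j q)"
proof -
  interpret circle_bundle_cocycle B p M "V k" "\<phi> k" "a k" "R k" "\<Psi> k" "\<zeta> k" l
    by (rule cocycles[OF k])
  have "q \<in> topspace (mtop M)"
    unfolding q_def using base_coord(3)[OF y] openin_subset[OF openin_base_nbhd] by blast
  from sum_weights_pos[OF this] have "(\<Sum>j\<in>K. weight j q) \<noteq> 0" by simp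
  moreover have "(\<Sum>j\<in>K. weight j q * (prim k (y, t) - red j (\<Psi> k (y, t)))) =
      prim k (y, t) * (\<Sum>j\<in>K. weight j q) - (\<Sum>j\<in>K. weight j q * red j (\<Psi> k (y, t)))"
    by (simp add: right_diff_distrib sum_subtractf sum_distrib_left mult.commute)
  ultimately show ?thesis
    by (simp add: straight_def correction_def p_param[OF y] q_def[symmetric] diff_divide_distrib)
qed

text \<open>Outside \<open>nbhd j\<close> the value of \<open>red j\<close> is unspecified, but
  there the weight vanishes on a whole neighborhood, so each term is smooth everywhere.\<close>

lemma smooth_on_straight:
  assumes k: "k \<in> K"
  shows "smooth_on (ball (a k) (R k) \<times> UNIV) (straight k)"
proof -
  interpret circle_bundle_cocycle B p M "V k" "\<phi> k" "a k" "R k" "\<Psi> k" "\<zeta> k" l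
    by (rule cocycles[OF k])
  let ?D = "ball (a k) (R k) \<times> (UNIV :: real set)"
  let ?q = "\<lambda>z. inv_into (V k) (\<phi> k) (fst z)"
  have D: "open ?D" by (intro open_Times) auto
  have sfst: "smooth_on ?D fst" by (rule smooth_on_bounded_linear[OF bounded_linear_fst D])
  have smooth_weight: "smooth_on ?D (\<lambda>z. weight j (?q z))" if "j \<in> K" for j
  proof -
    interpret j: circle_bundle_cocycle B p M "V j" "\<phi> j" "a j" "R j" "\<Psi> j" "\<zeta> j" l
      by (rule cocycles[OF that])
    show ?thesis
      by (rule smooth_on_compose[OF D j.smooth_on_bump[OF chart(1)] sfst]) (use chart(3) in auto)
  qed
  have smooth_term: "smooth_on ?D (\<lambda>z. weight j (?q z) * (prim k z - red j (\<Psi> k z)))" if j: "j \<in> K" for j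
  proof (rule smooth_on_local)
    fix z0 assume z0: "z0 \<in> ?D"
    interpret circle_bundle_cocycle_pair B p M "V k" "\<phi> k" "a k" "R k" "\<Psi> k" "\<zeta> k"
      "V j" "\<phi> j" "a j" "R j" "\<Psi> j" "\<zeta> j" l by (rule pair[OF k j])
    show "\<exists>N. open N \<and> z0 \<in> N \<and> smooth_on N (\<lambda>z. weight j (?q z) * (prim k z - red j (\<Psi> k z)))"
    proof (cases "?q z0 \<in> nbhd j")
      case True
      have "smooth_on overlap (\<lambda>z. weight j (?q z) * difference z)"
        by (rule smooth_on_mult[OF open_overlap smooth_on_subset[OF smooth_weight[OF j]] smooth_on_difference])
          (auto simp: overlap_def)
      moreover have "z0 \<in> overlap" using True z0 overlap_Pair[of "fst z0" "snd z0"] by auto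
      ultimately show ?thesis using open_overlap unfolding difference_def by blast
    next
      case False
      have "?q z0 \<in> topspace (mtop M)"
        using z0 base_coord(3)[of "fst z0"] openin_subset[OF openin_base_nbhd] by auto
      from C.bump_zero_near[OF this False]
      obtain W where W: "openin (mtop M) W" "?q z0 \<in> W" "\<And>q'. q' \<in> W \<Longrightarrow> weight j q' = 0" by blast
      let ?N = "?D \<inter> fst -` (\<phi> k ` (V k \<inter> W))"
      have N: "open ?N"
        by (intro open_Int D open_vimage chart_open_image_Int[OF chart_V W(1)] continuous_intros)
      have inW: "?q z \<in> W" if "z \<in> ?N" for z
        using that chart_inj_on[OF chart_V] by auto
      have "smooth_on ?N (\<lambda>z. weight j (?q z) * (prim k z - red j (\<Psi> k z)))"
        by (rule smooth_on_cong[OF smooth_on_const[OF N, of 0] N]) (use inW W(3) in auto)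
      moreover have "z0 \<in> ?N"
        using z0 base_coord(1,2)[of "fst z0"] W(2) by (auto intro!: image_eqI[of _ _ "?q z0"])
      ultimately show ?thesis using N by blast
    qed
  qed
  have "smooth_on ?D (\<lambda>z. (\<Sum>j\<in>K. weight j (?q z) * (prim k z - red j (\<Psi> k z))) / (\<Sum>j\<in>K. weight j (?q z)))"
  proof (intro smooth_on_divide smooth_on_sum D smooth_term smooth_weight)
    fix z assume "z \<in> ?D"
    then have "?q z \<in> topspace (mtop M)"
      using base_coord(3)[of "fst z"] openin_subset[OF openin_base_nbhd] by auto
    from sum_weights_pos[OF this] show "(\<Sum>j\<in>K. weight j (?q z)) \<noteq> 0" by simp
  qed
  then show ?thesis
    by (rule smooth_on_cong[OF _ D]) (use straight_eq[OF k] in auto)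
qed

text \<open>The weights come from the base and are constant along a fiber. Hence the fiber
  derivative is a weighted mean of the numbers \<open>d j\<close>, which have the sign of the period
  of parametrization \<open>k\<close> wherever the weight is nonzero.\<close>

lemma straight_derivative_nonzero:
  assumes k: "k \<in> K" and z: "z \<in> ball (a k) (R k) \<times> UNIV"
  shows "frechet_derivative (straight k) (at z) (0, 1) \<noteq> 0"
proof -
  interpret circle_bundle_cocycle B p M "V k" "\<phi> k" "a k" "R k" "\<Psi> k" "\<zeta> k" l
    by (rule cocycles[OF k])
  obtain y t where yt: "z = (y, t)" "y \<in> ball (a k) (R k)" using z by auto
  define q where "q = inv_into (V k) (\<phi> k) y"
  have qM: "q \<in> topspace (mtop M)"
    unfolding q_def using base_coord(3)[OF yt(2)] openin_subset[OF openin_base_nbhd] by blast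
  define d where "d j = frechet_derivative (\<lambda>z. prim k z - red j (\<Psi> k z)) (at (y, t)) (0, 1)" for j
  have d: "0 < \<epsilon> * d j" "((\<lambda>t. prim k (y, t) - red j (\<Psi> k (y, t))) has_real_derivative d j) (at t)"
    if j: "j \<in> K" "weight j q \<noteq> 0" for j
  proof -
    interpret circle_bundle_cocycle_pair B p M "V k" "\<phi> k" "a k" "R k" "\<Psi> k" "\<zeta> k"
      "V j" "\<phi> j" "a j" "R j" "\<Psi> j" "\<zeta> j" l by (rule pair[OF k j(1)])
    have "q \<in> nbhd j" using j(2) by (auto simp: bump_def split: if_splits)
    then have o: "(y, t) \<in> overlap" using overlap_Pair[OF yt(2)] by (simp add: q_def)
    have diff: "difference = (\<lambda>z. prim k z - red j (\<Psi> k z))" by (simp add: difference_def fun_eq_iff)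
    show "0 < \<epsilon> * d j"
      using difference_derivative_sign[OF o period[OF j(1)]] by (simp add: d_def diff)
    show "((\<lambda>t. prim k (y, t) - red j (\<Psi> k (y, t))) has_real_derivative d j) (at t)"
      using DERIV_snd[OF smooth_on_differentiable[OF smooth_on_difference o]] by (simp add: d_def diff)
  qed
  \<comment> \<open>If the weight is zero the term vanishes along the whole fiber, whatever
    \<open>d j\<close> may be.\<close>
  have term_deriv: "((\<lambda>t. weight j q * (prim k (y, t) - red j (\<Psi> k (y, t)))) has_real_derivative weight j q * d j) (at t)"
    if "j \<in> K" for j
    using d(2)[OF that] by (cases "weight j q = 0") (auto intro: DERIV_cmult)
  let ?W = "\<Sum>j\<in>K. weight j q"
  have W: "0 < ?W" by (rule sum_weights_pos[OF qM])
  have "((\<lambda>t. (\<Sum>j\<in>K. weight j q * (prim k (y, t) - red j (\<Psi> k (y, t)))) / ?W) has_real_derivative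
      (\<Sum>j\<in>K. weight j q * d j) / ?W) (at t)"
    by (intro DERIV_cdivide DERIV_sum term_deriv)
  then have "((\<lambda>t. straight k (y, t)) has_real_derivative (\<Sum>j\<in>K. weight j q * d j) / ?W) (at t)"
    by (simp add: straight_eq[OF k yt(2)] q_def)
  moreover have "((\<lambda>t. straight k (y, t)) has_real_derivative
      frechet_derivative (straight k) (at z) (0, 1)) (at t)"
    unfolding yt(1) by (rule DERIV_snd[OF smooth_on_differentiable[OF smooth_on_straight[OF k]]])
      (use yt in auto)
  ultimately have "frechet_derivative (straight k) (at z) (0, 1) = (\<Sum>j\<in>K. weight j q * d j) / ?W"
    by (rule DERIV_unique[rotated])
  moreover have "0 < (\<Sum>j\<in>K. weight j q * (\<epsilon> * d j))"
  proof -
    have "\<exists>i\<in>K. weight i q \<noteq> 0"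
    proof (rule ccontr)
      assume "\<not> (\<exists>i\<in>K. weight i q \<noteq> 0)"
      then have "?W = 0" by (intro sum.neutral) blast
      with W show False by simp
    qed
    then obtain i where i: "i \<in> K" "weight i q \<noteq> 0" by blast
    have nonneg: "0 \<le> weight j q * (\<epsilon> * d j)" if "j \<in> K" for j
      using d(1)[OF that] weight_nonneg[of j q] by (cases "weight j q = 0") auto
    have "0 < weight i q" using i(2) weight_nonneg[of i q] by linarith
    then have "0 < weight i q * (\<epsilon> * d i)" using d(1)[OF i] by (rule mult_pos_pos)
    then show ?thesis using sum_pos2[OF finite i(1), of "\<lambda>j. weight j q * (\<epsilon> * d j)"] nonneg by blast
  qed
  then have "0 < \<epsilon> * (\<Sum>j\<in>K. weight j q * d j)" by (simp add: sum_distrib_left mult_ac)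
  ultimately show ?thesis using W by auto
qed

text \<open>The last clause says that the second coordinate plus \<open>correction\<close> is a
  primitive of \<open>l\<close> inside the chart. As \<open>l\<close> and \<open>correction\<close>
  do not refer to the chart, this pins down the second coordinate up to constants. The clause on
  \<open>p\<close> keeps the vertical lines of the chart inside fibers.\<close>

definition adapted :: "('b, 'e \<times> real) chart \<Rightarrow> bool" where
  "adapted = (\<lambda>(O', \<theta>). compat_chart B (O', \<theta>) \<and>
     (\<exists>S T. open S \<and> connected S \<and> open T \<and> connected T \<and> \<theta> ` O' = S \<times> T) \<and>
     (\<forall>b\<in>O'. \<forall>b'\<in>O'. fst (\<theta> b) = fst (\<theta> b') \<longrightarrow> p b = p b') \<and>
     (\<forall>\<gamma>. continuous_map (top_of_set {0..1}) (mtop B) \<gamma> \<longrightarrow> \<gamma> ` {0..1} \<subseteq> O' \<longrightarrow>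
        l \<gamma> = (snd (\<theta> (\<gamma> 1)) + correction (\<gamma> 1)) - (snd (\<theta> (\<gamma> 0)) + correction (\<gamma> 0))))"

text \<open>Straightening a box of angles about \<open>b\<close> leaves the first coordinate alone,
  so fibers remain vertical while the level sets of \<open>straight k\<close> become
  horizontal.\<close>

lemma ex_adapted:
  assumes b: "b \<in> topspace (mtop B)"
  obtains O' \<theta> where "adapted (O', \<theta>)" "b \<in> O'"
proof -
  obtain k where k: "k \<in> K" "p b \<in> base_nbhd (V k) (\<phi> k) (a k) (R k / 2)"
    using cover[OF projection[OF b]] by blast
  interpret circle_bundle_cocycle B p M "V k" "\<phi> k" "a k" "R k" "\<Psi> k" "\<zeta> k" l
    by (rule cocycles[OF k(1)])
  have "ball (a k) (R k / 2) \<subseteq> ball (a k) (R k)" using chart(2) by auto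
  then have "p b \<in> nbhd k" using k(2) unfolding base_nbhd_def by blast
  from param_surj[OF b this] obtain t0 where t0: "\<phi> k (p b) \<in> ball (a k) (R k)" "\<Psi> k (\<phi> k (p b), t0) = b"
    by blast
  define s where "s = t0 - pi"
  define z0 where "z0 = (\<phi> k (p b), t0)"
  let ?\<Omega> = "ball (a k) (R k) \<times> {s<..<s + 2 * pi}"
  have z0: "z0 \<in> ?\<Omega>" using t0 by (simp add: z0_def s_def)
  have sub: "?\<Omega> \<subseteq> ball (a k) (R k) \<times> UNIV" by blast
  obtain D S T H where D: "open D" "z0 \<in> D" "D \<subseteq> ?\<Omega>"
    and ST: "open S" "connected S" "open T" "connected T"
    and H: "\<forall>z\<in>D. (fst z, straight k z) \<in> S \<times> T \<and> H (fst z, straight k z) = z"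
      "\<forall>w\<in>S \<times> T. H w \<in> D \<and> (fst (H w), straight k (H w)) = w" "smooth_on (S \<times> T) H"
  proof (rule straighten_snd[OF _ z0 smooth_on_subset[OF smooth_on_straight[OF k(1)] sub]])
    show "frechet_derivative (straight k) (at z) (0, 1) \<noteq> 0" if "z \<in> ?\<Omega>" for z
      by (rule straight_derivative_nonzero[OF k(1)]) (use that in auto)
  qed (auto intro!: open_Times)
  have sD: "smooth_on D (\<lambda>z. (fst z, straight k z))"
    by (intro smooth_on_Pair D(1) smooth_on_bounded_linear[OF bounded_linear_fst]
        smooth_on_subset[OF smooth_on_straight[OF k(1)]]) (use D(3) in auto)
  have D': "D \<subseteq> box_coord s ` angle_box s" using D(3) box_coord_image by simp
  note change = compat_chart_change_coordinates[OF manifolds(1) compat_box[of s] D(1) D' sD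
      open_Times[OF ST(1,3)] H(3) H(1,2)[rule_format]]
  let ?O = "angle_box s \<inter> box_coord s -` D" and ?\<theta> = "(\<lambda>z. (fst z, straight k z)) \<circ> box_coord s"
  have box: "box_coord s b' \<in> ?\<Omega>" "\<Psi> k (box_coord s b') = b'" "p b' \<in> nbhd k" if b': "b' \<in> ?O" for b'
  proof -
    obtain z where z: "z \<in> ?\<Omega>" "b' = \<Psi> k z" using b' by (auto simp: angle_box_def)
    then show "box_coord s b' \<in> ?\<Omega>" "\<Psi> k (box_coord s b') = b'" using box_coord_param[OF z(1)] by simp_all
    show "p b' \<in> nbhd k" using z param_in(2) by auto
  qed
  have "adapted (?O, ?\<theta>)"
    unfolding adapted_def prod.case
  proof (intro conjI allI ballI impI)
    show "compat_chart B (?O, ?\<theta>)" by (rule change(1))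
    show "\<exists>S T. open S \<and> connected S \<and> open T \<and> connected T \<and> ?\<theta> ` ?O = S \<times> T"
      using ST change(2) by blast
  next
    fix b1 b2 assume b12: "b1 \<in> ?O" "b2 \<in> ?O" "fst (?\<theta> b1) = fst (?\<theta> b2)"
    then have "\<phi> k (p b1) = \<phi> k (p b2)" by (simp add: box_coord_def)
    then show "p b1 = p b2" using coord_base(3) box(3) b12(1,2) by metis
  next
    fix \<gamma> :: "real \<Rightarrow> 'b" assume \<gamma>: "continuous_map (top_of_set {0..1}) (mtop B) \<gamma>" "\<gamma> ` {0..1} \<subseteq> ?O"
    let ?\<sigma> = "\<lambda>s'. box_coord s (\<gamma> s')"
    have \<gamma>O: "\<gamma> s' \<in> ?O" if "s' \<in> {0..1}" for s' using \<gamma>(2) that by blast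
    have "continuous_map (top_of_set {0..1}) (subtopology (mtop B) (angle_box s)) \<gamma>"
      using \<gamma> by (auto simp: continuous_map_in_subtopology)
    from continuous_map_compose[OF this chart_continuous[OF compat_chart_is_chart[OF compat_box]]]
    have cont: "continuous_on {0..1} ?\<sigma>" by (simp add: o_def)
    have "l \<gamma> = l (\<lambda>s'. \<Psi> k (?\<sigma> s'))"
      by (rule path_cocycle_cong[OF cocycle]) (use box(2)[OF \<gamma>O] in simp)
    also have "\<dots> = prim k (?\<sigma> 1) - prim k (?\<sigma> 0)"
      by (rule l_param_path[OF cont]) (use box(1)[OF \<gamma>O] sub in blast)
    \<comment> \<open>Adding \<open>correction\<close> to \<open>straight k\<close> gives back
      \<open>prim k\<close>.\<close>
    also have "\<dots> = (snd (?\<theta> (\<gamma> 1)) + correction (\<gamma> 1)) - (snd (?\<theta> (\<gamma> 0)) + correction (\<gamma> 0))"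
      using box(2)[OF \<gamma>O[of 0]] box(2)[OF \<gamma>O[of 1]] by (simp add: straight_def)
    finally show "l \<gamma> = (snd (?\<theta> (\<gamma> 1)) + correction (\<gamma> 1)) - (snd (?\<theta> (\<gamma> 0)) + correction (\<gamma> 0))" .
  qed
  moreover have "b \<in> ?O"
  proof -
    have "b = \<Psi> k z0" using t0(2) by (simp add: z0_def)
    then show ?thesis using box_coord_param[OF z0] D(2) z0 by (simp add: angle_box_def)
  qed
  ultimately show ?thesis by (rule that)
qed

end

section \<open>Transversality\<close>

text \<open>The curve is the coordinate line through \<open>b\<close> in the direction
  \<open>v\<close>, read in the other chart; a short piece of it stays in the overlap of the two
  domains.\<close>

lemma tangent_spaceI:
  assumes charts: "is_chart X (U, \<phi>)" "is_chart X (Y, \<kappa>)"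
    and smooth: "smooth_on (transition_domain (U, \<phi>) (Y, \<kappa>)) (transition_map (U, \<phi>) (Y, \<kappa>))"
    and b: "b \<in> U" "b \<in> Y"
    and D: "(transition_map (U, \<phi>) (Y, \<kappa>) has_derivative D) (at (\<phi> b))"
    and L: "\<And>b' t. b' \<in> U \<Longrightarrow> \<phi> b' = \<phi> b + t *\<^sub>R v \<Longrightarrow> b' \<in> L"
  shows "D v \<in> tangent_space (Y, \<kappa>) L b"
proof -
  let ?T = "transition_map (U, \<phi>) (Y, \<kappa>)" and ?dom = "transition_domain (U, \<phi>) (Y, \<kappa>)"
  let ?line = "\<lambda>t::real. \<phi> b + t *\<^sub>R v"
  define \<gamma> where "\<gamma> = (\<lambda>t. inv_into U \<phi> (?line t))"
  have inj: "inj_on \<phi> U" by (rule chart_inj_on[OF charts(1)])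
  have "open (?line -` ?dom)"
    by (intro open_vimage transition_domain_open[OF charts] continuous_intros)
  moreover have "0 \<in> ?line -` ?dom" using b by (auto simp: transition_domain_def)
  ultimately obtain \<eta> where \<eta>: "0 < \<eta>" "ball 0 \<eta> \<subseteq> ?line -` ?dom"
    using open_contains_ball_eq by blast
  have ball: "{- \<eta><..<\<eta>} = ball 0 \<eta>" by (auto simp: dist_real_def)
  have \<gamma>: "\<gamma> t \<in> Y \<inter> L" if t: "t \<in> {- \<eta><..<\<eta>}" for t
  proof -
    obtain b' where b': "b' \<in> U" "b' \<in> Y" "?line t = \<phi> b'"
      using t \<eta>(2) unfolding ball by (auto simp: transition_domain_def)
    have "\<gamma> t = b'" unfolding \<gamma>_def b'(3) using inj b'(1) by simp
    with b' L[OF b'(1), of t] show ?thesis by simp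
  qed
  have comp: "\<kappa> \<circ> \<gamma> = (\<lambda>t. ?T (?line t))"
    by (simp add: \<gamma>_def transition_map_def fun_eq_iff)
  have o: "open {- \<eta><..<\<eta>}" by simp
  have "smooth_on {- \<eta><..<\<eta>} (\<lambda>t. ?T (?line t))"
  proof (rule smooth_on_compose[OF o smooth])
    show "smooth_on {- \<eta><..<\<eta>} ?line"
      by (intro smooth_on_add smooth_on_scaleR smooth_on_const smooth_on_ident o)
    show "?line t \<in> ?dom" if "t \<in> {- \<eta><..<\<eta>}" for t using that \<eta>(2) unfolding ball by blast
  qed
  moreover have "((\<lambda>t. ?T (?line t)) has_vector_derivative D v) (at 0)"
  proof -
    interpret bounded_linear D using D by (rule has_derivative_bounded_linear)
    have "(?line has_derivative (\<lambda>t. t *\<^sub>R v)) (at 0)" by (auto intro!: derivative_eq_intros)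
    moreover have "(?T has_derivative D) (at (?line 0))" using D by simp
    ultimately have "((\<lambda>t. ?T (?line t)) has_derivative (\<lambda>t. D (t *\<^sub>R v))) (at 0)"
      by (rule has_derivative_compose)
    then show ?thesis by (simp add: has_vector_derivative_def scaleR)
  qed
  moreover have "\<gamma> 0 = b" using inj b by (simp add: \<gamma>_def)
  ultimately show ?thesis
    unfolding tangent_space_def prod.case using \<eta>(1) \<gamma>
    by (intro CollectI exI[of _ \<gamma>] exI[of _ \<eta>] conjI ballI) (simp_all only: comp)
qed

context circle_bundle_family
begin

section \<open>Adapted charts as a foliated atlas\<close>

lemma adapted_compat: "adapted (O', \<theta>) \<Longrightarrow> compat_chart B (O', \<theta>)"
  by (simp add: adapted_def)

lemma adapted_path:
  "adapted (O', \<theta>) \<Longrightarrow> continuous_map (top_of_set {0..1}) (mtop B) \<gamma> \<Longrightarrow> \<gamma> ` {0..1} \<subseteq> O' \<Longrightarrow>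
    l \<gamma> = (snd (\<theta> (\<gamma> 1)) + correction (\<gamma> 1)) - (snd (\<theta> (\<gamma> 0)) + correction (\<gamma> 0))"
  by (simp add: adapted_def)

text \<open>Along a segment \<open>l\<close> can be evaluated in either chart, and
  \<open>correction\<close> at the two ends cancels. So the second coordinates change by a
  translation locally: the leaves are those of a closed one-form.\<close>

lemma adapted_transition:
  assumes ad: "adapted (O', \<theta>)" "adapted (O'', \<theta>')" and z: "z \<in> transition_domain (O', \<theta>) (O'', \<theta>')"
  obtains W where "open W" "z \<in> W" "W \<subseteq> transition_domain (O', \<theta>) (O'', \<theta>')"
    "\<forall>w\<in>W. snd (transition_map (O', \<theta>) (O'', \<theta>') w) =
       snd w + (snd (transition_map (O', \<theta>) (O'', \<theta>') z) - snd z)"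
proof -
  let ?c = "(O', \<theta>)" and ?d = "(O'', \<theta>')"
  let ?T = "transition_map ?c ?d" and ?g = "inv_into O' \<theta>"
  have ch: "is_chart (mtop B) ?c" "is_chart (mtop B) ?d"
    using ad adapted_compat compat_chart_is_chart by blast+
  have dom: "?g w \<in> O'" "?g w \<in> O''" "\<theta> (?g w) = w" if "w \<in> transition_domain ?c ?d" for w
    using that chart_inj_on[OF ch(1)] by (auto simp: transition_domain_def)
  have T: "?T w = \<theta>' (?g w)" for w by (simp add: transition_map_def)
  obtain r where r: "0 < r" "ball z r \<subseteq> transition_domain ?c ?d"
    using transition_domain_open[OF ch] z open_contains_ball_eq by blast
  have *: "snd (?T w) = snd w + (snd (?T z) - snd z)" if w: "w \<in> ball z r" for w
  proof -
    let ?\<sigma> = "\<lambda>s. z + s *\<^sub>R (w - z)"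
    have \<sigma>: "?\<sigma> s \<in> transition_domain ?c ?d" if "s \<in> {0..1}" for s
      using convexD_alt[OF convex_ball, of z z r w s] w that r by (auto simp: algebra_simps)
    have "continuous_map (top_of_set {0..1}) (top_of_set (\<theta> ` O')) ?\<sigma>"
    proof -
      have "transition_domain ?c ?d \<subseteq> \<theta> ` O'" by (auto simp: transition_domain_def)
      then have "?\<sigma> ` {0..1} \<subseteq> \<theta> ` O'" using \<sigma> by blast
      moreover have "continuous_on {0..1} ?\<sigma>" by (intro continuous_intros)
      ultimately show ?thesis by (auto simp: continuous_map_in_subtopology)
    qed
    from continuous_map_compose[OF this chart_continuous_inv[OF ch(1)]]
    have cont: "continuous_map (top_of_set {0..1}) (mtop B) (\<lambda>s. ?g (?\<sigma> s))" by (simp add: o_def)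
    have "(\<lambda>s. ?g (?\<sigma> s)) ` {0..1} \<subseteq> O'" "(\<lambda>s. ?g (?\<sigma> s)) ` {0..1} \<subseteq> O''"
      using dom(1,2)[OF \<sigma>] by blast+
    from adapted_path[OF ad(1) cont this(1)] adapted_path[OF ad(2) cont this(2)]
    have "snd (\<theta>' (?g w)) - snd (\<theta>' (?g z)) = snd (\<theta> (?g w)) - snd (\<theta> (?g z))" by simp
    moreover have "w \<in> transition_domain ?c ?d" using w r(2) by blast
    ultimately show ?thesis using dom(3)[OF z] dom(3)[of w] by (simp add: T)
  qed
  show ?thesis
    by (rule that[of "ball z r"]) (use r in simp_all, blast intro: *)
qed

lemma codim1_foliation_adapted: "codim1_foliation B {c. adapted c}"
  unfolding codim1_foliation_def
proof (intro conjI)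
  show "\<forall>c\<in>{c. adapted c}. is_chart (mtop B) c \<and> (\<forall>d\<in>atlas B. smoothly_compatible c d)"
    by (auto simp: adapted_def compat_chart_def)
  show "(\<Union>c\<in>{c. adapted c}. fst c) = topspace (mtop B)"
  proof (intro equalityI subsetI)
    fix b assume "b \<in> (\<Union>c\<in>{c. adapted c}. fst c)"
    then obtain O' \<theta> where "adapted (O', \<theta>)" "b \<in> O'" by auto
    then show "b \<in> topspace (mtop B)"
      using openin_subset[OF chart_openin[OF compat_chart_is_chart[OF adapted_compat]]] by blast
  next
    fix b assume "b \<in> topspace (mtop B)"
    then obtain O' \<theta> where "adapted (O', \<theta>)" "b \<in> O'" by (rule ex_adapted)
    then show "b \<in> (\<Union>c\<in>{c. adapted c}. fst c)" by (intro UN_I[of "(O', \<theta>)"]) simp_all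
  qed
  show "\<forall>(O', \<theta>)\<in>{c. adapted c}. \<exists>S T. open S \<and> connected S \<and> open T \<and> connected T \<and> \<theta> ` O' = S \<times> T"
    by (auto simp: adapted_def)
  show "\<forall>c\<in>{c. adapted c}. \<forall>d\<in>{c. adapted c}. \<forall>z\<in>transition_domain c d.
        \<exists>W g. open W \<and> z \<in> W \<and> W \<subseteq> transition_domain c d \<and>
          (\<forall>w\<in>W. snd (transition_map c d w) = g (snd w))"
  proof (intro ballI)
    fix c d z assume c: "c \<in> {c. adapted c}" and d: "d \<in> {c. adapted c}" and z: "z \<in> transition_domain c d"
    obtain O' \<theta> O'' \<theta>' where cd: "c = (O', \<theta>)" "d = (O'', \<theta>')" by (cases c; cases d)
    obtain W where W: "open W" "z \<in> W" "W \<subseteq> transition_domain c d"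
      "\<forall>w\<in>W. snd (transition_map c d w) = snd w + (snd (transition_map c d z) - snd z)"
      unfolding cd by (rule adapted_transition) (use c d z cd in auto)
    \<comment> \<open>The witness for \<open>g\<close> is the translation found above.\<close>
    show "\<exists>W g. open W \<and> z \<in> W \<and> W \<subseteq> transition_domain c d \<and>
          (\<forall>w\<in>W. snd (transition_map c d w) = g (snd w))"
      by (intro exI conjI, rule W(1), rule W(2), rule W(3), rule W(4))
  qed
qed

text \<open>In an adapted chart horizontal lines through \<open>b\<close> lie in its plaque and
  vertical ones in its fiber. Their directions span the model space, and the derivative of the
  change to an atlas chart is onto.\<close>

lemma transverse_adapted:
  assumes b: "b \<in> topspace (mtop B)"
  shows "transverse_at B (leaf {c. adapted c} b) (fiber B p (p b)) b"
  unfolding transverse_at_def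
proof (intro ballI impI)
  fix c assume c: "c \<in> atlas B" "b \<in> fst c"
  obtain Y \<kappa> where cY: "c = (Y, \<kappa>)" by (cases c)
  obtain O' \<theta> where ad: "adapted (O', \<theta>)" and bO: "b \<in> O'" by (rule ex_adapted[OF b])
  let ?d = "(O', \<theta>)"
  have cc: "compat_chart B ?d" "compat_chart B (Y, \<kappa>)"
    using adapted_compat[OF ad] atlas_compat_chart[OF manifold] c(1) cY by auto
  note ch = cc[THEN compat_chart_is_chart]
  have z: "\<theta> b \<in> transition_domain ?d (Y, \<kappa>)"
    using bO c(2) by (auto simp: transition_domain_def cY)
  obtain D D' where D: "(transition_map ?d (Y, \<kappa>) has_derivative D) (at (\<theta> b))" "\<forall>v. D (D' v) = v"
    "\<forall>v. D' (D v) = v"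
    by (rule transition_derivative_bijective[OF manifold cc z])
  interpret D: bounded_linear D using D(1) by (rule has_derivative_bounded_linear)
  have smooth: "smooth_on (transition_domain ?d (Y, \<kappa>)) (transition_map ?d (Y, \<kappa>))"
    using compat_chart_smoothly_compatible[OF manifold cc] by (simp add: smoothly_compatible_def)
  note tangentI = tangent_spaceI[OF ch smooth bO _ D(1)]
  have bY: "b \<in> Y" using c(2) cY by simp
  have leaf: "D (e, 0) \<in> tangent_space c (leaf {c. adapted c} b) b" for e
    unfolding cY
  proof (rule tangentI[OF bY])
    fix b' t assume b': "b' \<in> O'" "\<theta> b' = \<theta> b + t *\<^sub>R (e, 0)"
    then have "snd (\<theta> b) = snd (\<theta> b')" by simp
    then have "same_plaque {c. adapted c} b b'"
      unfolding same_plaque_def using ad bO b'(1) by (intro bexI[of _ ?d]) simp_all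
    then show "b' \<in> leaf {c. adapted c} b" by (simp add: leaf_def)
  qed
  have fib: "D (0, s) \<in> tangent_space c (fiber B p (p b)) b" for s
    unfolding cY
  proof (rule tangentI[OF bY])
    fix b' t assume b': "b' \<in> O'" "\<theta> b' = \<theta> b + t *\<^sub>R (0, s)"
    then have "fst (\<theta> b') = fst (\<theta> b)" by simp
    then have "p b' = p b" using ad bO b'(1) unfolding adapted_def by blast
    then show "b' \<in> fiber B p (p b)"
      using b'(1) openin_subset[OF chart_openin[OF ch(1)]] by (auto simp: fiber_def)
  qed
  have "w \<in> {u + v |u v. u \<in> tangent_space c (leaf {c. adapted c} b) b \<and>
      v \<in> tangent_space c (fiber B p (p b)) b}" for w
  proof -
    obtain e s where es: "D' w = (e, s)" by (cases "D' w")
    have "w = D (e, 0) + D (0, s)" using D(2) es D.add[of "(e, 0)" "(0, s)"] by (metis add_Pair add_0 add.right_neutral)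
    then show ?thesis using leaf fib by blast
  qed
  then show "{u + v |u v. u \<in> tangent_space c (leaf {c. adapted c} b) b \<and>
      v \<in> tangent_space c (fiber B p (p b)) b} = UNIV" by blast
qed

lemma smoothly_foliated: "smoothly_foliated B p"
  unfolding smoothly_foliated_def using codim1_foliation_adapted transverse_adapted by blast

end

text \<open>The product in \<open>difference_derivative_sign\<close> is positive, so its factor
  \<open>A.\<epsilon>\<close> cannot be zero once \<open>C.\<epsilon>\<close> is nonzero.\<close>

lemma fiber_period_nonzero_transfer:
  assumes "circle_bundle_cocycle B p M V \<phi> a R \<Psi> \<zeta> l" "circle_bundle_cocycle B p M V' \<phi>' a' R' \<Psi>' \<zeta>' l"
    and q: "q \<in> base_nbhd V \<phi> a R" "q \<in> base_nbhd V' \<phi>' a' R'" and period: "fiber_period l a' \<Psi>' \<noteq> 0"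
  shows "fiber_period l a \<Psi> \<noteq> 0"
proof -
  interpret circle_bundle_cocycle_pair B p M V \<phi> a R \<Psi> \<zeta> V' \<phi>' a' R' \<Psi>' \<zeta>' l
    using assms(1,2) by (simp add: circle_bundle_cocycle_pair_def)
  have "(\<phi> q, 0) \<in> overlap"
    using overlap_Pair[OF A.coord_base(2)[OF q(1)]] A.coord_base(3)[OF q(1)] q(2) by simp
  from difference_derivative_sign[OF this period] show ?thesis by auto
qed

theorem theorem17:
  fixes B :: "('b, 'e::model_space \<times> real) manifold"
    and p :: "'b \<Rightarrow> 'a"
    and M :: "('a, 'e) manifold"
    and x :: 'a
    and h :: "complex \<Rightarrow> 'b"
  assumes "closed_manifold M"
    and "connected_space (mtop M)"
    and "smooth_circle_bundle B p M"
    and "x \<in> topspace (mtop M)"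
    and "homeomorphic_map (mtop circle) (subtopology (mtop B) (fiber B p x)) h"
    and "circle_class (mtop B) h \<noteq> \<one>\<^bsub>real_homology_group 1 (mtop B)\<^esub>"
  shows "smoothly_foliated B p"
proof -
  let ?X = "topspace (mtop M)"
  obtain l where l: "path_cocycle (mtop B) l" "l (\<lambda>s. h (cis (2 * pi * s))) \<noteq> 0"
    by (rule path_cocycle_of_circle_class[OF assms(6)])
  have "\<forall>y\<in>?X. \<exists>V \<phi> R \<Psi> \<zeta>. circle_bundle_chart B p M V \<phi> (\<phi> y) R \<Psi> \<zeta> \<and> y \<in> V"
    using ex_circle_bundle_chart[OF assms(3)] by metis
  then obtain V \<phi> R \<Psi> \<zeta> where
    chart: "\<And>y. y \<in> ?X \<Longrightarrow> circle_bundle_chart B p M (V y) (\<phi> y) (\<phi> y y) (R y) (\<Psi> y) (\<zeta> y)"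
    and yV: "\<And>y. y \<in> ?X \<Longrightarrow> y \<in> V y"
    by metis
  \<comment> \<open>Each point is the center of its own ball, so it lies in the neighborhoods of
    either radius.\<close>
  define a where "a y = \<phi> y y" for y
  let ?U = "\<lambda>y. base_nbhd (V y) (\<phi> y) (a y) (R y)"
  let ?U' = "\<lambda>y. base_nbhd (V y) (\<phi> y) (a y) (R y / 2)"
  let ?\<epsilon> = "\<lambda>y. fiber_period l (a y) (\<Psi> y)"
  have cocycle_at: "circle_bundle_cocycle B p M (V y) (\<phi> y) (a y) (R y) (\<Psi> y) (\<zeta> y) l" if "y \<in> ?X" for y
    using chart[OF that] l(1)
    by (simp add: circle_bundle_cocycle_def circle_bundle_cocycle_axioms_def a_def)
  have U: "openin (mtop M) (?U y)" "y \<in> ?U y" "openin (mtop M) (?U' y)" "y \<in> ?U' y" if y: "y \<in> ?X" for y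
  proof -
    interpret circle_bundle_cocycle B p M "V y" "\<phi> y" "a y" "R y" "\<Psi> y" "\<zeta> y" l
      by (rule cocycle_at[OF y])
    have half: "ball (a y) (R y / 2) \<subseteq> \<phi> y ` V y" using chart(2,3) by auto
    show "openin (mtop M) (?U y)" by (rule openin_base_nbhd)
    show "openin (mtop M) (?U' y)" by (rule base_nbhd_openin[OF chart_V half])
    show "y \<in> ?U y" "y \<in> ?U' y"
      unfolding base_nbhd_eq[OF chart_V chart(3)] base_nbhd_eq[OF chart_V half]
      using yV[OF y] chart(2) by (auto simp: a_def)
  qed
  have period: "?\<epsilon> y \<noteq> 0" if "y \<in> ?X" for y
  proof -
    \<comment> \<open>Periods over overlapping neighborhoods vanish together. Thus the neighborhoods
      of points of \<open>E\<close> and those of the other points have disjoint open unions covering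
      the connected base, and the former contains \<open>x\<close>.\<close>
    define E where "E = {y \<in> ?X. ?\<epsilon> y \<noteq> 0}"
    interpret circle_bundle_cocycle B p M "V x" "\<phi> x" "a x" "R x" "\<Psi> x" "\<zeta> x" l
      by (rule cocycle_at[OF assms(4)])
    have "?\<epsilon> x \<noteq> 0"
      by (rule fiber_period_nonzero[OF U(2)[OF assms(4)] homeomorphic_imp_continuous_map[OF assms(5)] l(2)])
    then have "x \<in> E" using assms(4) by (simp add: E_def)
    then have ne: "(\<Union>y\<in>E. ?U y) \<noteq> {}" using U(2)[OF assms(4)] by blast
    have "(\<Union>y\<in>E. ?U y) \<inter> (\<Union>y\<in>?X - E. ?U y) = {}"
    proof (rule equals0I)
      fix q assume "q \<in> (\<Union>y\<in>E. ?U y) \<inter> (\<Union>y\<in>?X - E. ?U y)"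
      then obtain y y' where y: "y \<in> ?X" "?\<epsilon> y \<noteq> 0" "q \<in> ?U y" and y': "y' \<in> ?X" "?\<epsilon> y' = 0" "q \<in> ?U y'"
        by (auto simp: E_def)
      from fiber_period_nonzero_transfer[OF cocycle_at[OF y'(1)] cocycle_at[OF y(1)] y'(3) y(3,2)] y'(2)
      show False by simp
    qed
    moreover have "openin (mtop M) (\<Union>y\<in>E. ?U y)" "openin (mtop M) (\<Union>y\<in>?X - E. ?U y)"
      by (intro openin_clauses(3) ballI; use U(1) in \<open>auto simp: E_def\<close>)+
    moreover have "?X \<subseteq> (\<Union>y\<in>E. ?U y) \<union> (\<Union>y\<in>?X - E. ?U y)" using U(2) by blast
    ultimately have "(\<Union>y\<in>?X - E. ?U y) = {}"
      using assms(2) ne unfolding connected_space_def by meson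
    then have "?X - E = {}" using U(2) by blast
    with that show ?thesis by (auto simp: E_def)
  qed
  \<comment> \<open>Compactness is applied to the balls of half radius, as the covering condition of
    the family demands; the centers of the selected balls become the index set.\<close>
  have "\<exists>\<F>. finite \<F> \<and> \<F> \<subseteq> ?U' ` ?X \<and> ?X \<subseteq> \<Union>\<F>"
  proof -
    have "compact_space (mtop M)" using assms(1) by (simp add: closed_manifold_def)
    from mp[OF spec[OF this[unfolded compact_space_alt], of "?U' ` ?X"]]
    show ?thesis using U(3,4) by blast
  qed
  then obtain \<F> where \<F>: "finite \<F>" "\<F> \<subseteq> ?U' ` ?X" "?X \<subseteq> \<Union>\<F>" by blast
  obtain K where K: "K \<subseteq> ?X" "finite K" "\<F> = ?U' ` K"
    using finite_subset_image[OF \<F>(1,2)] by blast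
  have "circle_bundle_family B p M K V \<phi> a R \<Psi> \<zeta> l"
  proof (rule circle_bundle_family.intro)
    show "smooth_manifold B" using assms(3) by (simp add: smooth_circle_bundle_def)
    show "p b \<in> ?X" if "b \<in> topspace (mtop B)" for b
      using assms(3) that continuous_map_image_subset_topspace
      unfolding smooth_circle_bundle_def smooth_map_def by blast
    show "\<exists>y\<in>K. q \<in> ?U' y" if "q \<in> ?X" for q using that \<F>(3) unfolding K(3) by blast
  qed (use K(1,2) cocycle_at period in auto)
  then show ?thesis by (rule circle_bundle_family.smoothly_foliated)
qed

end
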